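(* Let $\mathcal{K}^n$ ($n\ge 0$) be the chromatic derivatives associated with the Legendre polynomials, let $\mathrm{j}_n$ be the spherical Bessel function of the first kind of order $n$, and let $f$ be an arbitrary entire function. Then for all $z,u\in\mathbb{C}$, $$f(z)=\sum_{n=0}^{\infty}\mathcal{K}^n[f](u)\,\mathcal{K}^n_u[\mathrm{sinc}(z-u)]=\sum_{n=0}^{\infty}(-1)^n\,\mathcal{K}^n[f](u)\,\mathcal{K}^n[\mathrm{sinc}](z-u)=\sum_{n=0}^{\infty}\mathcal{K}^n[f](u)\,\sqrt{2n+1}\;\mathrm{j}_n(\pi(z-u)).$$ Moreover, if $f\in\mathbf{BL}(\pi)$, then the series (as a series of functions of $z$) converges uniformly on $\mathbb{R}$ and also converges with respect to the $L^2$ norm of the space $\mathbf{BL}(\pi)$.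
   Context: $\mathrm{sinc}(t)=\sin(\pi t)/(\pi t)$ (with $\mathrm{sinc}(0)=1$), an entire function. $\mathbf{BL}(\pi)$ is the Hilbert space of real valued continuous $L^2(\mathbb{R})$ functions whose Fourier transform is supported in $[-\pi,\pi]$, with the usual scalar product; each such function is identified with the entire function of which it is the restriction to $\mathbb{R}$. Let $p^L_n(\omega)$ be the polynomials obtained by scaling and normalizing the Legendre polynomials $P_n$, $p_n^L(\omega)=\sqrt{2n+1}\,P_n(\omega/\pi)$, so that $\frac{1}{2\pi}\int_{-\pi}^{\pi}p^L_n(\omega)p^L_m(\omega)\,d\omega=\delta(m-n)$, where $\delta(0)=1$ and $\delta(k)=0$ for $k\ne0$. The chromatic derivatives associated with the Legendre polynomials are the differential operators $\mathcal{K}^n_t=\mathrm{i}^n p^L_n\left(-\mathrm{i}\frac{d}{dt}\right)$, i.e. $\omega^k$ in $p_n^L(\omega)$ is replaced by $(-\mathrm{i})^k\,d^k/dt^k$ and the result is multiplied by $\mathrm{i}^n$. The subscript indicates the variable of differentiation and is dropped when the operator is applied to a function of a single variable; $\mathcal{K}^n[f](u)$ is the value at $u$ of $\mathcal{K}^n$ applied to $f$. *)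

theory Defs
  imports "HOL-Complex_Analysis.Complex_Analysis"
begin

definition csinc :: "complex \<Rightarrow> complex" where
  "csinc t = (if t = 0 then 1 else sin (of_real pi * t) / (of_real pi * t))"

(* Rodrigues' formula *)
definition legendre_poly :: "nat \<Rightarrow> real poly" where
  "legendre_poly n = smult (1 / (2 ^ n * fact n)) ((pderiv ^^ n) ([:-1, 0, 1:] ^ n))"

definition legendre_poly_normalized :: "nat \<Rightarrow> real poly" where
  "legendre_poly_normalized n =
     smult (sqrt (2 * real n + 1)) (pcompose (legendre_poly n) [:0, 1 / pi:])"

definition chromatic_deriv :: "nat \<Rightarrow> (complex \<Rightarrow> complex) \<Rightarrow> complex \<Rightarrow> complex" where
  "chromatic_deriv n f u =
     \<i> ^ n * (\<Sum>k\<le>degree (legendre_poly_normalized n).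
       of_real (coeff (legendre_poly_normalized n) k) * ((- \<i>) ^ k * (deriv ^^ k) f u))"

definition bessel_J :: "complex \<Rightarrow> complex \<Rightarrow> complex" where
  "bessel_J \<nu> z =
     (z / 2) powr \<nu> * (\<Sum>k. (- 1) ^ k / fact k * rGamma (\<nu> + of_nat k + 1) * (z / 2) ^ (2 * k))"

(* j_n(z) = sqrt (pi / (2 z)) J_{n+1/2}(z).  The factor is written as sqrt (pi / 2) / sqrt z so that
   its branch cut cancels against the one of (z / 2) powr (n + 1/2), also for negative real z.
   The value at 0 is the limit. *)
definition spherical_bessel_j :: "nat \<Rightarrow> complex \<Rightarrow> complex" where
  "spherical_bessel_j n z =
     (if z = 0 then (if n = 0 then 1 else 0)
      else of_real (sqrt (pi / 2)) / csqrt z * bessel_J (of_nat n + 1 / 2) z)"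

definition square_integrable :: "(real \<Rightarrow> 'a :: {real_normed_vector, second_countable_topology}) \<Rightarrow> bool" where
  "square_integrable g \<longleftrightarrow> g \<in> borel_measurable lborel \<and> integrable lborel (\<lambda>x. (norm (g x))\<^sup>2)"

(* Convergence in the L2 norm.  The squared norm is taken in ennreal, so that it is infinite
   (and not 0 by convention) when the difference is not square integrable. *)
definition L2_tendsto :: "('i \<Rightarrow> real \<Rightarrow> complex) \<Rightarrow> (real \<Rightarrow> complex) \<Rightarrow> 'i filter \<Rightarrow> bool" where
  "L2_tendsto g h F \<longleftrightarrow> ((\<lambda>i. \<integral>\<^sup>+x. ennreal ((norm (g i x - h x))\<^sup>2) \<partial>lborel) \<longlongrightarrow> 0) F"

(* The Fourier transform on L2 (Plancherel): the L2 limit of the truncated Fourier integrals. *)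
definition has_L2_fourier_transform :: "(real \<Rightarrow> real) \<Rightarrow> (real \<Rightarrow> complex) \<Rightarrow> bool" where
  "has_L2_fourier_transform g G \<longleftrightarrow>
     square_integrable G \<and>
     L2_tendsto
       (\<lambda>R \<omega>. LINT t:{-R..R}|lborel. exp (- (\<i> * of_real \<omega> * of_real t)) * of_real (g t)) G at_top"

definition BL_pi_real :: "(real \<Rightarrow> real) set" where
  "BL_pi_real =
     {g. continuous_on UNIV g \<and> square_integrable g \<and>
         (\<exists>G. has_L2_fourier_transform g G \<and>
              (AE \<omega> in lborel. \<omega> \<notin> {-pi..pi} \<longrightarrow> G \<omega> = 0))}"

(* The space BL(pi), whose members are identified with the entire functions extending them. *)
definition BL_pi :: "(complex \<Rightarrow> complex) set" where
  "BL_pi =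
     {f. f holomorphic_on UNIV \<and> (\<exists>g\<in>BL_pi_real. \<forall>x. f (of_real x) = of_real (g x))}"

end

theory Submission
  imports Defs "HOL-Probability.Probability" "HOL-Real_Asymp.Real_Asymp"
begin

text \<open>
Let \<open>p\<^sub>n\<close> be the Legendre polynomials normalized on \<open>[-\<pi>, \<pi>]\<close>, and let the kernel \<open>k\<^sub>n(w)\<close> be
\<open>(-\<i>)\<^sup>n / (2\<pi>)\<close> times the integral of \<open>p\<^sub>n(\<omega>) exp(\<i>\<omega>w)\<close> over \<open>[-\<pi>, \<pi>]\<close>.  The three series have the same
terms \<open>K\<^sup>n[f](u) k\<^sub>n(z - u)\<close>.  Indeed \<open>sinc\<close> is the Fourier--Laplace transform of the constant
\<open>1/(2\<pi>)\<close> on \<open>[-\<pi>, \<pi>]\<close>, and \<open>K\<^sup>n\<close> acts on such a transform by multiplying the transformed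
function by \<open>\<i>\<^sup>n p\<^sub>n(\<omega>)\<close>; the parity of \<open>p\<^sub>n\<close> takes care of the reflection \<open>z - u\<close>.  The power series
of \<open>k\<^sub>n\<close>, computed from Rodrigues' formula, is the one of \<open>sqrt (2n+1) j\<^sub>n(\<pi>w)\<close>
(\<open>chromatic_kernel_eq_spherical_bessel\<close>).

Pointwise convergence for an arbitrary entire function is a rearrangement of its Taylor series.
The coefficient of \<open>w\<^sup>m\<close> in \<open>k\<^sub>n(w)\<close> is, up to the factor \<open>(-\<i>)\<^sup>n \<i>\<^sup>m / m!\<close>, the moment of \<open>p\<^sub>n\<close> against
\<open>\<omega>\<^sup>m\<close>.  It vanishes for \<open>m < n\<close>, and \<open>\<omega>\<^sup>m\<close> is the sum over \<open>n \<le> m\<close> of these moments times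
\<open>p\<^sub>n\<close>.  Hence the coefficients of \<open>w\<^sup>m\<close> in the expansion form a finite sum, equal to the
\<open>m\<close>-th Taylor coefficient of \<open>f\<close> at \<open>u\<close> (\<open>chromatic_taylor_coefficient\<close>).  The rearrangement is
legitimate since Cauchy's inequality on a circle of radius \<open>R\<close> bounds \<open>K\<^sup>n[f](u)\<close> by
\<open>C (2n+1) (4/R)\<^sup>n n!\<close>, the moments are at most \<open>\<pi>\<^sup>m\<close>, and \<open>R\<close> is arbitrary
(\<open>chromatic_deriv_bound\<close>, \<open>triangular_series_sums\<close>).

Now let \<open>f\<close> be in \<open>BL(\<pi>)\<close>.  Fourier inversion represents \<open>f\<close> as the Fourier--Laplace transform of a
square-integrable \<open>D\<close> supported in \<open>[-\<pi>, \<pi>]\<close>.  Up to a constant factor, the numbers \<open>K\<^sup>n[f](u)\<close> have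
the absolute values of the Legendre coefficients of \<open>D(\<omega>) exp(\<i>\<omega>u)\<close>, so Bessel's inequality makes
them square-summable.  Bessel's inequality for \<open>exp(\<i>\<omega>w)\<close> bounds the sum of all \<open>|k\<^sub>n(w)|\<^sup>2\<close> by \<open>exp(2\<pi>|Im w|)\<close>, which is constant for
\<open>w = z - u\<close> with real \<open>z\<close>; the Cauchy--Schwarz inequality then gives uniform convergence.  Finite
combinations of the kernels \<open>k\<^sub>n(z - u)\<close> are Fourier--Laplace transforms of finite combinations of the
\<open>p\<^sub>n\<close>, multiplied by \<open>exp(-\<i>\<omega>u)\<close> and cut off outside \<open>[-\<pi>, \<pi>]\<close>, so the Plancherel inequality bounds the mean-square norm of a block of the series by the
square sum of its coefficients, up to a constant factor.  As the partial sums are already known to converge to \<open>f\<close>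
pointwise, Fatou's lemma turns this bound into convergence to \<open>f\<close> in the mean.

The Plancherel inequality, and the equality for almost everywhere continuous spectra, come from one
computation: the integral of \<open>|F(x)|\<^sup>2\<close> against a Gaussian of large width, where \<open>F\<close> is the transform
of \<open>D\<close>, equals a double integral of \<open>D(\<omega>)\<close> and the conjugate of \<open>D(\<omega> + \<sigma>s)\<close> against a Gaussian
in \<open>s\<close> (\<open>gauss_weighted_plancherel\<close>).  Fourier inversion uses the same Gaussian as a multiplier, and
the equality shows that the terms of the series belong to \<open>BL(\<pi>)\<close>.
\<close>

section \<open>Legendre polynomials\<close>

lemma coeff_quadratic_power_bound:
  "\<bar>coeff ([:-1, 0, 1:] ^ n :: real poly) k\<bar> \<le> 2 ^ n"
proof (induction n arbitrary: k)
  case 0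
  then show ?case by (simp add: coeff_1)
next
  case (Suc n)
  let ?q = "[:-1, 0, 1:] ^ n :: real poly"
  have "coeff ([:-1, 0, 1:] * ?q) k = - coeff ?q k + (if k < 2 then 0 else coeff ?q (k - 2))"
    by (cases k; cases "k - 1") (auto simp: coeff_pCons split: nat.splits)
  then show ?case using Suc[of k] Suc[of "k - 2"] by (auto split: if_splits)
qed

lemma coeff_quadratic_power_odd:
  "odd k \<Longrightarrow> coeff ([:-1, 0, 1:] ^ n :: real poly) k = 0"
proof (induction n arbitrary: k)
  case 0
  then show ?case using odd_pos[of k] by (simp add: coeff_1)
next
  case (Suc n)
  let ?q = "[:-1, 0, 1:] ^ n :: real poly"
  have "coeff ([:-1, 0, 1:] * ?q) k = - coeff ?q k + (if k < 2 then 0 else coeff ?q (k - 2))"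
    by (cases k; cases "k - 1") (auto simp: coeff_pCons split: nat.splits)
  then show ?case using Suc.IH[of k] Suc.IH[of "k - 2"] Suc.prems odd_pos[of k] by auto
qed

lemma degree_quadratic_power: "degree ([:-1, 0, 1:] ^ n :: real poly) = 2 * n"
  by (simp add: degree_power_eq)

text \<open>Rodrigues' formula turns the coefficients of a power of \<open>x\<^sup>2 - 1\<close>, which vanish in odd degree
  and are at most \<open>2\<^sup>n\<close>, into those of the Legendre polynomial.  This yields their parity and size.\<close>

lemma coeff_legendre:
  "coeff (legendre_poly n) k
     = real (fact (n + k)) / (2 ^ n * fact n * fact k) * coeff ([:-1, 0, 1:] ^ n) (n + k)"
proof -
  have "pochhammer (1 + real k) n = fact (n + k) / fact k"
    using pochhammer_product'[of "1 :: real" k n] by (simp add: add_ac field_simps flip: pochhammer_fact)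
  then show ?thesis
    by (simp add: legendre_poly_def coeff_higher_pderiv add_ac)
qed

lemma degree_legendre: "degree (legendre_poly n) = n"
proof (rule antisym)
  show "degree (legendre_poly n) \<le> n"
    by (rule degree_le) (auto simp: coeff_legendre intro!: coeff_eq_0 simp: degree_quadratic_power)
  have "coeff ([:-1, 0, 1:] ^ n :: real poly) (n + n) = 1"
    using lead_coeff_power[of "[:-1, 0, 1:] :: real poly" n] by (simp add: degree_quadratic_power mult_2)
  then have "coeff (legendre_poly n) n \<noteq> 0" by (simp add: coeff_legendre)
  then show "n \<le> degree (legendre_poly n)" by (rule le_degree)
qed

lemma lead_coeff_legendre: "coeff (legendre_poly n) n = fact (2 * n) / (2 ^ n * (fact n)\<^sup>2)"
proof -
  have "coeff ([:-1, 0, 1:] ^ n :: real poly) (n + n) = 1"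
    using lead_coeff_power[of "[:-1, 0, 1:] :: real poly" n] by (simp add: degree_quadratic_power mult_2)
  then show ?thesis by (simp add: coeff_legendre mult_2 power2_eq_square)
qed

lemma coeff_legendre_parity: "odd (n + k) \<Longrightarrow> coeff (legendre_poly n) k = 0"
  by (simp add: coeff_legendre coeff_quadratic_power_odd)

text \<open>The factor produced by differentiating is the binomial coefficient of \<open>n + k\<close> over \<open>n\<close>, at most
  \<open>2\<^sup>n\<^sup>+\<^sup>k\<close>; the powers of 2 in Rodrigues' formula and in the bound on the coefficients cancel.\<close>

lemma coeff_legendre_bound: "\<bar>coeff (legendre_poly n) k\<bar> \<le> 4 ^ n"
proof (cases "k \<le> n")
  case True
  have "\<bar>coeff (legendre_poly n) k\<bar>
      = real ((n + k) choose n) / 2 ^ n * \<bar>coeff ([:-1, 0, 1:] ^ n :: real poly) (n + k)\<bar>"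
    by (simp add: coeff_legendre binomial_fact abs_mult)
  also have "\<dots> \<le> real ((n + k) choose n) / 2 ^ n * 2 ^ n"
    by (intro mult_left_mono coeff_quadratic_power_bound) simp
  also have "\<dots> = real ((n + k) choose n)" by simp
  also have "\<dots> \<le> real (2 ^ (n + k))"
    using binomial_le_pow2 by (intro of_nat_mono) 
  also have "\<dots> \<le> 2 ^ (n + n)" using True by (simp add: power_increasing del: power_add)
  also have "\<dots> = 4 ^ n" by (simp add: power_add flip: power_mult_distrib)
  finally show ?thesis .
next
  case False
  then show ?thesis by (simp add: coeff_eq_0 degree_legendre)
qed

text \<open>The inner product \<open>mean (p * q)\<close> is the one for which the Legendre polynomials are orthogonal.  The factor
  \<open>1/2\<close> makes it a mean value, in accordance with the factor \<open>1/(2\<pi>)\<close> on \<open>[-\<pi>, \<pi>]\<close>.\<close>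

definition mean :: "real poly \<Rightarrow> real" where
  "mean p = (LINT x:{-1..1}|lborel. poly p x) / 2"

lemma poly_integrable_Icc: "set_integrable lborel {a..b} (\<lambda>x. poly p x :: real)"
  by (intro borel_integrable_atLeastAtMost') (intro continuous_intros)

lemma mean_add: "mean (p + q) = mean p + mean q"
  by (simp add: mean_def set_integral_add poly_integrable_Icc add_divide_distrib)

lemma mean_smult: "mean (smult c p) = c * mean p"
  by (simp add: mean_def)

lemma mean_0: "mean 0 = 0"
  by (simp add: mean_def)

lemma mean_diff: "mean (p - q) = mean p - mean q"
  using mean_add[of p "smult (-1) q"] mean_smult[of "-1" q] by simp

lemma mean_sum: "mean (\<Sum>i\<in>A. f i) = (\<Sum>i\<in>A. mean (f i))"
  by (induction A rule: infinite_finite_induct) (simp_all add: mean_0 mean_add)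

lemma mean_pderiv: "mean (pderiv p) = (poly p 1 - poly p (- 1)) / 2"
proof -
  have "(LINT x|lborel. poly (pderiv p) x * indicator {-1..1} x) = poly p 1 - poly p (- 1)"
    by (rule integral_FTC_Icc_real) (auto intro: poly_DERIV)
  then show ?thesis by (simp add: mean_def set_lebesgue_integral_def mult.commute)
qed

lemma quadratic_power_dvd_higher_pderiv:
  "k \<le> n \<Longrightarrow> ([:-1, 0, 1:] :: real poly) ^ (n - k) dvd (pderiv ^^ k) ([:-1, 0, 1:] ^ n)"
proof (induction k)
  case 0
  then show ?case by simp
next
  case (Suc k)
  let ?q = "[:-1, 0, 1:] :: real poly"
  from Suc obtain r where r: "(pderiv ^^ k) (?q ^ n) = ?q ^ (n - k) * r" by (auto elim: dvdE)
  have [simp]: "n - k = Suc (n - Suc k)" using Suc.prems by simp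
  have "(pderiv ^^ Suc k) (?q ^ n)
      = ?q ^ (n - Suc k) * (?q * pderiv r + smult (of_nat (n - k)) (pderiv ?q * r))"
    by (simp add: r pderiv_mult pderiv_power_Suc smult_add_right algebra_simps
          del: pderiv_pCons mult_pCons_left mult_pCons_right of_nat_Suc of_nat_diff power_Suc)
       (rule disjI2, rule power_Suc)
  then show ?case by (metis dvd_triv_left)
qed

text \<open>The boundary terms vanish since every derivative of order less than \<open>n\<close> of \<open>(x\<^sup>2 - 1)\<^sup>n\<close> still
  contains a factor \<open>x\<^sup>2 - 1\<close>.\<close>

lemma mean_by_parts:
  assumes "k \<le> n"
  shows "mean ((pderiv ^^ n) ([:-1, 0, 1:] ^ n) * r)
           = (-1) ^ k * mean ((pderiv ^^ (n - k)) ([:-1, 0, 1:] ^ n) * (pderiv ^^ k) r)"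
  using assms
proof (induction k)
  case 0
  then show ?case by simp
next
  case (Suc k)
  define h :: "real poly" where "h = (pderiv ^^ (n - Suc k)) ([:-1, 0, 1:] ^ n)"
  have "[:-1, 0, 1:] dvd ([:-1, 0, 1:] :: real poly) ^ (n - (n - Suc k))"
    using Suc.prems by (intro dvd_power) auto
  also have "\<dots> dvd h" unfolding h_def by (rule quadratic_power_dvd_higher_pderiv) auto
  finally have "poly h 1 = 0" "poly h (- 1) = 0" by (auto elim!: dvdE)
  then have "mean (pderiv (h * (pderiv ^^ k) r)) = 0" by (simp add: mean_pderiv)
  then have "mean (pderiv h * (pderiv ^^ k) r) = - mean (h * (pderiv ^^ Suc k) r)"
    by (simp add: pderiv_mult mean_add mult.commute)
  moreover have "pderiv h = (pderiv ^^ (n - k)) ([:-1, 0, 1:] ^ n)"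
    using Suc.prems by (simp add: h_def Suc_diff_Suc flip: funpow_Suc_right)
      (metis Suc_diff_Suc Suc_le_lessD comp_apply funpow.simps(2))
  ultimately show ?case using Suc by (simp add: h_def)
qed

lemma mean_legendre_mult:
  "mean (legendre_poly n * r) = mean ([:1, 0, -1:] ^ n * (pderiv ^^ n) r) / (2 ^ n * fact n)"
proof -
  have "[:1, 0, -1:] ^ n = smult ((-1) ^ n) ([:-1, 0, 1:] ^ n :: real poly)"
    by (simp flip: smult_power)
  then show ?thesis
    using mean_by_parts[of n n r] by (simp add: legendre_poly_def mean_smult)
qed

lemma Gamma_real_plus1: "x > 0 \<Longrightarrow> Gamma (x + 1 :: real) = x * Gamma x"
  by (intro Gamma_plus1) (auto elim!: nonpos_Ints_cases)

lemma Gamma_half_integer: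
  "Gamma (real k + 1 / 2) = sqrt pi * fact (2 * k) / (4 ^ k * fact k)"
proof (induction k)
  case 0
  then show ?case by (simp add: Gamma_one_half_real)
next
  case (Suc k)
  have "Gamma (real (Suc k) + 1 / 2) = (real k + 1 / 2) * Gamma (real k + 1 / 2)"
    using Gamma_real_plus1[of "real k + 1 / 2"] by (simp add: add_ac)
  also have "\<dots> = sqrt pi * fact (2 * Suc k) / (4 ^ Suc k * fact (Suc k))"
    unfolding Suc by (simp add: divide_simps) (simp add: algebra_simps)
  finally show ?case .
qed

lemma monom_square_mult: "monom 1 (2 * k) * [:1, 0, -1 :: real:] = monom 1 (2 * k) - monom 1 (2 * Suc k)"
proof -
  have "[:1, 0, -1 :: real:] = monom 1 0 - monom 1 2" by (simp add: monom_altdef numeral_2_eq_2 one_pCons)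
  then show ?thesis by (simp add: right_diff_distrib mult_monom)
qed

text \<open>A Beta integral.  Multiplying by one more factor \<open>1 - x\<^sup>2\<close> is a difference of two integrals
  with smaller \<open>n\<close>, so that the functional equation of the Gamma function gives an induction over \<open>n\<close>.\<close>

lemma mean_beta:
  "mean ([:1, 0, -1:] ^ n * monom 1 (2 * k))
     = Gamma (real k + 1 / 2) * fact n / (2 * Gamma (real n + real k + 3 / 2))"
proof (induction n arbitrary: k)
  case 0
  have "pderiv (smult (1 / (2 * real k + 1)) (monom 1 (Suc (2 * k)))) = monom 1 (2 * k)"
    by (simp add: pderiv_smult pderiv_monom smult_monom)
  then have mean: "mean (monom 1 (2 * k)) = 1 / (2 * real k + 1)"
    using mean_pderiv[of "smult (1 / (2 * real k + 1)) (monom 1 (Suc (2 * k)))"]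
    by (simp add: poly_monom field_simps)
  have step: "Gamma (real 0 + real k + 3 / 2) = (real k + 1 / 2) * Gamma (real k + 1 / 2)"
    using Gamma_real_plus1[of "real k + 1 / 2"] by (simp add: add_ac)
  have "Gamma (real k + 1 / 2) \<noteq> 0"
    using Gamma_real_pos[of "real k + 1 / 2"] by linarith
  then show ?case unfolding step
    by (simp add: mean)
next
  case (Suc n)
  have "mean ([:1, 0, -1:] ^ Suc n * monom 1 (2 * k))
      = mean ([:1, 0, -1:] ^ n * monom 1 (2 * k)) - mean ([:1, 0, -1:] ^ n * monom 1 (2 * Suc k))"
    unfolding mean_diff[symmetric] right_diff_distrib[symmetric] monom_square_mult[symmetric]
    by (simp only: power_Suc2 mult_ac)
  moreover have "Gamma (real n + real (Suc k) + 3 / 2)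
      = (real n + real k + 3 / 2) * Gamma (real n + real k + 3 / 2)"
    using Gamma_real_plus1[of "real n + real k + 3 / 2"] by (simp add: add_ac)
  moreover have "Gamma (real (Suc k) + 1 / 2) = (real k + 1 / 2) * Gamma (real k + 1 / 2)"
    using Gamma_real_plus1[of "real k + 1 / 2"] by (simp add: add_ac)
  moreover have "G * F / (2 * X) - (b * G) * F / (2 * (a * X)) = G * ((a - b) * F) / (2 * (a * X))"
    if "X \<noteq> 0" "a \<noteq> 0" for a b G F X :: real
    using that by (simp add: field_simps)
  note this[of "Gamma (real n + real k + 3 / 2)" "real n + real k + 3 / 2"]
  moreover have "Gamma (real n + real k + 3 / 2) \<noteq> 0"
    using Gamma_real_pos[of "real n + real k + 3 / 2"] by linarith
  moreover have "real n + real k + 3 / 2 \<noteq> 0" "real n + real k + 3 / 2 - (real k + 1 / 2) = real (Suc n)"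
    by linarith+
  moreover have "real (Suc n) + real k + 3 / 2 = real n + real (Suc k) + 3 / 2"
    by simp
  ultimately show ?case
    unfolding Suc.IH by (simp only: fact_Suc of_nat_mult not_False_eq_True)
qed

lemma higher_pderiv_eq_0: "degree (r :: real poly) < n \<Longrightarrow> (pderiv ^^ n) r = 0"
  by (rule poly_eqI) (simp add: coeff_higher_pderiv coeff_eq_0)

lemma mean_legendre_orthogonal:
  "mean (legendre_poly n * legendre_poly m) = (if n = m then 1 / (2 * real n + 1) else 0)"
proof -
  have ne: "mean (legendre_poly n * legendre_poly m) = 0" if "m < n" for m n
    using that by (simp add: mean_legendre_mult higher_pderiv_eq_0 degree_legendre mean_0)
  have "(pderiv ^^ n) (legendre_poly n) = [:fact n * coeff (legendre_poly n) n:]"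
    by (rule poly_eqI)
       (auto simp: coeff_higher_pderiv coeff_pCons coeff_eq_0 degree_legendre simp flip: pochhammer_fact split: nat.splits)
  then have "mean (legendre_poly n * legendre_poly n)
       = mean ([:1, 0, -1:] ^ n) * coeff (legendre_poly n) n / 2 ^ n"
    by (simp add: mean_legendre_mult mean_smult mult.commute)
  also have "mean ([:1, 0, -1:] ^ n) = sqrt pi * fact n / (2 * Gamma (real (Suc n) + 1 / 2))"
    using mean_beta[of n 0] by (simp add: Gamma_one_half_real add_ac)
  also have "\<dots> * coeff (legendre_poly n) n / 2 ^ n = 1 / (2 * real n + 1)"
    unfolding Gamma_half_integer lead_coeff_legendre
    using power_mult_distrib[of "2 :: real" 2 n]
    by (simp add: divide_simps power2_eq_square)
  finally show ?thesis
    using ne[of m n] ne[of n m] by (cases n m rule: linorder_cases) (simp_all add: mult.commute)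
qed

text \<open>These numbers become the coefficients of the Bessel series.  For odd \<open>m - n\<close> the integrand is odd,
  for \<open>m < n\<close> the \<open>n\<close>-th derivative of the monomial vanishes, and the remaining case is a Beta integral.\<close>

lemma mean_legendre_monom:
  "mean (legendre_poly n * monom 1 m) =
     (if n \<le> m \<and> even (m - n) then
        sqrt pi * fact m / (2 * 2 ^ m * fact ((m - n) div 2)
          * Gamma (real n + real ((m - n) div 2) + 3 / 2)) else 0)"
proof (cases "n \<le> m \<and> even (m - n)")
  case True
  then obtain k where k: "m = n + 2 * k" by (metis evenE le_add_diff_inverse)
  have "(pderiv ^^ n) (monom 1 m) = smult (fact m / fact (2 * k)) (monom (1 :: real) (2 * k))"
    using pochhammer_product'[of "1 :: real" "2 * k" n]
    by (intro poly_eqI) (auto simp: coeff_higher_pderiv k field_simps simp flip: pochhammer_fact)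
  then have "mean (legendre_poly n * monom 1 m) = fact m / fact (2 * k) / (2 ^ n * fact n) *
     (Gamma (real k + 1 / 2) * fact n / (2 * Gamma (real n + real k + 3 / 2)))"
    by (simp add: mean_legendre_mult mean_smult mean_beta)
  then show ?thesis using k True
    unfolding Gamma_half_integer by (simp add: field_simps power_add power_mult power2_eq_square
        flip: power_mult_distrib)
next
  case False
  have "mean (legendre_poly n * monom 1 m) = 0"
  proof (cases "n \<le> m")
    case True
    define r where "r = legendre_poly n * monom 1 m"
    have odd: "coeff r k = 0" if "even k" for k
      using that False True coeff_legendre_parity[of n "k - m"]
      by (auto simp: r_def mult.commute[of _ "monom _ _"] coeff_monom_mult)
    have "coeff r k * (- x) ^ k = - (coeff r k * x ^ k)" for x k
      using odd[of k] by (cases "even k") auto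
    then have "poly r (- x) = - poly r x" for x
      by (simp add: poly_altdef flip: sum_negf)
    then have "indicator {-1..1} (- x) *\<^sub>R poly r (- x) = - (indicator {-1..1} x *\<^sub>R poly r x)" for x
      by (auto simp: indicator_def)
    then have "(LINT x|lborel. indicator {-1..1} x *\<^sub>R poly r x)
        = (LINT x|lborel. - (indicator {-1..1} x *\<^sub>R poly r x))"
      using lborel_integral_real_affine[of "- 1" "\<lambda>x. indicator {-1..1} x *\<^sub>R poly r x" 0] by simp
    then have "mean r = 0"
      by (simp add: mean_def set_lebesgue_integral_def)
    then show ?thesis by (simp add: r_def)
  next
    case nle: False
    then show ?thesis
      by (simp add: mean_legendre_mult higher_pderiv_eq_0 degree_monom_eq mean_0)
  qed
  then show ?thesis using False by auto
qed

section \<open>Gaussian regularization of the Fourier integral\<close>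

text \<open>The sign and the constant are those of the inverse Fourier transform without the factor
  \<open>1/(2\<pi>)\<close>; complex arguments are allowed because the functions of interest have compact support.\<close>

definition fourier_laplace :: "(real \<Rightarrow> complex) \<Rightarrow> complex \<Rightarrow> complex" where
  "fourier_laplace D z = (LINT \<omega>|lborel. D \<omega> * exp (\<i> * of_real \<omega> * z))"

abbreviation gauss :: "real \<Rightarrow> real" where "gauss \<equiv> std_normal_density"

lemma norm_exp_ii_real [simp]: "cmod (exp (\<i> * complex_of_real a * complex_of_real b)) = 1"
  by (simp add: norm_exp_eq_Re)

lemma borel_measurable_cnj [measurable]:
  "f \<in> borel_measurable M \<Longrightarrow> (\<lambda>x. cnj (f x)) \<in> borel_measurable M"
  by (rule borel_measurable_continuous_on[OF continuous_on_cnj[OF continuous_on_id]])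

lemma gauss_le_1: "gauss x \<le> 1"
proof -
  have "gauss x \<le> 1 / sqrt (2 * pi) * 1"
    unfolding std_normal_density_def by (intro mult_left_mono) auto
  also have "\<dots> \<le> 1" using pi_gt3 by simp
  finally show ?thesis .
qed

lemma integral_gauss_exp:
  "(LINT x|lborel. of_real (gauss x) * exp (\<i> * of_real t * of_real x)) = of_real (exp (- t\<^sup>2 / 2))"
proof -
  have "of_real (exp (- t\<^sup>2 / 2)) = char std_normal_distribution t"
    by (simp add: char_std_normal_distribution)
  also have "\<dots> = (LINT x|lborel. gauss x *\<^sub>R iexp (t * x))"
    unfolding char_def by (subst integral_density) auto
  finally show ?thesis by (simp add: scaleR_conv_of_real mult_ac)
qed

lemma integral_gauss_scaled_exp:
  assumes "\<sigma> > 0"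
  shows "(LINT x|lborel. of_real (gauss (\<sigma> * x)) * exp (\<i> * of_real y * of_real x))
           = of_real (sqrt (2 * pi) / \<sigma> * gauss (y / \<sigma>))"
proof -
  have "(LINT x|lborel. of_real (gauss x) * exp (\<i> * of_real (y / \<sigma>) * of_real x))
      = \<sigma> *\<^sub>R (LINT x|lborel. of_real (gauss (\<sigma> * x)) * exp (\<i> * of_real y * complex_of_real x))"
    using assms by (subst lborel_integral_real_affine[where c = \<sigma> and t = 0]) (auto simp: mult.assoc)
  then have "(LINT x|lborel. of_real (gauss (\<sigma> * x)) * exp (\<i> * of_real y * of_real x))
      = of_real (exp (- (y / \<sigma>)\<^sup>2 / 2)) / complex_of_real \<sigma>"
    using assms unfolding integral_gauss_exp by (simp add: scaleR_conv_of_real field_simps)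
  then show ?thesis
    by (simp add: std_normal_density_def)
qed

lemma Fubini_bounded_kernel:
  fixes F H :: "real \<Rightarrow> complex" and K :: "real \<Rightarrow> real \<Rightarrow> complex"
  assumes F: "integrable lborel F" and H: "integrable lborel H"
    and K [measurable]: "case_prod K \<in> borel_measurable (borel \<Otimes>\<^sub>M borel)"
    and bound: "\<And>x y. norm (K x y) \<le> B"
  shows "(LINT x|lborel. F x * (LINT y|lborel. H y * K x y))
       = (LINT y|lborel. H y * (LINT x|lborel. F x * K x y))"
proof -
  have [measurable]: "F \<in> borel_measurable borel" "H \<in> borel_measurable borel"
    using F H by (auto dest: borel_measurable_integrable)
  have "integrable (lborel \<Otimes>\<^sub>M lborel) (\<lambda>(x, y). F x * (H y * of_real B))"
    using F H by (intro lborel_pair.Fubini_integrable) (auto simp: norm_mult)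
  then have *: "integrable (lborel \<Otimes>\<^sub>M lborel) (\<lambda>(x, y). F x * (H y * K x y))"
  proof (rule Bochner_Integration.integrable_bound)
    show "AE p in lborel \<Otimes>\<^sub>M lborel. norm (case p of (x, y) \<Rightarrow> F x * (H y * K x y))
             \<le> norm (case p of (x, y) \<Rightarrow> F x * (H y * of_real B))"
      by (intro AE_I2) (auto simp: norm_mult intro!: mult_left_mono order_trans[OF bound abs_ge_self])
  qed measurable
  have "(LINT x|lborel. F x * (LINT y|lborel. H y * K x y)) = (LINT x|lborel. LINT y|lborel. F x * (H y * K x y))"
    by simp
  also have "\<dots> = (LINT y|lborel. LINT x|lborel. F x * (H y * K x y))"
    using lborel_pair.Fubini_integral[OF *] by simp
  also have "\<dots> = (LINT y|lborel. H y * (LINT x|lborel. F x * K x y))"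
    by (subst integral_mult_right_zero[symmetric]) (simp only: mult_ac)
  finally show ?thesis .
qed

lemma fourier_laplace_measurable [measurable]:
  assumes [measurable]: "D \<in> borel_measurable borel"
  shows "(\<lambda>x. fourier_laplace D (of_real x)) \<in> borel_measurable borel"
  unfolding fourier_laplace_def by measurable

lemma norm_fourier_laplace_le:
  "cmod (fourier_laplace D (of_real x)) \<le> (LINT \<omega>|lborel. cmod (D \<omega>))"
  unfolding fourier_laplace_def
  by (rule order_trans[OF integral_norm_bound]) (simp add: norm_mult)

lemma cnj_fourier_laplace:
  "cnj (fourier_laplace D (of_real x)) = (LINT \<omega>|lborel. cnj (D \<omega>) * exp (- (\<i> * of_real \<omega> * of_real x)))"
  unfolding fourier_laplace_def
  by (subst Bochner_Integration.integral_cnj[symmetric]) (simp add: exp_cnj)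

text \<open>Expanding the square and exchanging the integrals leaves the Fourier transform of a Gaussian in
  \<open>\<omega> - \<omega>'\<close>, which is a Gaussian of width \<open>\<sigma>\<close>; then substitute \<open>\<omega>' = \<omega> + \<sigma> s\<close>.  The identity contains
  both halves of the Plancherel theorem as \<open>\<sigma>\<close> tends to 0.\<close>

lemma gauss_weighted_plancherel:
  assumes "integrable lborel D" and \<sigma>: "\<sigma> > 0"
  shows "(LINT x|lborel. of_real (gauss (\<sigma> * x)) * of_real ((cmod (fourier_laplace D (of_real x)))\<^sup>2))
       = of_real (sqrt (2 * pi)) * (LINT \<omega>|lborel. D \<omega> * (LINT s|lborel. of_real (gauss s) * cnj (D (\<omega> + \<sigma> * s))))"
proof -
  have [measurable]: "D \<in> borel_measurable borel" using assms(1) by auto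
  have gauss_int: "integrable lborel (\<lambda>x. complex_of_real (gauss (\<sigma> * x)))"
    using lborel_integrable_real_affine[of gauss \<sigma> 0] \<sigma>
    by (subst complex_of_real_integrable_eq) (auto simp: less_le)
  let ?F = "\<lambda>x. fourier_laplace D (complex_of_real x)"
  let ?e = "\<lambda>\<omega> x. exp (\<i> * of_real \<omega> * complex_of_real x)"
  have int: "integrable lborel (\<lambda>x. of_real (gauss (\<sigma> * x)) * cnj (?F x))"
  proof (rule Bochner_Integration.integrable_bound)
    show "integrable lborel (\<lambda>x. complex_of_real (gauss (\<sigma> * x)) * of_real (LINT \<omega>|lborel. cmod (D \<omega>)))"
      using gauss_int by simp
    show "AE x in lborel. norm (of_real (gauss (\<sigma> * x)) * cnj (?F x))
       \<le> norm (complex_of_real (gauss (\<sigma> * x)) * of_real (LINT \<omega>|lborel. cmod (D \<omega>)))"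
      by (auto simp: norm_mult intro!: mult_left_mono order_trans[OF norm_fourier_laplace_le])
  qed measurable
  have "(LINT x|lborel. of_real (gauss (\<sigma> * x)) * of_real ((cmod (?F x))\<^sup>2))
      = (LINT x|lborel. (of_real (gauss (\<sigma> * x)) * cnj (?F x)) * (LINT \<omega>|lborel. D \<omega> * ?e \<omega> x))"
    unfolding complex_norm_square fourier_laplace_def by (simp only: mult_ac)
  also have "\<dots> = (LINT \<omega>|lborel. D \<omega> * (LINT x|lborel. (of_real (gauss (\<sigma> * x)) * cnj (?F x)) * ?e \<omega> x))"
    by (rule Fubini_bounded_kernel[where B = 1]) (use assms int in auto)
  also have "\<dots> = (LINT \<omega>|lborel. D \<omega> * (of_real (sqrt (2 * pi)) *
      (LINT s|lborel. of_real (gauss s) * cnj (D (\<omega> + \<sigma> * s)))))"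
  proof (intro Bochner_Integration.integral_cong refl arg_cong2[where f = "(*)"])
    fix \<omega>
    have shift: "cnj (?F x) * ?e \<omega> x = (LINT \<omega>'|lborel. cnj (D \<omega>') * ?e (\<omega> - \<omega>') x)" for x
    proof -
      have "cnj (D \<omega>') * exp (- (\<i> * of_real \<omega>' * of_real x)) * ?e \<omega> x = cnj (D \<omega>') * ?e (\<omega> - \<omega>') x" for \<omega>'
        by (simp add: algebra_simps flip: exp_add)
      then show ?thesis
        unfolding cnj_fourier_laplace by (subst integral_mult_left_zero[symmetric]) presburger
    qed
    have "(LINT x|lborel. (of_real (gauss (\<sigma> * x)) * cnj (?F x)) * ?e \<omega> x)
        = (LINT x|lborel. of_real (gauss (\<sigma> * x)) * (LINT \<omega>'|lborel. cnj (D \<omega>') * ?e (\<omega> - \<omega>') x))"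
      unfolding shift[symmetric] by (simp only: mult.assoc)
    also have "\<dots> = (LINT \<omega>'|lborel. cnj (D \<omega>') * (LINT x|lborel. of_real (gauss (\<sigma> * x)) * ?e (\<omega> - \<omega>') x))"
      by (rule Fubini_bounded_kernel[where B = 1]) (use assms gauss_int in auto)
    also have "\<dots> = (LINT \<omega>'|lborel. cnj (D \<omega>') * of_real (sqrt (2 * pi) / \<sigma> * gauss ((\<omega> - \<omega>') / \<sigma>)))"
      by (simp only: integral_gauss_scaled_exp[OF \<sigma>])
    also have "\<dots> = \<sigma> *\<^sub>R (LINT s|lborel. cnj (D (\<omega> + \<sigma> * s)) * of_real (sqrt (2 * pi) / \<sigma> * gauss s))"
      using \<sigma> by (subst lborel_integral_real_affine[where c = \<sigma> and t = \<omega>])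
        (auto simp: normal_density_def)
    also have "\<dots> = of_real (sqrt (2 * pi)) * (LINT s|lborel. of_real (gauss s) * cnj (D (\<omega> + \<sigma> * s)))"
    proof -
      have "cnj (D (\<omega> + \<sigma> * s)) * of_real (sqrt (2 * pi) / \<sigma> * gauss s)
          = of_real (sqrt (2 * pi) / \<sigma>) * (of_real (gauss s) * cnj (D (\<omega> + \<sigma> * s)))" for s
        by simp
      then show ?thesis using \<sigma> by (simp only: integral_mult_right_zero) (simp add: scaleR_conv_of_real)
    qed
    finally show "(LINT x|lborel. (of_real (gauss (\<sigma> * x)) * cnj (?F x)) * ?e \<omega> x)
       = of_real (sqrt (2 * pi)) * (LINT s|lborel. of_real (gauss s) * cnj (D (\<omega> + \<sigma> * s)))" .
  qed
  also have "\<dots> = of_real (sqrt (2 * pi)) * (LINT \<omega>|lborel. D \<omega> * (LINT s|lborel. of_real (gauss s) * cnj (D (\<omega> + \<sigma> * s))))"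
    by (subst integral_mult_right_zero[symmetric]) (simp only: mult_ac)
  finally show ?thesis .
qed

section \<open>Plancherel theorem for compactly supported functions\<close>

lemma ennreal_norm_integral_le: "ennreal (norm (integral\<^sup>L M f)) \<le> (\<integral>\<^sup>+x. ennreal (norm (f x)) \<partial>M)"
  by (cases "integrable M f") (auto intro: integral_norm_bound_ennreal simp: not_integrable_integral_eq)

lemma gauss_eq_exp: "gauss x = gauss 0 * exp (- x\<^sup>2 / 2)"
  by (simp add: std_normal_density_def)

lemma gauss_0: "gauss 0 = 1 / sqrt (2 * pi)"
  by (simp add: std_normal_density_def)

lemma gauss_le_gauss_0: "gauss x \<le> gauss 0"
  by (subst gauss_eq_exp) (intro mult_right_le_one_le, auto)

lemma isCont_gauss: "isCont gauss x"
  by (auto simp: normal_density_def[abs_def] intro!: continuous_intros)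

lemma nn_integral_gauss: "(\<integral>\<^sup>+s. ennreal (gauss s) \<partial>lborel) = 1"
  by (subst nn_integral_eq_integral) auto

lemma integrable_gauss_scaled: "\<sigma> \<noteq> 0 \<Longrightarrow> integrable lborel (\<lambda>x. gauss (\<sigma> * x))"
  using lborel_integrable_real_affine[of gauss \<sigma> 0] by auto

lemma nn_integral_gauss_weighted:
  assumes "integrable lborel D" and \<sigma>: "\<sigma> > 0"
  shows "(\<integral>\<^sup>+x. ennreal (gauss (\<sigma> * x) * (cmod (fourier_laplace D (of_real x)))\<^sup>2) \<partial>lborel)
       = ennreal (sqrt (2 * pi) * Re (LINT \<omega>|lborel. D \<omega> * (LINT s|lborel. of_real (gauss s) * cnj (D (\<omega> + \<sigma> * s)))))"
proof -
  have [measurable]: "D \<in> borel_measurable borel" using assms(1) by auto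
  let ?g = "\<lambda>x. gauss (\<sigma> * x) * (cmod (fourier_laplace D (complex_of_real x)))\<^sup>2"
  have int: "integrable lborel ?g"
  proof (rule Bochner_Integration.integrable_bound)
    show "integrable lborel (\<lambda>x. gauss (\<sigma> * x) * (LINT \<omega>|lborel. cmod (D \<omega>))\<^sup>2)"
      using integrable_gauss_scaled \<sigma> by auto
    show "AE x in lborel. norm (?g x) \<le> norm (gauss (\<sigma> * x) * (LINT \<omega>|lborel. cmod (D \<omega>))\<^sup>2)"
      by (auto simp: abs_mult intro!: mult_left_mono power_mono norm_fourier_laplace_le)
  qed measurable
  have "complex_of_real (integral\<^sup>L lborel ?g)
      = of_real (sqrt (2 * pi)) * (LINT \<omega>|lborel. D \<omega> * (LINT s|lborel. of_real (gauss s) * cnj (D (\<omega> + \<sigma> * s))))"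
    unfolding gauss_weighted_plancherel[OF assms, symmetric] by (subst integral_complex_of_real[symmetric]) simp
  from arg_cong[OF this, of Re] have "integral\<^sup>L lborel ?g
      = sqrt (2 * pi) * Re (LINT \<omega>|lborel. D \<omega> * (LINT s|lborel. of_real (gauss s) * cnj (D (\<omega> + \<sigma> * s))))"
    by simp
  then show ?thesis using int by (subst nn_integral_eq_integral) auto
qed

text \<open>The inequality \<open>ab \<le> a\<^sup>2/2 + b\<^sup>2/2\<close> separates \<open>D(\<omega>)\<close> from \<open>D(\<omega> + \<sigma>s)\<close>, and both resulting
  integrals are equal by translation invariance.\<close>

lemma nn_integral_gauss_weighted_le:
  assumes "integrable lborel D" and \<sigma>: "\<sigma> > 0"
  shows "(\<integral>\<^sup>+x. ennreal (gauss (\<sigma> * x) * (cmod (fourier_laplace D (of_real x)))\<^sup>2) \<partial>lborel)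
      \<le> ennreal (sqrt (2 * pi)) * (\<integral>\<^sup>+\<omega>. ennreal ((cmod (D \<omega>))\<^sup>2) \<partial>lborel)"
proof -
  have [measurable]: "D \<in> borel_measurable borel" using assms(1) by auto
  define u where "u \<omega> = ennreal ((cmod (D \<omega>))\<^sup>2 / 2)" for \<omega>
  have [measurable]: "u \<in> borel_measurable borel" unfolding u_def by measurable
  let ?I = "LINT \<omega>|lborel. D \<omega> * (LINT s|lborel. of_real (gauss s) * cnj (D (\<omega> + \<sigma> * s)))"
  have "ennreal (Re ?I) \<le> ennreal (cmod ?I)"
    by (intro ennreal_leI complex_Re_le_cmod)
  also have "\<dots> \<le> (\<integral>\<^sup>+\<omega>. ennreal (cmod (D \<omega>))
      * ennreal (cmod (LINT s|lborel. of_real (gauss s) * cnj (D (\<omega> + \<sigma> * s)))) \<partial>lborel)"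
    using ennreal_norm_integral_le[of lborel "\<lambda>\<omega>. D \<omega> * (LINT s|lborel. of_real (gauss s) * cnj (D (\<omega> + \<sigma> * s)))"]
    by (simp add: norm_mult ennreal_mult)
  also have "\<dots> \<le> (\<integral>\<^sup>+\<omega>. ennreal (cmod (D \<omega>))
      * (\<integral>\<^sup>+s. ennreal (cmod (of_real (gauss s) * cnj (D (\<omega> + \<sigma> * s)))) \<partial>lborel) \<partial>lborel)"
    by (intro nn_integral_mono mult_left_mono ennreal_norm_integral_le) auto
  also have "\<dots> = (\<integral>\<^sup>+\<omega>. \<integral>\<^sup>+s. ennreal (gauss s * (cmod (D \<omega>) * cmod (D (\<omega> + \<sigma> * s)))) \<partial>lborel \<partial>lborel)"
    by (subst nn_integral_cmult[symmetric]) (auto simp: norm_mult mult_ac simp flip: ennreal_mult)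
  also have "\<dots> \<le> (\<integral>\<^sup>+\<omega>. \<integral>\<^sup>+s. ennreal (gauss s) * u \<omega> + ennreal (gauss s) * u (\<omega> + \<sigma> * s) \<partial>lborel \<partial>lborel)"
  proof (intro nn_integral_mono)
    fix \<omega> s
    have "cmod (D \<omega>) * cmod (D (\<omega> + \<sigma> * s)) \<le> (cmod (D \<omega>))\<^sup>2 / 2 + (cmod (D (\<omega> + \<sigma> * s)))\<^sup>2 / 2"
      using sum_squares_bound[of "cmod (D \<omega>)" "cmod (D (\<omega> + \<sigma> * s))"] by simp
    then have "gauss s * (cmod (D \<omega>) * cmod (D (\<omega> + \<sigma> * s)))
        \<le> gauss s * ((cmod (D \<omega>))\<^sup>2 / 2) + gauss s * ((cmod (D (\<omega> + \<sigma> * s)))\<^sup>2 / 2)"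
      unfolding distrib_left[symmetric] by (intro mult_left_mono) auto
    then show "ennreal (gauss s * (cmod (D \<omega>) * cmod (D (\<omega> + \<sigma> * s))))
        \<le> ennreal (gauss s) * u \<omega> + ennreal (gauss s) * u (\<omega> + \<sigma> * s)"
      unfolding u_def by (simp add: ennreal_leI flip: ennreal_mult ennreal_plus)
  qed
  also have "\<dots> = (\<integral>\<^sup>+\<omega>. (\<integral>\<^sup>+s. ennreal (gauss s) * u \<omega> \<partial>lborel) \<partial>lborel)
      + (\<integral>\<^sup>+\<omega>. \<integral>\<^sup>+s. ennreal (gauss s) * u (\<omega> + \<sigma> * s) \<partial>lborel \<partial>lborel)"
    by (simp add: nn_integral_add)
  also have "(\<integral>\<^sup>+\<omega>. (\<integral>\<^sup>+s. ennreal (gauss s) * u \<omega> \<partial>lborel) \<partial>lborel) = integral\<^sup>N lborel u"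
    by (simp add: nn_integral_multc nn_integral_gauss)
  also have "(\<integral>\<^sup>+\<omega>. \<integral>\<^sup>+s. ennreal (gauss s) * u (\<omega> + \<sigma> * s) \<partial>lborel \<partial>lborel)
      = (\<integral>\<^sup>+s. \<integral>\<^sup>+\<omega>. ennreal (gauss s) * u (\<omega> + \<sigma> * s) \<partial>lborel \<partial>lborel)"
    by (intro lborel_pair.Fubini') measurable
  also have "\<dots> = (\<integral>\<^sup>+s. ennreal (gauss s) * integral\<^sup>N lborel u \<partial>lborel)"
  proof (intro nn_integral_cong)
    fix s
    have "integral\<^sup>N lborel u = (\<integral>\<^sup>+\<omega>. u (\<omega> + \<sigma> * s) \<partial>lborel)"
      by (subst nn_integral_real_affine[where c = 1 and t = "\<sigma> * s"]) (auto simp: add.commute)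
    then show "(\<integral>\<^sup>+\<omega>. ennreal (gauss s) * u (\<omega> + \<sigma> * s) \<partial>lborel) = ennreal (gauss s) * integral\<^sup>N lborel u"
      by (simp add: nn_integral_cmult)
  qed
  also have "\<dots> = integral\<^sup>N lborel u" by (simp add: nn_integral_multc nn_integral_gauss)
  also have "integral\<^sup>N lborel u + integral\<^sup>N lborel u = (\<integral>\<^sup>+\<omega>. ennreal ((cmod (D \<omega>))\<^sup>2) \<partial>lborel)"
    by (subst nn_integral_add[symmetric]) (auto simp: u_def simp flip: ennreal_plus)
  finally show ?thesis
    unfolding nn_integral_gauss_weighted[OF assms] by (simp add: ennreal_mult' mult_left_mono)
qed

text \<open>Fatou's lemma as the width of the Gaussian weight tends to infinity.\<close>

lemma plancherel_le:
  assumes "integrable lborel D"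
  shows "(\<integral>\<^sup>+x. ennreal ((cmod (fourier_laplace D (of_real x)))\<^sup>2) \<partial>lborel)
      \<le> ennreal (2 * pi) * (\<integral>\<^sup>+\<omega>. ennreal ((cmod (D \<omega>))\<^sup>2) \<partial>lborel)"
proof -
  have [measurable]: "D \<in> borel_measurable borel" using assms(1) by auto
  let ?F = "\<lambda>x. (cmod (fourier_laplace D (complex_of_real x)))\<^sup>2"
  let ?\<sigma> = "\<lambda>j. 1 / real (Suc j)"
  have lim: "(\<lambda>j. ennreal (sqrt (2 * pi)) * ennreal (gauss (?\<sigma> j * x) * ?F x)) \<longlonglongrightarrow> ennreal (?F x)" for x
  proof -
    have "(\<lambda>j. ?\<sigma> j * x) \<longlonglongrightarrow> 0 * x"
      by (rule tendsto_mult[OF LIMSEQ_Suc[OF lim_1_over_n] tendsto_const])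
    then have "(\<lambda>j. gauss (?\<sigma> j * x)) \<longlonglongrightarrow> gauss 0"
      by (intro isCont_tendsto_compose[OF isCont_gauss]) simp
    then have "(\<lambda>j. ennreal (sqrt (2 * pi) * (gauss (?\<sigma> j * x) * ?F x)))
        \<longlonglongrightarrow> ennreal (sqrt (2 * pi) * (gauss 0 * ?F x))"
      by (intro tendsto_intros) 
    then show ?thesis by (simp add: gauss_0 ennreal_mult)
  qed
  have "(\<integral>\<^sup>+x. ennreal (?F x) \<partial>lborel)
      = (\<integral>\<^sup>+x. liminf (\<lambda>j. ennreal (sqrt (2 * pi)) * ennreal (gauss (?\<sigma> j * x) * ?F x)) \<partial>lborel)"
    by (intro nn_integral_cong lim_imp_Liminf[OF sequentially_bot lim, symmetric])
  also have "\<dots> \<le> liminf (\<lambda>j. \<integral>\<^sup>+x. ennreal (sqrt (2 * pi)) * ennreal (gauss (?\<sigma> j * x) * ?F x) \<partial>lborel)"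
    by (intro nn_integral_liminf) measurable
  also have "\<dots> \<le> liminf (\<lambda>j::nat. ennreal (sqrt (2 * pi)) * (ennreal (sqrt (2 * pi)) * (\<integral>\<^sup>+\<omega>. ennreal ((cmod (D \<omega>))\<^sup>2) \<partial>lborel)))"
  proof (intro Liminf_mono always_eventually allI)
    fix j
    show "(\<integral>\<^sup>+x. ennreal (sqrt (2 * pi)) * ennreal (gauss (?\<sigma> j * x) * ?F x) \<partial>lborel)
       \<le> ennreal (sqrt (2 * pi)) * (ennreal (sqrt (2 * pi)) * (\<integral>\<^sup>+\<omega>. ennreal ((cmod (D \<omega>))\<^sup>2) \<partial>lborel))"
      using nn_integral_gauss_weighted_le[OF assms, of "?\<sigma> j"]
      by (subst nn_integral_cmult) (auto intro!: mult_left_mono)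
  qed
  also have "\<dots> = ennreal (2 * pi) * (\<integral>\<^sup>+\<omega>. ennreal ((cmod (D \<omega>))\<^sup>2) \<partial>lborel)"
    by (simp add: Liminf_const flip: mult.assoc ennreal_mult)
  finally show ?thesis .
qed

lemma integrable_bounded_support:
  fixes D :: "real \<Rightarrow> 'a :: {banach, second_countable_topology}"
  assumes [measurable]: "D \<in> borel_measurable borel"
    and "\<And>\<omega>. norm (D \<omega>) \<le> B" and "\<And>\<omega>. \<omega> \<notin> {a..b} \<Longrightarrow> D \<omega> = 0"
  shows "integrable lborel D"
proof (rule Bochner_Integration.integrable_bound)
  show "integrable lborel (\<lambda>\<omega>. B * indicator {a..b} \<omega>)"
    by (intro integrable_mult_right integrable_real_indicator) (auto simp: emeasure_lborel_Icc_eq)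
  show "AE \<omega> in lborel. norm (D \<omega>) \<le> norm (B * indicator {a..b} \<omega>)"
    using assms(2,3) by (auto simp: indicator_def intro!: AE_I2 order_trans[OF assms(2) abs_ge_self])
qed measurable

text \<open>For almost everywhere continuous \<open>D\<close> the inner Gaussian average tends to \<open>D(\<omega>)\<close> for almost all
  \<open>\<omega>\<close>, so that the Gaussian-weighted integrals converge to the right-hand side.  They never exceed
  the left-hand side because a Gaussian is maximal at 0.\<close>

lemma plancherel:
  assumes [measurable]: "D \<in> borel_measurable borel"
    and bound: "\<And>\<omega>. cmod (D \<omega>) \<le> B" and supp: "\<And>\<omega>. \<omega> \<notin> {a..b} \<Longrightarrow> D \<omega> = 0"
    and cont: "AE \<omega> in lborel. isCont D \<omega>"
  shows "(\<integral>\<^sup>+x. ennreal ((cmod (fourier_laplace D (of_real x)))\<^sup>2) \<partial>lborel)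
       = ennreal (2 * pi * (LINT \<omega>|lborel. (cmod (D \<omega>))\<^sup>2))"
proof (rule antisym)
  have D: "integrable lborel D" by (rule integrable_bounded_support[OF _ bound supp]) auto
  have B: "0 \<le> B" using bound[of 0] norm_ge_zero order_trans by blast
  have D2: "integrable lborel (\<lambda>\<omega>. (cmod (D \<omega>))\<^sup>2)"
    by (rule integrable_bounded_support[where B = "B\<^sup>2" and a = a and b = b])
       (auto simp: supp intro!: power_mono bound)
  let ?N = "\<integral>\<^sup>+x. ennreal ((cmod (fourier_laplace D (of_real x)))\<^sup>2) \<partial>lborel"
  let ?\<sigma> = "\<lambda>j. 1 / real (Suc j)"
  let ?h = "\<lambda>j \<omega>. LINT s|lborel. of_real (gauss s) * cnj (D (\<omega> + ?\<sigma> j * s))"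
  show "?N \<le> ennreal (2 * pi * (LINT \<omega>|lborel. (cmod (D \<omega>))\<^sup>2))"
    using plancherel_le[OF D] D2 by (simp add: nn_integral_eq_integral ennreal_mult)
  have bound_h: "cmod (?h j \<omega>) \<le> B" for j \<omega>
  proof -
    have "cmod (?h j \<omega>) \<le> (LINT s|lborel. gauss s * B)"
    proof (rule Bochner_Integration.integral_norm_bound_integral)
      show "integrable lborel (\<lambda>s. of_real (gauss s) * cnj (D (\<omega> + ?\<sigma> j * s)))"
        by (rule Bochner_Integration.integrable_bound[where f = "\<lambda>s. gauss s * B"])
           (auto simp: norm_mult B intro!: mult_left_mono bound)
    qed (auto simp: norm_mult intro!: mult_left_mono bound)
    then show ?thesis by simp
  qed
  have "(\<lambda>j. LINT \<omega>|lborel. D \<omega> * ?h j \<omega>) \<longlonglongrightarrow> (LINT \<omega>|lborel. D \<omega> * cnj (D \<omega>))"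
  proof (rule integral_dominated_convergence[where w = "\<lambda>\<omega>. cmod (D \<omega>) * B"])
    show "AE \<omega> in lborel. (\<lambda>j. D \<omega> * ?h j \<omega>) \<longlonglongrightarrow> D \<omega> * cnj (D \<omega>)"
      using cont
    proof eventually_elim
      case (elim \<omega>)
      have "(\<lambda>j. ?h j \<omega>) \<longlonglongrightarrow> (LINT s|lborel. of_real (gauss s) * cnj (D \<omega>))"
      proof (rule integral_dominated_convergence[where w = "\<lambda>s. gauss s * B"])
        show "AE s in lborel. (\<lambda>j. of_real (gauss s) * cnj (D (\<omega> + ?\<sigma> j * s))) \<longlonglongrightarrow> of_real (gauss s) * cnj (D \<omega>)"
        proof (intro AE_I2 tendsto_mult tendsto_const tendsto_cnj)
          fix s
          have "(\<lambda>j. \<omega> + ?\<sigma> j * s) \<longlonglongrightarrow> \<omega> + 0 * s"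
            by (intro tendsto_add tendsto_mult tendsto_const LIMSEQ_Suc[OF lim_1_over_n])
          then show "(\<lambda>j. D (\<omega> + ?\<sigma> j * s)) \<longlonglongrightarrow> D \<omega>"
            using elim by (intro isCont_tendsto_compose[of \<omega> D]) auto
        qed
      qed (auto simp: norm_mult intro!: mult_left_mono bound)
      then show ?case by (intro tendsto_intros) simp
    qed
    show "AE \<omega> in lborel. norm (D \<omega> * ?h j \<omega>) \<le> cmod (D \<omega>) * B" for j
      using bound_h by (auto simp: norm_mult intro!: mult_left_mono)
  qed (use D in auto)
  also have "(LINT \<omega>|lborel. D \<omega> * cnj (D \<omega>)) = of_real (LINT \<omega>|lborel. (cmod (D \<omega>))\<^sup>2)"
    unfolding complex_norm_square[symmetric] by (rule integral_complex_of_real)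
  finally have "(\<lambda>j. ennreal (sqrt (2 * pi) * Re (LINT \<omega>|lborel. D \<omega> * ?h j \<omega>)))
      \<longlonglongrightarrow> ennreal (sqrt (2 * pi) * Re (of_real (LINT \<omega>|lborel. (cmod (D \<omega>))\<^sup>2)))"
    by (intro tendsto_intros)
  moreover have "ennreal (sqrt (2 * pi) * Re (LINT \<omega>|lborel. D \<omega> * ?h j \<omega>)) \<le> ennreal (gauss 0) * ?N" for j
  proof -
    have "ennreal (sqrt (2 * pi) * Re (LINT \<omega>|lborel. D \<omega> * ?h j \<omega>))
        = (\<integral>\<^sup>+x. ennreal (gauss (?\<sigma> j * x) * (cmod (fourier_laplace D (of_real x)))\<^sup>2) \<partial>lborel)"
      by (rule nn_integral_gauss_weighted[OF D, symmetric]) simp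
    also have "\<dots> \<le> (\<integral>\<^sup>+x. ennreal (gauss 0) * ennreal ((cmod (fourier_laplace D (of_real x)))\<^sup>2) \<partial>lborel)"
      by (intro nn_integral_mono) (auto simp: gauss_le_gauss_0 simp flip: ennreal_mult intro!: ennreal_leI mult_right_mono)
    also have "\<dots> = ennreal (gauss 0) * ?N" by (rule nn_integral_cmult) measurable
    finally show ?thesis .
  qed
  ultimately have "ennreal (sqrt (2 * pi) * (LINT \<omega>|lborel. (cmod (D \<omega>))\<^sup>2)) \<le> ennreal (gauss 0) * ?N"
    by (intro LIMSEQ_le_const2[of "\<lambda>j. ennreal (sqrt (2 * pi) * Re (LINT \<omega>|lborel. D \<omega> * ?h j \<omega>))"]) auto
  then have "ennreal (sqrt (2 * pi)) * ennreal (sqrt (2 * pi) * (LINT \<omega>|lborel. (cmod (D \<omega>))\<^sup>2))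
      \<le> ennreal (sqrt (2 * pi)) * (ennreal (gauss 0) * ?N)"
    by (rule mult_left_mono) simp
  then show "ennreal (2 * pi * (LINT \<omega>|lborel. (cmod (D \<omega>))\<^sup>2)) \<le> ?N"
    by (simp add: gauss_0 flip: ennreal_mult ennreal_mult' mult.assoc)
qed

section \<open>The Fourier transform on the square-integrable functions\<close>

lemma continuous_bounded_Icc:
  fixes g :: "real \<Rightarrow> real"
  assumes "continuous_on UNIV g"
  obtains B where "B \<ge> 0" "\<And>t. t \<in> {a..b} \<Longrightarrow> \<bar>g t\<bar> \<le> B"
proof -
  have "compact (g ` {a..b})"
    by (intro compact_continuous_image continuous_on_subset[OF assms]) auto
  then have "bounded (g ` {a..b})" by (rule compact_imp_bounded)
  then obtain B where "\<forall>y\<in>g ` {a..b}. norm y \<le> B" by (auto simp: bounded_iff)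
  then show ?thesis by (intro that[of "max 0 B"]) (auto intro: max.coboundedI2)
qed

lemma mult_le_sum_squares: "0 \<le> a \<Longrightarrow> 0 \<le> b \<Longrightarrow> a * b \<le> a\<^sup>2 + b\<^sup>2" for a b :: real
  using sum_squares_bound[of a b] mult_nonneg_nonneg[of a b] by linarith

lemma integral_norm_diff_square:
  fixes F D :: "real \<Rightarrow> complex"
  assumes [measurable]: "F \<in> borel_measurable borel" "D \<in> borel_measurable borel"
    and F2: "integrable lborel (\<lambda>x. (cmod (F x))\<^sup>2)" and D2: "integrable lborel (\<lambda>x. (cmod (D x))\<^sup>2)"
  shows "integrable lborel (\<lambda>x. (cmod (F x - D x))\<^sup>2)"
    and "(LINT x|lborel. (cmod (F x - D x))\<^sup>2)
       = (LINT x|lborel. (cmod (F x))\<^sup>2) - 2 * Re (LINT x|lborel. cnj (D x) * F x) + (LINT x|lborel. (cmod (D x))\<^sup>2)"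
proof -
  have cross_int: "integrable lborel (\<lambda>x. cnj (D x) * F x)"
  proof (rule Bochner_Integration.integrable_bound[OF Bochner_Integration.integrable_add[OF D2 F2]])
    show "AE x in lborel. norm (cnj (D x) * F x) \<le> norm ((cmod (D x))\<^sup>2 + (cmod (F x))\<^sup>2)"
      by (intro AE_I2) (simp add: norm_mult mult_le_sum_squares)
  qed measurable
  have eq: "(cmod (F x - D x))\<^sup>2 = (cmod (F x))\<^sup>2 - 2 * Re (cnj (D x) * F x) + (cmod (D x))\<^sup>2" for x
    unfolding cmod_power2 by (simp add: power2_eq_square algebra_simps)
  have Re_int: "integrable lborel (\<lambda>x. 2 * Re (cnj (D x) * F x))"
    by (intro integrable_mult_right integrable_Re cross_int)
  have Re_eq: "(LINT x|lborel. 2 * Re (cnj (D x) * F x)) = 2 * Re (LINT x|lborel. cnj (D x) * F x)"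
    by (subst integral_mult_right_zero) (simp only: integral_Re[OF cross_int])
  note diff_int = Bochner_Integration.integrable_diff[OF F2 Re_int]
  show "integrable lborel (\<lambda>x. (cmod (F x - D x))\<^sup>2)"
    unfolding eq by (rule Bochner_Integration.integrable_add[OF diff_int D2])
  show "(LINT x|lborel. (cmod (F x - D x))\<^sup>2)
       = (LINT x|lborel. (cmod (F x))\<^sup>2) - 2 * Re (LINT x|lborel. cnj (D x) * F x) + (LINT x|lborel. (cmod (D x))\<^sup>2)"
    unfolding eq Re_eq[symmetric] Bochner_Integration.integral_add[OF diff_int D2]
      Bochner_Integration.integral_diff[OF F2 Re_int] ..
qed

text \<open>The function \<open>g\<close> is split into a bounded part near \<open>x\<close>, to which dominated convergence applies
  after rescaling, and a part far from \<open>x\<close>.  The latter is only known to be square-integrable; its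
  contribution is \<open>O(1/j)\<close> by the decay of the Gaussian.\<close>

lemma approximate_identity_gauss:
  assumes cont: "continuous_on UNIV g" and sq: "integrable lborel (\<lambda>t. (g t)\<^sup>2)"
  shows "(\<lambda>j. real (Suc j) * (LINT t|lborel. g t * gauss (real (Suc j) * (x - t)))) \<longlonglongrightarrow> g x"
proof -
  have [measurable]: "g \<in> borel_measurable borel" using cont by (rule borel_measurable_continuous_onI)
  have isCont_g: "isCont g t" for t using cont by (simp add: continuous_on_eq_continuous_at)
  obtain B where B0: "0 \<le> B" and B: "\<And>t. t \<in> {x - 1..x + 1} \<Longrightarrow> \<bar>g t\<bar> \<le> B"
    using continuous_bounded_Icc[OF cont] by metis
  define near where "near t = indicator {x - 1..x + 1} t * g t" for t
  define far where "far t = indicator (- {x - 1..x + 1}) t * g t" for t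
  have [measurable]: "near \<in> borel_measurable borel" "far \<in> borel_measurable borel"
    unfolding near_def far_def by measurable
  have near_bound: "\<bar>near t\<bar> \<le> B" for t
    using B[of t] B0 by (simp add: near_def indicator_def)
  have split: "g t = near t + far t" for t by (simp add: near_def far_def indicator_def)
  have near_int: "integrable lborel (\<lambda>t. near t * gauss (c * (x - t)))" for c
    by (rule integrable_bounded_support[where B = B and a = "x - 1" and b = "x + 1"])
       (auto simp: abs_mult near_def[of "_ :: real"] gauss_le_1 B0 B indicator_def intro!: mult_mono[of _ B _ 1, simplified])
  have exp_int: "integrable lborel (\<lambda>t. (g t)\<^sup>2 + exp (- (x - t)\<^sup>2 / 2))"
  proof (rule Bochner_Integration.integrable_add[OF sq])
    have "integrable lborel (\<lambda>t. sqrt (2 * pi) * gauss (x + (- 1) * t))"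
      using lborel_integrable_real_affine[of gauss "- 1" x] by simp
    then show "integrable lborel (\<lambda>t. exp (- (x - t)\<^sup>2 / 2))"
      by (simp add: std_normal_density_def)
  qed
  have far_bound: "\<bar>far t * gauss (real (Suc j) * (x - t))\<bar>
      \<le> 4 / (real (Suc j))\<^sup>2 * ((g t)\<^sup>2 + exp (- (x - t)\<^sup>2 / 2))" for j t
  proof (cases "t \<in> {x - 1..x + 1}")
    case True
    then show ?thesis by (simp add: far_def)
  next
    case False
    define k where "k = real (Suc j)"
    define y where "y = x - t"
    have k: "k \<ge> 1" by (simp add: k_def)
    have y: "y\<^sup>2 \<ge> 1" using False abs_square_le_1[of y] unfolding y_def by auto
    \<comment> \<open>One part of the exponent gives the factor \<open>4/k\<^sup>2\<close>, the other keeps a square-integrable Gaussian in \<open>y\<close>.\<close>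
    have ky: "k\<^sup>2 * y\<^sup>2 / 2 \<ge> k\<^sup>2 / 4 + y\<^sup>2 / 4"
    proof -
      have "k\<^sup>2 * 1 \<le> k\<^sup>2 * y\<^sup>2" by (rule mult_left_mono[OF y]) simp
      moreover have "1 * y\<^sup>2 \<le> k\<^sup>2 * y\<^sup>2" using k by (intro mult_right_mono one_le_power) auto
      ultimately show ?thesis by simp
    qed
    have "gauss (k * y) \<le> 1 * exp (- (k * y)\<^sup>2 / 2)"
      by (subst gauss_eq_exp) (intro mult_right_mono gauss_le_1, simp)
    also have "\<dots> \<le> exp (- (k\<^sup>2 / 4)) * exp (- y\<^sup>2 / 4)"
      using ky by (simp add: power_mult_distrib flip: exp_add)
    also have "exp (- (k\<^sup>2 / 4)) \<le> 4 / k\<^sup>2"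
      using exp_ge_add_one_self[of "k\<^sup>2 / 4"] k by (simp add: exp_minus field_simps)
    finally have *: "gauss (k * y) \<le> 4 / k\<^sup>2 * exp (- y\<^sup>2 / 4)" by (auto intro: mult_right_mono)
    have "exp (- y\<^sup>2 / 2) = (exp (- y\<^sup>2 / 4))\<^sup>2" by (simp add: power2_eq_square flip: exp_add)
    then have **: "\<bar>g t\<bar> * exp (- y\<^sup>2 / 4) \<le> (g t)\<^sup>2 + exp (- y\<^sup>2 / 2)"
      using mult_le_sum_squares[of "\<bar>g t\<bar>" "exp (- y\<^sup>2 / 4)"] by simp
    have "\<bar>far t * gauss (k * y)\<bar> \<le> \<bar>g t\<bar> * (4 / k\<^sup>2 * exp (- y\<^sup>2 / 4))"
      using mult_left_mono[OF *, of "\<bar>g t\<bar>"] by (auto simp: far_def abs_mult indicator_def)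
    also have "\<dots> = 4 / k\<^sup>2 * (\<bar>g t\<bar> * exp (- y\<^sup>2 / 4))" by simp
    also have "\<dots> \<le> 4 / k\<^sup>2 * ((g t)\<^sup>2 + exp (- y\<^sup>2 / 2))" by (intro mult_left_mono **) simp
    finally show ?thesis by (simp add: k_def y_def)
  qed
  have far_int: "integrable lborel (\<lambda>t. far t * gauss (real (Suc j) * (x - t)))" for j
    by (rule Bochner_Integration.integrable_bound[OF integrable_mult_right[OF exp_int, of "4 / (real (Suc j))\<^sup>2"]])
       (use far_bound[of _ j] in \<open>auto intro!: order_trans[OF far_bound abs_ge_self]\<close>)
  have "(\<lambda>j. real (Suc j) * (LINT t|lborel. near t * gauss (real (Suc j) * (x - t)))) \<longlonglongrightarrow> g x"
  proof -
    have "(\<lambda>j. LINT s|lborel. near (x + s / real (Suc j)) * gauss s) \<longlonglongrightarrow> (LINT s|lborel. g x * gauss s)"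
    proof (rule integral_dominated_convergence[where w = "\<lambda>s. B * gauss s"])
      show "AE s in lborel. (\<lambda>j. near (x + s / real (Suc j)) * gauss s) \<longlonglongrightarrow> g x * gauss s"
      proof (intro AE_I2 tendsto_mult tendsto_const)
        fix s
        have "\<forall>\<^sub>F t in nhds x. near t = g t"
          unfolding eventually_nhds
          by (rule exI[of _ "{x - 1<..<x + 1}"]) (auto simp: near_def)
        then have "isCont near x" using isCont_g[of x] isCont_cong by blast
        moreover have "near x = g x" by (simp add: near_def)
        moreover have "(\<lambda>j. x + s / real (Suc j)) \<longlonglongrightarrow> x + 0"
          by (intro tendsto_add tendsto_const LIMSEQ_Suc[OF lim_const_over_n])
        ultimately show "(\<lambda>j. near (x + s / real (Suc j))) \<longlonglongrightarrow> g x"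
          using isCont_tendsto_compose[of x near] by fastforce
      qed
    qed (auto simp: abs_mult near_bound intro!: mult_right_mono)
    moreover have "real (Suc j) * (LINT t|lborel. near t * gauss (real (Suc j) * (x - t)))
        = (LINT s|lborel. near (x + s / real (Suc j)) * gauss s)" for j
    proof -
      have "gauss (real (Suc j) * (x - (x + 1 / real (Suc j) * s))) = gauss s" for s
        by (simp add: normal_density_def del: of_nat_Suc)
      then show ?thesis
        by (subst lborel_integral_real_affine[where c = "1 / real (Suc j)" and t = x])
           (simp_all del: of_nat_Suc)
    qed
    ultimately show ?thesis by simp
  qed
  moreover have "(\<lambda>j. real (Suc j) * (LINT t|lborel. far t * gauss (real (Suc j) * (x - t)))) \<longlonglongrightarrow> 0"
  proof (rule Lim_null_comparison)
    let ?C = "LINT t|lborel. (g t)\<^sup>2 + exp (- (x - t)\<^sup>2 / 2)"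
    show "\<forall>\<^sub>F j in sequentially. norm (real (Suc j) * (LINT t|lborel. far t * gauss (real (Suc j) * (x - t))))
        \<le> 4 * ?C / real (Suc j)"
    proof (intro always_eventually allI)
      fix j
      have "norm (LINT t|lborel. far t * gauss (real (Suc j) * (x - t)))
          \<le> (LINT t|lborel. 4 / (real (Suc j))\<^sup>2 * ((g t)\<^sup>2 + exp (- (x - t)\<^sup>2 / 2)))"
        by (rule Bochner_Integration.integral_norm_bound_integral[OF far_int integrable_mult_right[OF exp_int]])
           (use far_bound in auto)
      also have "\<dots> = 4 / (real (Suc j))\<^sup>2 * ?C" by (rule integral_mult_right_zero)
      finally have "real (Suc j) * norm (LINT t|lborel. far t * gauss (real (Suc j) * (x - t)))
          \<le> real (Suc j) * (4 / (real (Suc j))\<^sup>2 * ?C)" by (rule mult_left_mono) simp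
      also have "\<dots> = 4 * ?C / real (Suc j)" by (simp add: power2_eq_square divide_simps)
      finally show "norm (real (Suc j) * (LINT t|lborel. far t * gauss (real (Suc j) * (x - t))))
        \<le> 4 * ?C / real (Suc j)" by (simp only: norm_mult norm_of_nat)
    qed
    show "(\<lambda>j. 4 * ?C / real (Suc j)) \<longlonglongrightarrow> 0" by (rule LIMSEQ_Suc[OF lim_const_over_n])
  qed
  ultimately have "(\<lambda>j. real (Suc j) * (LINT t|lborel. near t * gauss (real (Suc j) * (x - t)))
      + real (Suc j) * (LINT t|lborel. far t * gauss (real (Suc j) * (x - t)))) \<longlonglongrightarrow> g x + 0"
    by (rule tendsto_add)
  moreover have "(LINT t|lborel. g t * gauss (real (Suc j) * (x - t)))
      = (LINT t|lborel. near t * gauss (real (Suc j) * (x - t))) + (LINT t|lborel. far t * gauss (real (Suc j) * (x - t)))" for j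
    unfolding split[of "_ :: real"] distrib_right by (rule Bochner_Integration.integral_add[OF near_int far_int])
  ultimately show ?thesis by (simp add: distrib_left)
qed

lemma truncated_fourier_integral:
  "(LINT t:{- R..R}|lborel. exp (- (\<i> * of_real \<omega> * of_real t)) * of_real (g t))
     = fourier_laplace (\<lambda>t. indicator {- R..R} t *\<^sub>R of_real (g t)) (of_real (- \<omega>))"
  unfolding set_lebesgue_integral_def fourier_laplace_def
  by (intro Bochner_Integration.integral_cong) (auto simp: mult_ac)

text \<open>Let \<open>F\<^sub>R\<close> be the Fourier integral of \<open>g\<close> truncated at \<open>R\<close>, and \<open>E(R)\<close> the integral of
  \<open>g\<^sup>2\<close> over \<open>[-R, R]\<close>.  The Plancherel inequality gives \<open>\<parallel>F\<^sub>R\<parallel>\<^sup>2 \<le> 2\<pi> E(R)\<close>, and Fubini's theorem gives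
  the inner product \<open>2\<pi> E(R)\<close> of \<open>F\<^sub>R\<close> and \<open>D\<close>.  Hence \<open>\<parallel>F\<^sub>R - D\<parallel>\<^sup>2 \<le> \<parallel>D\<parallel>\<^sup>2 - 2\<pi> E(R)\<close>, which tends to 0
  by the Plancherel equality.\<close>

lemma has_L2_fourier_transform_fourier_laplace:
  assumes [measurable]: "D \<in> borel_measurable borel"
    and bound: "\<And>\<omega>. cmod (D \<omega>) \<le> B" and supp: "\<And>\<omega>. \<omega> \<notin> {a..b} \<Longrightarrow> D \<omega> = 0"
    and cont: "AE \<omega> in lborel. isCont D \<omega>"
    and g: "\<And>x. of_real (g x) = fourier_laplace D (of_real x) / (2 * of_real pi)"
  shows "square_integrable g" and "has_L2_fourier_transform g D"
proof -
  have D: "integrable lborel D" by (rule integrable_bounded_support[OF _ bound supp]) auto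
  have D2: "integrable lborel (\<lambda>\<omega>. (cmod (D \<omega>))\<^sup>2)"
    by (rule integrable_bounded_support[where B = "B\<^sup>2" and a = a and b = b])
       (auto simp: supp intro!: power_mono bound)
  have g_Re: "g = (\<lambda>x. Re (fourier_laplace D (of_real x) / (2 * of_real pi)))"
    by (rule ext) (simp flip: g)
  have [measurable]: "g \<in> borel_measurable borel" unfolding g_Re by measurable
  have norm_g: "\<bar>g x\<bar> = cmod (fourier_laplace D (of_real x)) / (2 * pi)" for x
    using arg_cong[OF g[of x], of cmod] by (simp add: norm_divide)
  define N where "N = (LINT \<omega>|lborel. (cmod (D \<omega>))\<^sup>2)"
  have N0: "N \<ge> 0" by (simp add: N_def)
  have nn_g: "(\<integral>\<^sup>+x. ennreal ((g x)\<^sup>2) \<partial>lborel) = ennreal (N / (2 * pi))"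
  proof -
    have "(g x)\<^sup>2 = 1 / (2 * pi)\<^sup>2 * (cmod (fourier_laplace D (of_real x)))\<^sup>2" for x
      by (subst power2_abs[symmetric]) (simp add: norm_g power_divide)
    then have "(\<integral>\<^sup>+x. ennreal ((g x)\<^sup>2) \<partial>lborel)
        = ennreal (1 / (2 * pi)\<^sup>2) * (\<integral>\<^sup>+x. ennreal ((cmod (fourier_laplace D (of_real x)))\<^sup>2) \<partial>lborel)"
      by (subst nn_integral_cmult[symmetric]) (auto simp flip: ennreal_mult)
    also have "\<dots> = ennreal (1 / (2 * pi)\<^sup>2 * (2 * pi * N))"
    proof -
      have "(\<integral>\<^sup>+x. ennreal ((cmod (fourier_laplace D (of_real x)))\<^sup>2) \<partial>lborel) = ennreal (2 * pi * N)"
        unfolding N_def by (rule plancherel[OF _ bound supp cont]) auto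
      then show ?thesis using N0 by (subst ennreal_mult) auto
    qed
    also have "1 / (2 * pi)\<^sup>2 * (2 * pi * N) = N / (2 * pi)" by (simp add: power2_eq_square)
    finally show ?thesis .
  qed
  have g2: "integrable lborel (\<lambda>x. (g x)\<^sup>2)"
    by (rule integrableI_bounded) (auto simp: nn_g)
  have int_g2: "(LINT x|lborel. (g x)\<^sup>2) = N / (2 * pi)"
    using nn_g nn_integral_eq_integral[OF g2] N0 by (simp add: integral_nonneg_AE)
  show sq: "square_integrable g" using g2 by (simp add: square_integrable_def)
  define h where "h R t = indicator {- R..R} t *\<^sub>R complex_of_real (g t)" for R t :: real
  have [measurable]: "h R \<in> borel_measurable borel" for R unfolding h_def by measurable
  have h: "integrable lborel (h R)" for R
    by (rule integrable_bounded_support[where B = "(LINT \<omega>|lborel. cmod (D \<omega>)) / (2 * pi)" and a = "- R" and b = R])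
       (auto simp: h_def norm_g indicator_def intro!: divide_right_mono norm_fourier_laplace_le)
  define E where "E R = (LINT t|lborel. indicator {- R..R} t * (g t)\<^sup>2)" for R :: real
  have E_int: "integrable lborel (\<lambda>t. indicator {- R..R} t * (g t)\<^sup>2)" for R :: real
    by (rule Bochner_Integration.integrable_bound[OF g2]) (auto simp: indicator_def)
  have E0: "E R \<ge> 0" for R by (simp add: E_def)
  have E_lim: "(E \<longlongrightarrow> N / (2 * pi)) at_top"
    unfolding E_def int_g2[symmetric]
  proof (rule integral_dominated_convergence_at_top[OF _ _ g2])
    show "AE x in lborel. ((\<lambda>R. indicator {- R..R} x * (g x)\<^sup>2) \<longlongrightarrow> (g x)\<^sup>2) at_top"
    proof (intro AE_I2 tendsto_eventually)
      fix x
      show "\<forall>\<^sub>F R in at_top. indicator {- R..R} x * (g x)\<^sup>2 = (g x)\<^sup>2"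
        using eventually_ge_at_top[of "\<bar>x\<bar>"] by eventually_elim (auto simp: indicator_def)
    qed
  qed (auto simp: indicator_def)
  let ?F = "\<lambda>R \<omega>. fourier_laplace (h R) (of_real (- \<omega>))"
  have F_meas [measurable]: "?F R \<in> borel_measurable borel" for R by measurable
  have nn_F: "(\<integral>\<^sup>+\<omega>. ennreal ((cmod (?F R \<omega>))\<^sup>2) \<partial>lborel) \<le> ennreal (2 * pi * E R)" for R
  proof -
    have "(\<integral>\<^sup>+\<omega>. ennreal ((cmod (?F R \<omega>))\<^sup>2) \<partial>lborel)
        = (\<integral>\<^sup>+\<omega>. ennreal ((cmod (fourier_laplace (h R) (of_real \<omega>)))\<^sup>2) \<partial>lborel)"
      by (subst (2) nn_integral_real_affine[where c = "- 1" and t = 0]) auto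
    also have "\<dots> \<le> ennreal (2 * pi) * (\<integral>\<^sup>+t. ennreal ((cmod (h R t))\<^sup>2) \<partial>lborel)"
      by (rule plancherel_le[OF h])
    also have "(\<integral>\<^sup>+t. ennreal ((cmod (h R t))\<^sup>2) \<partial>lborel) = (\<integral>\<^sup>+t. ennreal (indicator {- R..R} t * (g t)\<^sup>2) \<partial>lborel)"
      by (intro nn_integral_cong) (auto simp: h_def indicator_def)
    also have "\<dots> = ennreal (E R)"
      unfolding E_def by (rule nn_integral_eq_integral[OF E_int]) auto
    finally show ?thesis using E0 by (simp add: ennreal_mult')
  qed
  have F2: "integrable lborel (\<lambda>\<omega>. (cmod (?F R \<omega>))\<^sup>2)" for R
    using nn_F[of R] by (intro integrableI_bounded) (auto intro: le_less_trans simp del: of_real_minus)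
  have F_le: "(LINT \<omega>|lborel. (cmod (?F R \<omega>))\<^sup>2) \<le> 2 * pi * E R" for R
    using nn_F[of R] nn_integral_eq_integral[OF F2[of R]] E0[of R] by simp
  have cross: "(LINT \<omega>|lborel. cnj (D \<omega>) * ?F R \<omega>) = of_real (2 * pi * E R)" for R
  proof -
    have "(LINT \<omega>|lborel. cnj (D \<omega>) * ?F R \<omega>)
        = (LINT t|lborel. h R t * (LINT \<omega>|lborel. cnj (D \<omega>) * exp (\<i> * of_real t * of_real (- \<omega>))))"
      unfolding fourier_laplace_def
      by (rule Fubini_bounded_kernel[where B = 1]) (use D h in \<open>auto simp: norm_exp_eq_Re\<close>)
    also have "\<dots> = (LINT t|lborel. h R t * cnj (fourier_laplace D (of_real t)))"
      unfolding cnj_fourier_laplace by (simp add: mult_ac)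
    also have "\<dots> = (LINT t|lborel. of_real (2 * pi * (indicator {- R..R} t * (g t)\<^sup>2)))"
    proof (intro Bochner_Integration.integral_cong refl)
      fix t
      have "fourier_laplace D (of_real t) = of_real (2 * pi * g t)" using g[of t] by (simp add: field_simps)
      then show "h R t * cnj (fourier_laplace D (of_real t)) = of_real (2 * pi * (indicator {- R..R} t * (g t)\<^sup>2))"
        by (simp add: h_def scaleR_conv_of_real power2_eq_square)
    qed
    also have "\<dots> = of_real (2 * pi * E R)" unfolding integral_complex_of_real E_def by simp
    finally show ?thesis .
  qed
  have diff: "(\<integral>\<^sup>+\<omega>. ennreal ((cmod (?F R \<omega> - D \<omega>))\<^sup>2) \<partial>lborel) \<le> ennreal (N - 2 * pi * E R)" for R
  proof -
    note diff_sq = integral_norm_diff_square[OF F_meas[of R] assms(1) F2 D2]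
    have "(LINT \<omega>|lborel. (cmod (?F R \<omega> - D \<omega>))\<^sup>2)
        = (LINT \<omega>|lborel. (cmod (?F R \<omega>))\<^sup>2) - 2 * Re (LINT \<omega>|lborel. cnj (D \<omega>) * ?F R \<omega>) + N"
      unfolding N_def by (rule diff_sq(2))
    also have "\<dots> \<le> N - 2 * pi * E R" using F_le[of R] unfolding cross by simp
    finally show ?thesis
      by (subst nn_integral_eq_integral[OF diff_sq(1)]) (auto intro: ennreal_leI)
  qed
  have "((\<lambda>R. ennreal (N - 2 * pi * E R)) \<longlongrightarrow> ennreal (N - 2 * pi * (N / (2 * pi)))) at_top"
    by (intro tendsto_intros E_lim)
  then have "((\<lambda>R. ennreal (N - 2 * pi * E R)) \<longlongrightarrow> 0) at_top" by simp
  then have "((\<lambda>R. \<integral>\<^sup>+\<omega>. ennreal ((cmod (?F R \<omega> - D \<omega>))\<^sup>2) \<partial>lborel) \<longlongrightarrow> 0) at_top"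
    by (rule tendsto_sandwich[OF _ _ tendsto_const, rotated 2]) (use diff in \<open>auto simp del: of_real_minus\<close>)
  then show "has_L2_fourier_transform g D"
    unfolding has_L2_fourier_transform_def L2_tendsto_def truncated_fourier_integral h_def[symmetric]
    using D2 by (simp add: square_integrable_def)
qed

text \<open>Pairing with \<open>\<phi>\<close> is continuous in the mean-square norm by the Cauchy--Schwarz inequality, and for
  truncated integrals Fubini's theorem moves the transform from \<open>g\<close> to \<open>\<phi>\<close>.\<close>

lemma fourier_laplace_truncation_tendsto:
  assumes cont: "continuous_on UNIV g" and sq: "integrable lborel (\<lambda>t. (g t)\<^sup>2)"
    and F: "has_L2_fourier_transform g G"
    and phi: "integrable lborel \<phi>" "integrable lborel (\<lambda>\<omega>. (cmod (\<phi> \<omega>))\<^sup>2)"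
    and G: "integrable lborel (\<lambda>\<omega>. \<phi> \<omega> * G \<omega>)"
  shows "(\<lambda>n. LINT t|lborel. indicator {- real n..real n} t *\<^sub>R of_real (g t) * fourier_laplace \<phi> (of_real (- t)))
           \<longlonglongrightarrow> (LINT \<omega>|lborel. \<phi> \<omega> * G \<omega>)"
proof -
  have [measurable]: "g \<in> borel_measurable borel" using cont by (rule borel_measurable_continuous_onI)
  have [measurable]: "\<phi> \<in> borel_measurable borel" using phi(1) by auto
  have [measurable]: "G \<in> borel_measurable borel"
    using F by (simp add: has_L2_fourier_transform_def square_integrable_def)
  define h where "h R t = indicator {- R..R} t *\<^sub>R complex_of_real (g t)" for R t :: real
  have [measurable]: "h R \<in> borel_measurable borel" for R unfolding h_def by measurable
  have h: "integrable lborel (h R)" for R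
  proof -
    obtain B where "0 \<le> B" "\<And>t. t \<in> {- R..R} \<Longrightarrow> \<bar>g t\<bar> \<le> B"
      using continuous_bounded_Icc[OF cont] by metis
    then show ?thesis
      by (intro integrable_bounded_support[where B = B and a = "- R" and b = R])
         (auto simp: h_def indicator_def)
  qed
  let ?F = "\<lambda>R \<omega>. fourier_laplace (h R) (of_real (- \<omega>))"
  have [measurable]: "?F R \<in> borel_measurable borel" for R by measurable
  have F_int: "integrable lborel (\<lambda>\<omega>. \<phi> \<omega> * ?F R \<omega>)" for R
    by (rule Bochner_Integration.integrable_bound[OF integrable_mult_right[OF phi(1), of "complex_of_real (LINT t|lborel. cmod (h R t))"]])
       (auto simp: norm_mult mult.commute[of "cmod (\<phi> _)"] simp del: of_real_minus
          intro!: mult_right_mono norm_fourier_laplace_le[THEN order_trans])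
  have "((\<lambda>R. \<integral>\<^sup>+\<omega>. ennreal ((cmod (?F R \<omega> - G \<omega>))\<^sup>2) \<partial>lborel) \<longlongrightarrow> 0) at_top"
    using F unfolding has_L2_fourier_transform_def L2_tendsto_def truncated_fourier_integral h_def[symmetric] by blast
  then have lim: "(\<lambda>n. \<integral>\<^sup>+\<omega>. ennreal ((cmod (?F (real n) \<omega> - G \<omega>))\<^sup>2) \<partial>lborel) \<longlonglongrightarrow> 0"
    by (rule filterlim_compose[OF _ filterlim_real_sequentially])
  define C where "C = (\<integral>\<^sup>+\<omega>. ennreal ((cmod (\<phi> \<omega>))\<^sup>2) \<partial>lborel)"
  have C: "C < \<top>" unfolding C_def using phi(2) by (simp add: nn_integral_eq_integral)
  have bound: "ennreal ((cmod ((LINT \<omega>|lborel. \<phi> \<omega> * ?F R \<omega>) - (LINT \<omega>|lborel. \<phi> \<omega> * G \<omega>)))\<^sup>2)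
      \<le> C * (\<integral>\<^sup>+\<omega>. ennreal ((cmod (?F R \<omega> - G \<omega>))\<^sup>2) \<partial>lborel)" for R
  proof -
    have "(LINT \<omega>|lborel. \<phi> \<omega> * ?F R \<omega>) - (LINT \<omega>|lborel. \<phi> \<omega> * G \<omega>) = (LINT \<omega>|lborel. \<phi> \<omega> * (?F R \<omega> - G \<omega>))"
      unfolding right_diff_distrib by (rule Bochner_Integration.integral_diff[OF F_int G, symmetric])
    then have "ennreal (cmod ((LINT \<omega>|lborel. \<phi> \<omega> * ?F R \<omega>) - (LINT \<omega>|lborel. \<phi> \<omega> * G \<omega>)))
        \<le> (\<integral>\<^sup>+\<omega>. ennreal (cmod (\<phi> \<omega>)) * ennreal (cmod (?F R \<omega> - G \<omega>)) \<partial>lborel)"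
      using ennreal_norm_integral_le[of lborel "\<lambda>\<omega>. \<phi> \<omega> * (?F R \<omega> - G \<omega>)"] by (simp add: norm_mult ennreal_mult)
    then have "(ennreal (cmod ((LINT \<omega>|lborel. \<phi> \<omega> * ?F R \<omega>) - (LINT \<omega>|lborel. \<phi> \<omega> * G \<omega>))))\<^sup>2
        \<le> (\<integral>\<^sup>+\<omega>. ennreal (cmod (\<phi> \<omega>)) * ennreal (cmod (?F R \<omega> - G \<omega>)) \<partial>lborel)\<^sup>2"
      by (rule power_mono) simp
    also have "\<dots> \<le> (\<integral>\<^sup>+\<omega>. (ennreal (cmod (\<phi> \<omega>)))\<^sup>2 \<partial>lborel) * (\<integral>\<^sup>+\<omega>. (ennreal (cmod (?F R \<omega> - G \<omega>)))\<^sup>2 \<partial>lborel)"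
      by (rule Cauchy_Schwarz_nn_integral) measurable
    finally show ?thesis by (simp add: C_def ennreal_power)
  qed
  have "(\<lambda>n. C * (\<integral>\<^sup>+\<omega>. ennreal ((cmod (?F (real n) \<omega> - G \<omega>))\<^sup>2) \<partial>lborel)) \<longlonglongrightarrow> C * 0"
    by (rule ennreal_tendsto_cmult[OF C lim])
  then have "(\<lambda>n. C * (\<integral>\<^sup>+\<omega>. ennreal ((cmod (?F (real n) \<omega> - G \<omega>))\<^sup>2) \<partial>lborel)) \<longlonglongrightarrow> 0" by simp
  then have "(\<lambda>n. ennreal ((cmod ((LINT \<omega>|lborel. \<phi> \<omega> * ?F (real n) \<omega>) - (LINT \<omega>|lborel. \<phi> \<omega> * G \<omega>)))\<^sup>2)) \<longlonglongrightarrow> 0"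
    by (rule tendsto_sandwich[OF _ _ tendsto_const, rotated 2]) (use bound in \<open>auto simp del: of_real_minus\<close>)
  then have "(\<lambda>n. (cmod ((LINT \<omega>|lborel. \<phi> \<omega> * ?F (real n) \<omega>) - (LINT \<omega>|lborel. \<phi> \<omega> * G \<omega>)))\<^sup>2) \<longlonglongrightarrow> 0"
    by (subst (asm) ennreal_tendsto_0_iff) auto
  then have "(\<lambda>n. (LINT \<omega>|lborel. \<phi> \<omega> * ?F (real n) \<omega>) - (LINT \<omega>|lborel. \<phi> \<omega> * G \<omega>)) \<longlonglongrightarrow> 0"
    by (simp add: tendsto_norm_zero_iff)
  then have "(\<lambda>n. LINT \<omega>|lborel. \<phi> \<omega> * ?F (real n) \<omega>) \<longlonglongrightarrow> (LINT \<omega>|lborel. \<phi> \<omega> * G \<omega>)"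
    by (rule LIM_zero_cancel)
  moreover have "(LINT \<omega>|lborel. \<phi> \<omega> * ?F R \<omega>) = (LINT t|lborel. h R t * fourier_laplace \<phi> (of_real (- t)))" for R
  proof -
    have "(LINT \<omega>|lborel. \<phi> \<omega> * ?F R \<omega>)
        = (LINT t|lborel. h R t * (LINT \<omega>|lborel. \<phi> \<omega> * exp (\<i> * of_real t * of_real (- \<omega>))))"
      unfolding fourier_laplace_def
      by (rule Fubini_bounded_kernel[where B = 1]) (use phi h in \<open>auto simp: norm_exp_eq_Re\<close>)
    then show ?thesis by (simp add: fourier_laplace_def mult_ac)
  qed
  ultimately show ?thesis by (simp add: h_def)
qed

lemma norm_exp_minus_ii_real: "cmod (exp (- (\<i> * complex_of_real a * complex_of_real b))) = 1"
  by (simp add: norm_exp_eq_Re)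

text \<open>For \<open>\<phi>(\<omega>) = gauss(\<sigma>\<omega>) exp(\<i>\<omega>x)\<close> the transform of \<open>\<phi>\<close> is a Gaussian of width \<open>\<sigma>\<close> centred at \<open>x\<close>.  As
  \<open>\<sigma>\<close> tends to 0 the side with \<open>g\<close> tends to a multiple of \<open>g(x)\<close>, by continuity of \<open>g\<close>, and the side with the
  transform tends to the Fourier integral of \<open>D\<close>, because \<open>D\<close> is integrable.\<close>

theorem fourier_inversion_band_limited:
  assumes cont: "continuous_on UNIV g" and sq: "square_integrable g"
    and F: "has_L2_fourier_transform g G"
    and supp: "AE \<omega> in lborel. \<omega> \<notin> {a..b} \<longrightarrow> G \<omega> = 0"
  defines "D \<equiv> (\<lambda>\<omega>. indicator {a..b} \<omega> *\<^sub>R G \<omega>)"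
  shows "integrable lborel D" and "integrable lborel (\<lambda>\<omega>. (cmod (D \<omega>))\<^sup>2)"
    and "of_real (g x) = fourier_laplace D (of_real x) / (2 * of_real pi)"
proof -
  have [measurable]: "g \<in> borel_measurable borel" using cont by (rule borel_measurable_continuous_onI)
  have g2: "integrable lborel (\<lambda>t. (g t)\<^sup>2)" using sq by (simp add: square_integrable_def)
  have [measurable]: "G \<in> borel_measurable borel" and G2: "integrable lborel (\<lambda>\<omega>. (cmod (G \<omega>))\<^sup>2)"
    using F by (auto simp: has_L2_fourier_transform_def square_integrable_def)
  have [measurable]: "D \<in> borel_measurable borel" unfolding D_def by measurable
  show D2: "integrable lborel (\<lambda>\<omega>. (cmod (D \<omega>))\<^sup>2)"
    by (rule Bochner_Integration.integrable_bound[OF G2]) (auto simp: D_def indicator_def)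
  show D: "integrable lborel D"
  proof (rule Bochner_Integration.integrable_bound)
    show "integrable lborel (\<lambda>\<omega>. (cmod (D \<omega>))\<^sup>2 + indicat_real {a..b} \<omega>)"
      by (intro Bochner_Integration.integrable_add D2 integrable_real_indicator) (auto simp: emeasure_lborel_Icc_eq)
    show "AE \<omega> in lborel. norm (D \<omega>) \<le> norm ((cmod (D \<omega>))\<^sup>2 + indicat_real {a..b} \<omega>)"
    proof (intro AE_I2)
      fix \<omega>
      show "norm (D \<omega>) \<le> norm ((cmod (D \<omega>))\<^sup>2 + indicat_real {a..b} \<omega>)"
        using mult_le_sum_squares[of "cmod (D \<omega>)" 1] by (auto simp: D_def indicator_def)
    qed
  qed measurable
  have D_G: "AE \<omega> in lborel. D \<omega> = G \<omega>"
    using supp by eventually_elim (auto simp: D_def indicator_def)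
  \<comment> \<open>The Gaussian multiplier makes every integral absolutely convergent.\<close>
  have regularized: "(LINT \<omega>|lborel. of_real (gauss (\<sigma> * \<omega>)) * exp (\<i> * of_real \<omega> * of_real x) * D \<omega>)
      = of_real (sqrt (2 * pi) / \<sigma> * (LINT t|lborel. g t * gauss ((x - t) / \<sigma>)))" if \<sigma>: "\<sigma> > 0" for \<sigma>
  proof -
    define \<phi> where "\<phi> \<omega> = of_real (gauss (\<sigma> * \<omega>)) * exp (\<i> * of_real \<omega> * of_real x)" for \<omega>
    have [measurable]: "\<phi> \<in> borel_measurable borel" unfolding \<phi>_def by measurable
    have norm_phi: "cmod (\<phi> \<omega>) = gauss (\<sigma> * \<omega>)" for \<omega> by (simp add: \<phi>_def norm_mult)
    have gauss_int: "integrable lborel (\<lambda>\<omega>. gauss (\<sigma> * \<omega>))" using integrable_gauss_scaled \<sigma> by simp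
    have gauss_square: "(gauss y)\<^sup>2 \<le> gauss y" for y
      using mult_left_mono[OF gauss_le_1, of "gauss y" y] by (simp add: power2_eq_square)
    have phi_int: "integrable lborel \<phi>"
      by (rule Bochner_Integration.integrable_bound[OF gauss_int]) (auto simp: norm_phi)
    have phi_D: "integrable lborel (\<lambda>\<omega>. \<phi> \<omega> * D \<omega>)"
      by (rule Bochner_Integration.integrable_bound[OF D])
         (auto simp: norm_phi norm_mult intro!: mult_left_le_one_le gauss_le_1)
    have "AE \<omega> in lborel. \<phi> \<omega> * D \<omega> = \<phi> \<omega> * G \<omega>" using D_G by eventually_elim simp
    then have G_int: "integrable lborel (\<lambda>\<omega>. \<phi> \<omega> * G \<omega>)"
        and G_eq: "(LINT \<omega>|lborel. \<phi> \<omega> * D \<omega>) = (LINT \<omega>|lborel. \<phi> \<omega> * G \<omega>)"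
      using phi_D by (auto intro!: integral_cong_AE integrable_cong_AE_imp[OF phi_D])
    have "fourier_laplace \<phi> (of_real (- t)) = of_real (sqrt (2 * pi) / \<sigma> * gauss ((x - t) / \<sigma>))" for t
      unfolding integral_gauss_scaled_exp[OF \<sigma>, symmetric] fourier_laplace_def \<phi>_def
      by (intro Bochner_Integration.integral_cong refl) (simp add: algebra_simps flip: exp_add)
    moreover have "(\<lambda>n. LINT t|lborel. indicator {- real n..real n} t *\<^sub>R of_real (g t) * fourier_laplace \<phi> (of_real (- t)))
        \<longlonglongrightarrow> (LINT \<omega>|lborel. \<phi> \<omega> * G \<omega>)"
      by (rule fourier_laplace_truncation_tendsto[OF cont g2 F phi_int _ G_int])
         (rule Bochner_Integration.integrable_bound[OF gauss_int], auto simp: norm_phi gauss_square)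
    ultimately have lim1: "(\<lambda>n. LINT t|lborel. indicator {- real n..real n} t *\<^sub>R complex_of_real (g t)
          * of_real (sqrt (2 * pi) / \<sigma> * gauss ((x - t) / \<sigma>))) \<longlonglongrightarrow> (LINT \<omega>|lborel. \<phi> \<omega> * G \<omega>)"
      by simp
    have w: "integrable lborel (\<lambda>t. sqrt (2 * pi) / \<sigma> * ((g t)\<^sup>2 + gauss ((x - t) / \<sigma>)))"
      using lborel_integrable_real_affine[of gauss "- 1 / \<sigma>" "x / \<sigma>"] \<sigma> g2
      by (intro integrable_mult_right Bochner_Integration.integrable_add) (auto simp: diff_divide_distrib)
    have bound: "\<bar>g t\<bar> * gauss ((x - t) / \<sigma>) \<le> (g t)\<^sup>2 + gauss ((x - t) / \<sigma>)" for t
      using mult_le_sum_squares[of "\<bar>g t\<bar>" "gauss ((x - t) / \<sigma>)"] gauss_square[of "(x - t) / \<sigma>"] by simp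
    have "(\<lambda>n. LINT t|lborel. indicator {- real n..real n} t *\<^sub>R complex_of_real (g t)
          * of_real (sqrt (2 * pi) / \<sigma> * gauss ((x - t) / \<sigma>)))
        \<longlonglongrightarrow> (LINT t|lborel. complex_of_real (g t) * of_real (sqrt (2 * pi) / \<sigma> * gauss ((x - t) / \<sigma>)))"
    proof (rule integral_dominated_convergence[OF _ _ w])
      show "AE t in lborel. (\<lambda>n. indicator {- real n..real n} t *\<^sub>R complex_of_real (g t)
            * of_real (sqrt (2 * pi) / \<sigma> * gauss ((x - t) / \<sigma>)))
         \<longlonglongrightarrow> complex_of_real (g t) * of_real (sqrt (2 * pi) / \<sigma> * gauss ((x - t) / \<sigma>))"
      proof (intro AE_I2 tendsto_eventually)
        fix t
        show "\<forall>\<^sub>F n in sequentially. indicator {- real n..real n} t *\<^sub>R complex_of_real (g t)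
            * of_real (sqrt (2 * pi) / \<sigma> * gauss ((x - t) / \<sigma>))
          = complex_of_real (g t) * of_real (sqrt (2 * pi) / \<sigma> * gauss ((x - t) / \<sigma>))"
          using eventually_ge_at_top[of "nat \<lceil>\<bar>t\<bar>\<rceil>"]
        proof eventually_elim
          case (elim n)
          then have "t \<in> {- real n..real n}" by simp linarith
          then show ?case by simp
        qed
      qed
      show "AE t in lborel. norm (indicator {- real n..real n} t *\<^sub>R complex_of_real (g t)
            * of_real (sqrt (2 * pi) / \<sigma> * gauss ((x - t) / \<sigma>)))
          \<le> sqrt (2 * pi) / \<sigma> * ((g t)\<^sup>2 + gauss ((x - t) / \<sigma>))" for n
      proof (intro AE_I2)
        fix t
        have "norm (indicator {- real n..real n} t *\<^sub>R complex_of_real (g t)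
            * of_real (sqrt (2 * pi) / \<sigma> * gauss ((x - t) / \<sigma>)))
          \<le> sqrt (2 * pi) / \<sigma> * (\<bar>g t\<bar> * gauss ((x - t) / \<sigma>))"
          using \<sigma> by (auto simp: norm_mult norm_divide indicator_def mult_ac)
        also have "\<dots> \<le> sqrt (2 * pi) / \<sigma> * ((g t)\<^sup>2 + gauss ((x - t) / \<sigma>))"
          using \<sigma> by (intro mult_left_mono bound) auto
        finally show "norm (indicator {- real n..real n} t *\<^sub>R complex_of_real (g t)
            * of_real (sqrt (2 * pi) / \<sigma> * gauss ((x - t) / \<sigma>)))
          \<le> sqrt (2 * pi) / \<sigma> * ((g t)\<^sup>2 + gauss ((x - t) / \<sigma>))" .
      qed
    qed measurable
    from LIMSEQ_unique[OF lim1 this]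
    have "(LINT \<omega>|lborel. \<phi> \<omega> * D \<omega>)
        = (LINT t|lborel. complex_of_real (sqrt (2 * pi) / \<sigma> * (g t * gauss ((x - t) / \<sigma>))))"
      unfolding G_eq by (simp add: mult_ac)
    also have "\<dots> = of_real (sqrt (2 * pi) / \<sigma> * (LINT t|lborel. g t * gauss ((x - t) / \<sigma>)))"
      unfolding integral_complex_of_real integral_mult_right_zero ..
    finally show ?thesis by (simp only: \<phi>_def)
  qed
  let ?\<sigma> = "\<lambda>j. 1 / real (Suc j)"
  have lim_g: "(\<lambda>j. complex_of_real (sqrt (2 * pi) * (real (Suc j) * (LINT t|lborel. g t * gauss (real (Suc j) * (x - t))))))
      \<longlonglongrightarrow> of_real (sqrt (2 * pi) * g x)"
    by (intro tendsto_of_real tendsto_mult tendsto_const approximate_identity_gauss cont g2)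
  have "(\<lambda>j. LINT \<omega>|lborel. of_real (gauss (?\<sigma> j * \<omega>)) * exp (\<i> * of_real \<omega> * of_real x) * D \<omega>)
      \<longlonglongrightarrow> (LINT \<omega>|lborel. of_real (gauss 0) * exp (\<i> * of_real \<omega> * of_real x) * D \<omega>)"
  proof (rule integral_dominated_convergence[OF _ _ integrable_norm[OF D]])
    show "AE \<omega> in lborel. (\<lambda>j. of_real (gauss (?\<sigma> j * \<omega>)) * exp (\<i> * of_real \<omega> * of_real x) * D \<omega>)
        \<longlonglongrightarrow> of_real (gauss 0) * exp (\<i> * of_real \<omega> * of_real x) * D \<omega>"
    proof (intro AE_I2 tendsto_mult tendsto_const tendsto_of_real)
      fix \<omega>
      have "(\<lambda>j. ?\<sigma> j * \<omega>) \<longlonglongrightarrow> 0 * \<omega>"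
        by (rule tendsto_mult[OF LIMSEQ_Suc[OF lim_1_over_n] tendsto_const])
      then show "(\<lambda>j. gauss (?\<sigma> j * \<omega>)) \<longlonglongrightarrow> gauss 0"
        by (intro isCont_tendsto_compose[OF isCont_gauss]) simp
    qed
  qed (auto simp: norm_mult intro!: mult_left_le_one_le gauss_le_1)
  moreover have "(LINT \<omega>|lborel. of_real (gauss (?\<sigma> j * \<omega>)) * exp (\<i> * of_real \<omega> * of_real x) * D \<omega>)
      = of_real (sqrt (2 * pi) * (real (Suc j) * (LINT t|lborel. g t * gauss (real (Suc j) * (x - t)))))" for j
    using regularized[of "?\<sigma> j"] by (simp add: mult_ac)
  ultimately have "(LINT \<omega>|lborel. of_real (gauss 0) * exp (\<i> * of_real \<omega> * of_real x) * D \<omega>) = of_real (sqrt (2 * pi) * g x)"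
    using lim_g by (metis (no_types, lifting) LIMSEQ_unique tendsto_cong always_eventually ext)
  moreover have "(LINT \<omega>|lborel. of_real (gauss 0) * exp (\<i> * of_real \<omega> * of_real x) * D \<omega>)
      = of_real (gauss 0) * fourier_laplace D (of_real x)"
    unfolding fourier_laplace_def by (subst integral_mult_right_zero[symmetric]) (simp add: mult_ac)
  ultimately have "of_real (gauss 0) * fourier_laplace D (of_real x) = of_real (sqrt (2 * pi) * g x)" by simp
  then have "of_real (sqrt (2 * pi)) * (of_real (gauss 0) * fourier_laplace D (of_real x))
      = complex_of_real (sqrt (2 * pi) * (sqrt (2 * pi) * g x))" by simp
  then have "fourier_laplace D (of_real x) = of_real (2 * pi * g x)"
    by (simp add: gauss_0 flip: of_real_mult mult.assoc)
  then show "of_real (g x) = fourier_laplace D (of_real x) / (2 * of_real pi)" by simp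
qed

section \<open>Entire functions with bounded spectrum\<close>

lemma higher_deriv_of_power_series:
  fixes f :: "complex \<Rightarrow> complex"
  assumes "\<And>w. (\<lambda>k. a k * w ^ k) sums f (u + w)"
  shows "f holomorphic_on UNIV" and "(deriv ^^ k) f u = fact k * a k"
proof -
  have "f holomorphic_on ball u r" for r
    by (rule power_series_holomorphic[where a = a]) (use assms[of "_ - u"] in simp)
  then have "f field_differentiable at z" for z
    using holomorphic_on_open[OF open_ball, of f u "dist u z + 1"]
    by (auto simp: field_differentiable_def)
  then show hol: "f holomorphic_on UNIV" by (simp add: holomorphic_on_def)
  have "(\<lambda>k. (deriv ^^ k) f u / fact k * w ^ k) sums f (u + w)" for w
    using holomorphic_power_series[of f u "norm w + 1" "u + w"] hol
    by (auto simp: dist_norm intro: holomorphic_on_subset)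
  then have "(\<lambda>w. f (u + w)) has_fps_expansion Abs_fps (\<lambda>k. (deriv ^^ k) f u / fact k)"
    by (intro has_fps_expansionI) simp
  moreover have "(\<lambda>w. f (u + w)) has_fps_expansion Abs_fps a"
    using assms by (intro has_fps_expansionI) simp
  ultimately have "Abs_fps (\<lambda>k. (deriv ^^ k) f u / fact k) = Abs_fps a"
    by (rule fps_expansion_unique_complex)
  then have "(deriv ^^ k) f u / fact k = a k" by (metis fps_nth_Abs_fps)
  then show "(deriv ^^ k) f u = fact k * a k" by (simp add: field_simps)
qed

text \<open>Band-limitedness refers to the spectrum \<open>D\<close> and not to its transform.  Vanishing is required
  everywhere outside \<open>[-\<pi>, \<pi>]\<close> rather than almost everywhere, so that the pointwise bounds for products
  with exponentials hold without exceptional null sets.\<close>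

definition band_limited :: "(real \<Rightarrow> complex) \<Rightarrow> bool" where
  "band_limited D \<longleftrightarrow> integrable lborel D \<and> (\<forall>\<omega>. \<omega> \<notin> {-pi..pi} \<longrightarrow> D \<omega> = 0)"

lemma band_limited_mult:
  assumes "band_limited D" and cont: "continuous_on UNIV h"
  shows "band_limited (\<lambda>\<omega>. h \<omega> * D \<omega>)"
proof -
  have D: "integrable lborel D" and supp: "\<And>\<omega>. \<omega> \<notin> {-pi..pi} \<Longrightarrow> D \<omega> = 0"
    using assms by (auto simp: band_limited_def)
  have [measurable]: "h \<in> borel_measurable borel" using cont by (rule borel_measurable_continuous_onI)
  have "compact (h ` {-pi..pi})"
    by (intro compact_continuous_image continuous_on_subset[OF cont]) auto
  then have "bounded (h ` {-pi..pi})" by (rule compact_imp_bounded)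
  then obtain B where "\<forall>x\<in>{-pi..pi}. cmod (h x) \<le> B" by (auto simp: bounded_iff)
  then have B: "cmod (h \<omega>) \<le> B" if "\<omega> \<in> {-pi..pi}" for \<omega> using that by blast
  have "integrable lborel (\<lambda>\<omega>. h \<omega> * D \<omega>)"
  proof (rule Bochner_Integration.integrable_bound)
    show "integrable lborel (\<lambda>\<omega>. complex_of_real B * D \<omega>)" using D by simp
    show "AE \<omega> in lborel. norm (h \<omega> * D \<omega>) \<le> norm (complex_of_real B * D \<omega>)"
    proof (intro AE_I2)
      fix \<omega>
      show "norm (h \<omega> * D \<omega>) \<le> norm (complex_of_real B * D \<omega>)"
        using B[of \<omega>] supp[of \<omega>]
        by (cases "\<omega> \<in> {-pi..pi}") (auto simp: norm_mult intro!: mult_right_mono)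
    qed
  qed (use D in measurable)
  then show ?thesis using supp by (simp add: band_limited_def)
qed

lemma band_limited_exp_integrable:
  assumes "band_limited D"
  shows "integrable lborel (\<lambda>\<omega>. D \<omega> * exp (\<i> * of_real \<omega> * z))"
  using band_limited_mult[OF assms, of "\<lambda>\<omega>. exp (\<i> * of_real \<omega> * z)"]
  by (simp add: band_limited_def mult.commute continuous_intros)

lemma fourier_laplace_cmult: "fourier_laplace (\<lambda>\<omega>. c * D \<omega>) z = c * fourier_laplace D z"
  unfolding fourier_laplace_def by (subst integral_mult_right_zero[symmetric]) (simp only: mult.assoc)

lemma fourier_laplace_sum:
  assumes "\<And>i. i \<in> I \<Longrightarrow> band_limited (D i)"
  shows "fourier_laplace (\<lambda>\<omega>. \<Sum>i\<in>I. D i \<omega>) z = (\<Sum>i\<in>I. fourier_laplace (D i) z)"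
  unfolding fourier_laplace_def sum_distrib_right
  by (rule Bochner_Integration.integral_sum) (use assms band_limited_exp_integrable in auto)

lemma fourier_laplace_add_arg:
  "fourier_laplace D (z + w) = fourier_laplace (\<lambda>\<omega>. exp (\<i> * of_real \<omega> * z) * D \<omega>) w"
  unfolding fourier_laplace_def
  by (intro Bochner_Integration.integral_cong refl) (simp add: distrib_left exp_add mult_ac)

text \<open>The exponential series is integrated term by term; on the support \<open>|\<omega>w|\<close> is at most \<open>\<pi>|w|\<close>.\<close>

lemma fourier_laplace_power_series_0:
  assumes D: "band_limited D"
  shows "(\<lambda>k. fourier_laplace (\<lambda>\<omega>. (\<i> * of_real \<omega>) ^ k * D \<omega>) 0 / fact k * w ^ k) sums fourier_laplace D w"
proof -
  have D_int: "integrable lborel D" and supp: "\<And>\<omega>. \<omega> \<notin> {-pi..pi} \<Longrightarrow> D \<omega> = 0"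
    using D by (auto simp: band_limited_def)
  let ?f = "\<lambda>k \<omega>. (\<i> * of_real \<omega>) ^ k * D \<omega> * (w ^ k / fact k)"
  have exp_sums: "(\<lambda>k. ?f k \<omega>) sums (D \<omega> * exp (\<i> * of_real \<omega> * w))" for \<omega>
    using sums_mult[OF exp_converges[of "\<i> * of_real \<omega> * w"], of "D \<omega>"]
    by (simp add: power_mult_distrib scaleR_conv_of_real divide_inverse mult_ac)
  have f_int: "integrable lborel (?f k)" for k
  proof (rule integrable_mult_left)
    have "band_limited (\<lambda>\<omega>. (\<i> * of_real \<omega>) ^ k * D \<omega>)"
      by (intro band_limited_mult D continuous_intros)
    then show "integrable lborel (\<lambda>\<omega>. (\<i> * of_real \<omega>) ^ k * D \<omega>)" by (simp add: band_limited_def)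
  qed
  have bound: "norm (?f k \<omega>) \<le> cmod (D \<omega>) * ((pi * cmod w) ^ k / fact k)" for k \<omega>
  proof (cases "\<omega> \<in> {-pi..pi}")
    case True
    then have "\<bar>\<omega>\<bar> ^ k \<le> pi ^ k" by (intro power_mono) auto
    then have "\<bar>\<omega>\<bar> ^ k * (cmod (D \<omega>) * cmod w ^ k / fact k) \<le> pi ^ k * (cmod (D \<omega>) * cmod w ^ k / fact k)"
      by (rule mult_right_mono) simp
    then show ?thesis by (simp add: norm_mult norm_power norm_divide power_mult_distrib mult_ac)
  qed (simp add: supp)
  have exp_summable: "summable (\<lambda>k. (pi * cmod w) ^ k / fact k)"
    using summable_exp_generic[of "pi * cmod w"] by (simp add: divide_inverse mult.commute)
  have "(\<lambda>k. integral\<^sup>L lborel (?f k)) sums (LINT \<omega>|lborel. (\<Sum>k. ?f k \<omega>))"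
  proof (rule sums_integral[OF f_int])
    show "AE \<omega> in lborel. summable (\<lambda>k. norm (?f k \<omega>))"
      by (intro AE_I2 summable_comparison_test'[OF summable_mult[OF exp_summable]]) (use bound in auto)
    show "summable (\<lambda>k. LINT \<omega>|lborel. norm (?f k \<omega>))"
    proof (rule summable_comparison_test')
      show "summable (\<lambda>k. (LINT \<omega>|lborel. cmod (D \<omega>)) * ((pi * cmod w) ^ k / fact k))"
        by (rule summable_mult[OF exp_summable])
      show "norm (LINT \<omega>|lborel. norm (?f k \<omega>)) \<le> (LINT \<omega>|lborel. cmod (D \<omega>)) * ((pi * cmod w) ^ k / fact k)" for k
      proof -
        have "norm (LINT \<omega>|lborel. norm (?f k \<omega>)) = (LINT \<omega>|lborel. norm (?f k \<omega>))"
          by (simp only: real_norm_def abs_of_nonneg Bochner_Integration.integral_nonneg norm_ge_zero)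
        also have "\<dots> \<le> (LINT \<omega>|lborel. cmod (D \<omega>) * ((pi * cmod w) ^ k / fact k))"
          by (intro integral_mono integrable_norm f_int integrable_mult_left D_int bound)
        finally show ?thesis by simp
      qed
    qed
  qed
  moreover have "(LINT \<omega>|lborel. (\<Sum>k. ?f k \<omega>)) = fourier_laplace D w"
    unfolding fourier_laplace_def by (simp add: sums_unique[OF exp_sums])
  moreover have "integral\<^sup>L lborel (?f k) = fourier_laplace (\<lambda>\<omega>. (\<i> * of_real \<omega>) ^ k * D \<omega>) 0 / fact k * w ^ k" for k
    unfolding integral_mult_left_zero fourier_laplace_def by simp
  ultimately show ?thesis by (simp only:)
qed

lemma fourier_laplace_power_series:
  assumes D: "band_limited D"
  shows "(\<lambda>k. fourier_laplace (\<lambda>\<omega>. (\<i> * of_real \<omega>) ^ k * D \<omega>) u / fact k * w ^ k)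
           sums fourier_laplace D (u + w)"
proof -
  have "band_limited (\<lambda>\<omega>. exp (\<i> * of_real \<omega> * u) * D \<omega>)"
    using D by (rule band_limited_mult) (intro continuous_intros)
  from fourier_laplace_power_series_0[OF this] show ?thesis
    using fourier_laplace_add_arg[of "\<lambda>\<omega>. (\<i> * of_real \<omega>) ^ _ * D \<omega>" u 0]
      fourier_laplace_add_arg[of D u w] by (simp add: mult_ac)
qed

lemma fourier_laplace_holomorphic: "band_limited D \<Longrightarrow> fourier_laplace D holomorphic_on UNIV"
  using higher_deriv_of_power_series(1)[OF fourier_laplace_power_series] .

lemma higher_deriv_fourier_laplace:
  "band_limited D \<Longrightarrow>
     (deriv ^^ k) (fourier_laplace D) u = fourier_laplace (\<lambda>\<omega>. (\<i> * of_real \<omega>) ^ k * D \<omega>) u"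
  using higher_deriv_of_power_series(2)[OF fourier_laplace_power_series, of D k u] by simp

text \<open>Differentiation multiplies the spectrum by \<open>\<i>\<omega>\<close>, and the factors \<open>(-\<i>)\<^sup>k\<close> in the chromatic derivative
  cancel the powers of \<open>\<i>\<close>.\<close>

lemma chromatic_deriv_fourier_laplace:
  assumes D: "band_limited D"
  shows "chromatic_deriv n (fourier_laplace D) u
       = \<i> ^ n * fourier_laplace (\<lambda>\<omega>. of_real (poly (legendre_poly_normalized n) \<omega>) * D \<omega>) u"
proof -
  let ?p = "legendre_poly_normalized n"
  let ?c = "\<lambda>k. complex_of_real (coeff ?p k)"
  have "fourier_laplace (\<lambda>\<omega>. of_real (poly ?p \<omega>) * D \<omega>) u
      = fourier_laplace (\<lambda>\<omega>. \<Sum>k\<le>degree ?p. ?c k * (of_real \<omega> ^ k * D \<omega>)) u"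
    by (simp add: poly_altdef sum_distrib_right mult.assoc)
  also have "\<dots> = (\<Sum>k\<le>degree ?p. fourier_laplace (\<lambda>\<omega>. ?c k * (of_real \<omega> ^ k * D \<omega>)) u)"
    by (intro fourier_laplace_sum band_limited_mult D continuous_intros)
  also have "\<dots> = (\<Sum>k\<le>degree ?p. ?c k * ((- \<i>) ^ k * (deriv ^^ k) (fourier_laplace D) u))"
  proof (intro sum.cong refl)
    fix k
    have "of_real \<omega> ^ k * D \<omega> = (- \<i>) ^ k * ((\<i> * of_real \<omega>) ^ k * D \<omega>)" for \<omega>
      by (simp add: mult.assoc[symmetric] power_mult_distrib[symmetric])
    then show "fourier_laplace (\<lambda>\<omega>. ?c k * (of_real \<omega> ^ k * D \<omega>)) u
        = ?c k * ((- \<i>) ^ k * (deriv ^^ k) (fourier_laplace D) u)"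
      by (simp only: higher_deriv_fourier_laplace[OF D] fourier_laplace_cmult)
  qed
  finally show ?thesis by (simp add: chromatic_deriv_def)
qed

section \<open>Chromatic kernels and spherical Bessel functions\<close>

lemma poly_legendre_normalized:
  "poly (legendre_poly_normalized n) \<omega> = sqrt (2 * real n + 1) * poly (legendre_poly n) (\<omega> / pi)"
  by (simp add: legendre_poly_normalized_def poly_pcompose)

lemma coeff_legendre_normalized:
  "coeff (legendre_poly_normalized n) k = sqrt (2 * real n + 1) * coeff (legendre_poly n) k / pi ^ k"
  by (simp add: legendre_poly_normalized_def coeff_pcompose_linear power_divide)

lemma degree_legendre_normalized: "degree (legendre_poly_normalized n) = n"
  by (simp add: legendre_poly_normalized_def degree_pcompose degree_legendre)

lemma legendre_normalized_parity:
  "poly (legendre_poly_normalized n) (- \<omega>) = (-1) ^ n * poly (legendre_poly_normalized n) \<omega>"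
proof -
  let ?c = "coeff (legendre_poly_normalized n)"
  have "?c k * (- \<omega>) ^ k = (-1) ^ n * (?c k * \<omega> ^ k)" for k
    using coeff_legendre_parity[of n k]
    by (cases "even n"; cases "even k") (simp_all add: coeff_legendre_normalized)
  then show ?thesis
    unfolding poly_altdef sum_distrib_left by (intro sum.cong refl)
qed

lemma legendre_normalized_0: "poly (legendre_poly_normalized 0) \<omega> = 1"
  by (simp add: poly_legendre_normalized legendre_poly_def)

text \<open>The factor \<open>1/(2\<pi>)\<close> is included so that integrating against a window gives the Legendre coefficient
  and the window with index 0 is the spectrum of \<open>sinc\<close>.\<close>

definition legendre_window :: "nat \<Rightarrow> real \<Rightarrow> complex" where
  "legendre_window n \<omega> = indicator {-pi..pi} \<omega> *\<^sub>R of_real (poly (legendre_poly_normalized n) \<omega> / (2 * pi))"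

text \<open>The function by which the \<open>n\<close>-th chromatic derivative is multiplied in the expansion.  By Poisson's integral it is
  a multiple of a spherical Bessel function.\<close>

definition chromatic_kernel :: "nat \<Rightarrow> complex \<Rightarrow> complex" where
  "chromatic_kernel n w = (- \<i>) ^ n * fourier_laplace (legendre_window n) w"

lemma legendre_window_measurable [measurable]: "legendre_window n \<in> borel_measurable borel"
  unfolding legendre_window_def poly_altdef by measurable

lemma legendre_window_bounded: obtains B where "\<And>\<omega>. cmod (legendre_window n \<omega>) \<le> B"
proof -
  let ?f = "\<lambda>\<omega>. poly (legendre_poly_normalized n) \<omega> / (2 * pi)"
  have "continuous_on UNIV ?f" by (intro continuous_intros) auto
  from continuous_bounded_Icc[OF this] obtain B where "B \<ge> 0" "\<And>t. t \<in> {-pi..pi} \<Longrightarrow> \<bar>?f t\<bar> \<le> B" by metis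
  then show ?thesis by (intro that[of B]) (auto simp: legendre_window_def indicator_def norm_divide)
qed

lemma legendre_window_band_limited: "band_limited (legendre_window n)"
proof -
  obtain B where "\<And>\<omega>. cmod (legendre_window n \<omega>) \<le> B"
    using legendre_window_bounded[of n] by blast
  then have "integrable lborel (legendre_window n)"
    by (intro integrable_bounded_support[where a = "-pi" and b = pi]) (auto simp: legendre_window_def)
  then show ?thesis by (simp add: band_limited_def legendre_window_def)
qed

lemma cnj_legendre_window [simp]: "cnj (legendre_window n \<omega>) = legendre_window n \<omega>"
  by (simp add: legendre_window_def)

lemma legendre_window_minus: "legendre_window n (- \<omega>) = (-1) ^ n * legendre_window n \<omega>"
  by (auto simp: legendre_window_def legendre_normalized_parity indicator_def)

lemma legendre_window_moment:
  "(LINT \<omega>|lborel. of_real (poly q (\<omega> / pi)) * legendre_window n \<omega>)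
     = of_real (sqrt (2 * real n + 1) * mean (legendre_poly n * q))"
proof -
  let ?r = "legendre_poly n * q"
  have "(LINT \<omega>|lborel. indicator {-pi..pi} \<omega> *\<^sub>R poly ?r (\<omega> / pi)) = 2 * pi * mean ?r"
  proof -
    have "indicator {-pi..pi} (pi * x) = (indicator {-1..1} x :: real)" for x :: real
    proof -
      have "- pi \<le> pi * x \<longleftrightarrow> - 1 \<le> x" "pi * x \<le> pi \<longleftrightarrow> x \<le> 1"
        using mult_le_cancel_left_pos[OF pi_gt_zero, of "- 1" x] mult_le_cancel_left_pos[OF pi_gt_zero, of x 1] by auto
      then show ?thesis by (simp add: indicator_def)
    qed
    then show ?thesis
      by (subst lborel_integral_real_affine[where c = pi and t = 0])
         (simp_all add: mean_def set_lebesgue_integral_def)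
  qed
  moreover have "of_real (poly q (\<omega> / pi)) * legendre_window n \<omega>
      = of_real (sqrt (2 * real n + 1) / (2 * pi) * (indicator {-pi..pi} \<omega> *\<^sub>R poly ?r (\<omega> / pi)))" for \<omega>
    by (simp add: legendre_window_def poly_legendre_normalized scaleR_conv_of_real)
  ultimately show ?thesis
    by (simp only: integral_complex_of_real integral_mult_right_zero) simp
qed

lemma legendre_window_orthogonal:
  "(LINT \<omega>|lborel. legendre_window n \<omega> * legendre_window m \<omega>) = (if n = m then 1 / (2 * of_real pi) else 0)"
proof -
  have "legendre_window n \<omega> * legendre_window m \<omega>
      = of_real (poly (smult (sqrt (2 * real n + 1) / (2 * pi)) (legendre_poly n)) (\<omega> / pi)) * legendre_window m \<omega>" for \<omega>
    by (simp add: legendre_window_def poly_legendre_normalized scaleR_conv_of_real indicator_def)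
  then have "(LINT \<omega>|lborel. legendre_window n \<omega> * legendre_window m \<omega>)
      = of_real (sqrt (2 * real m + 1) * (sqrt (2 * real n + 1) / (2 * pi) * mean (legendre_poly m * legendre_poly n)))"
    by (simp only: legendre_window_moment mult_smult_right mean_smult)
  also have "\<dots> = (if n = m then 1 / (2 * of_real pi) else 0)"
  proof (cases "n = m")
    case True
    have "sqrt a * (sqrt a / (2 * pi) * (1 / a)) = 1 / (2 * pi)" if "a > 0" for a
    proof -
      have "sqrt a * (sqrt a / (2 * pi) * (1 / a)) = (sqrt a * sqrt a) / a / (2 * pi)" by simp
      then show ?thesis using that by simp
    qed
    from this[of "2 * real m + 1"]
    have "sqrt (2 * real m + 1) * (sqrt (2 * real m + 1) / (2 * pi) * (1 / (2 * real m + 1))) = 1 / (2 * pi)"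
      by simp
    then show ?thesis using True by (simp only: mean_legendre_orthogonal if_True) simp
  qed (simp add: mean_legendre_orthogonal)
  finally show ?thesis .
qed

lemma fourier_laplace_legendre_window_minus:
  "fourier_laplace (legendre_window n) (- w) = (-1) ^ n * fourier_laplace (legendre_window n) w"
  unfolding fourier_laplace_def
  by (subst lborel_integral_real_affine[where c = "-1" and t = 0])
     (simp_all add: legendre_window_minus mult.assoc)

lemma csinc_eq_fourier_laplace: "csinc = fourier_laplace (legendre_window 0)"
proof
  fix z
  have F: "fourier_laplace (legendre_window 0) z
      = (LINT \<omega>|lborel. indicator {-pi..pi} \<omega> *\<^sub>R (exp (\<i> * of_real \<omega> * z) / (2 * of_real pi)))"
    unfolding fourier_laplace_def legendre_window_def legendre_normalized_0
    by (intro Bochner_Integration.integral_cong) (auto simp: scaleR_conv_of_real)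
  show "csinc z = fourier_laplace (legendre_window 0) z"
  proof (cases "z = 0")
    case True
    have "(LINT \<omega>|lborel. indicator {-pi..pi} \<omega> *\<^sub>R (1 / (2 * complex_of_real pi)))
        = (2 * pi) *\<^sub>R (1 / (2 * complex_of_real pi))"
      by (subst integral_scaleR_left) (auto simp: integrable_indicator_iff)
    then show ?thesis by (simp add: F[unfolded True] True csinc_def scaleR_conv_of_real)
  next
    case False
    let ?P = "\<lambda>\<omega>. exp (\<i> * of_real \<omega> * z) / (2 * of_real pi * \<i> * z)"
    have "(?P has_vector_derivative exp (\<i> * of_real \<omega> * z) / (2 * of_real pi)) (at \<omega> within S)" for \<omega> S
      by (rule has_vector_derivative_real_field) (auto intro!: derivative_eq_intros simp: False)
    then have "fourier_laplace (legendre_window 0) z = ?P pi - ?P (- pi)"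
      unfolding F by (intro integral_FTC_Icc) (auto intro!: continuous_intros)
    also have "\<dots> = (exp (\<i> * (of_real pi * z)) - exp (- (\<i> * (of_real pi * z)))) / (2 * \<i>) / (of_real pi * z)"
      by (simp add: mult_ac flip: diff_divide_distrib)
    also have "\<dots> = csinc z" using False by (simp add: csinc_def sin_exp_eq)
    finally show ?thesis ..
  qed
qed

lemma csinc_minus: "csinc (- z) = csinc z"
  by (simp add: csinc_def)

lemma legendre_normalized_mult_window_0: "of_real (poly (legendre_poly_normalized n) \<omega>) * legendre_window 0 \<omega> = legendre_window n \<omega>"
  by (simp add: legendre_window_def legendre_normalized_0 scaleR_conv_of_real)

lemma chromatic_deriv_csinc:
  "(- 1) ^ n * chromatic_deriv n csinc w = chromatic_kernel n w"
proof -
  have "(- 1) ^ n * \<i> ^ n = (- \<i>) ^ n" by (simp flip: power_mult_distrib)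
  then show ?thesis
    unfolding csinc_eq_fourier_laplace chromatic_deriv_fourier_laplace[OF legendre_window_band_limited]
      legendre_normalized_mult_window_0 chromatic_kernel_def by simp
qed

text \<open>As a function of \<open>v\<close>, \<open>sinc(z - v) = sinc(v - z)\<close> has the modulated spectrum
  \<open>exp(-\<i>\<omega>z)/(2\<pi>)\<close>.  The parity of the Legendre polynomials reverses the argument of the result.\<close>

lemma chromatic_deriv_csinc_shifted:
  "chromatic_deriv n (\<lambda>v. csinc (z - v)) u = chromatic_kernel n (z - u)"
proof -
  let ?E = "\<lambda>\<omega>. exp (\<i> * of_real \<omega> * (- z)) * legendre_window 0 \<omega>"
  have E: "band_limited ?E"
    by (intro band_limited_mult legendre_window_band_limited continuous_intros)
  have "csinc (z - v) = fourier_laplace ?E v" for v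
    using csinc_minus[of "z - v"] fourier_laplace_add_arg[of "legendre_window 0" "- z" v]
    by (simp add: csinc_eq_fourier_laplace)
  then have "chromatic_deriv n (\<lambda>v. csinc (z - v)) u
      = \<i> ^ n * fourier_laplace (\<lambda>\<omega>. of_real (poly (legendre_poly_normalized n) \<omega>) * ?E \<omega>) u"
    by (simp only: chromatic_deriv_fourier_laplace[OF E])
  also have "(\<lambda>\<omega>. of_real (poly (legendre_poly_normalized n) \<omega>) * ?E \<omega>)
      = (\<lambda>\<omega>. exp (\<i> * of_real \<omega> * (- z)) * legendre_window n \<omega>)"
    by (rule ext, subst legendre_normalized_mult_window_0[symmetric], rule mult.left_commute)
  also have "fourier_laplace \<dots> u = fourier_laplace (legendre_window n) (- (z - u))"
    unfolding fourier_laplace_add_arg[symmetric] by simp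
  also have "\<i> ^ n * \<dots> = chromatic_kernel n (z - u)"
    unfolding fourier_laplace_legendre_window_minus chromatic_kernel_def mult.assoc[symmetric]
    by (simp flip: power_mult_distrib)
  finally show ?thesis .
qed

text \<open>The mean value of \<open>p\<^sub>n(\<omega>) \<omega>\<^sup>m\<close> over \<open>[-\<pi>, \<pi>]\<close>, computed on \<open>[-1, 1]\<close>.\<close>

definition legendre_moment :: "nat \<Rightarrow> nat \<Rightarrow> real" where
  "legendre_moment n m = sqrt (2 * real n + 1) * pi ^ m * mean (legendre_poly n * monom 1 m)"

lemma chromatic_kernel_power_series:
  "(\<lambda>m. (- \<i>) ^ n * \<i> ^ m * of_real (legendre_moment n m) / fact m * w ^ m) sums chromatic_kernel n w"
proof -
  have "fourier_laplace (\<lambda>\<omega>. (\<i> * of_real \<omega>) ^ m * legendre_window n \<omega>) 0 = \<i> ^ m * of_real (legendre_moment n m)" for m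
  proof -
    have "(\<i> * of_real \<omega>) ^ m * legendre_window n \<omega>
        = \<i> ^ m * (of_real (poly (smult (pi ^ m) (monom 1 m)) (\<omega> / pi)) * legendre_window n \<omega>)" for \<omega>
      by (simp add: poly_monom power_mult_distrib power_divide)
    then show ?thesis
      unfolding fourier_laplace_def mult_zero_right exp_zero mult_1_right
      by (simp only: integral_mult_right_zero legendre_window_moment mult_smult_right mean_smult)
         (simp add: legendre_moment_def)
  qed
  then show ?thesis
    using sums_mult[OF fourier_laplace_power_series_0[OF legendre_window_band_limited, of n w], of "(- \<i>) ^ n"]
    by (simp add: chromatic_kernel_def mult_ac)
qed

lemma legendre_moment_eq:
  "legendre_moment n (n + 2 * k) = sqrt (2 * real n + 1) * sqrt pi / 2
     * (pi / 2) ^ (n + 2 * k) * fact (n + 2 * k) / (fact k * Gamma (real n + real k + 3 / 2))"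
  by (simp add: legendre_moment_def mean_legendre_monom power_divide mult_ac)

lemma legendre_moment_eq_0: "m \<notin> range (\<lambda>k. n + 2 * k) \<Longrightarrow> legendre_moment n m = 0"
proof -
  assume m: "m \<notin> range (\<lambda>k. n + 2 * k)"
  have "m = n + 2 * ((m - n) div 2)" if "n \<le> m" "even (m - n)" using that by simp
  with m have "\<not> (n \<le> m \<and> even (m - n))" by blast
  then show ?thesis by (simp only: legendre_moment_def mean_legendre_monom if_False mult_zero_right)
qed

lemma csqrt_half: "csqrt (z / 2) = csqrt z / of_real (sqrt 2)"
proof (cases "z = 0")
  case False
  have "csqrt (z / 2) = exp (Ln (z / of_real 2) / 2)" using False by (simp add: csqrt_exp_Ln)
  also have "Ln (z / of_real 2) = Ln z - of_real (ln 2)"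
    using False by (intro Ln_divide_of_real) auto
  also have "exp ((Ln z - of_real (ln 2)) / 2) = csqrt z / of_real (exp (ln 2 / 2))"
    using False by (simp add: csqrt_exp_Ln diff_divide_distrib exp_diff exp_of_real[symmetric])
  also have "exp (ln 2 / 2) = sqrt (2 :: real)"
    by (simp add: powr_half_sqrt[symmetric] powr_def)
  finally show ?thesis .
qed simp

text \<open>The branch cut of the square root cancels against that of the power with exponent
  \<open>n + 1/2\<close>, since halving the argument only rescales the principal square root.\<close>

lemma spherical_bessel_j_series:
  assumes "z \<noteq> 0"
  shows "spherical_bessel_j n z = of_real (sqrt pi / 2) * (z / 2) ^ n *
     (\<Sum>k. (- 1) ^ k / fact k * of_real (inverse (Gamma (real n + real k + 3 / 2))) * (z / 2) ^ (2 * k))"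
proof -
  have "rGamma (of_nat n + 1 / 2 + of_nat k + 1) = complex_of_real (inverse (Gamma (real n + real k + 3 / 2)))" for k
    using rGamma_complex_of_real[of "real n + real k + 3 / 2"] by (simp add: rGamma_inverse_Gamma add_ac)
  moreover have "(z / 2) powr (of_nat n + 1 / 2) = (z / 2) ^ n * (csqrt z / of_real (sqrt 2))"
  proof -
    have "(z / 2) powr (of_nat n + 1 / 2) = (z / 2) powr of_nat n * (z / 2) powr (1 / 2)"
      by (rule powr_add)
    also have "(z / 2) powr of_nat n = (z / 2) ^ n" using assms by (intro powr_nat') simp
    also have "(z / 2) powr (1 / 2) = csqrt z / of_real (sqrt 2)"
      using csqrt_conv_powr[of "z / 2"] by (simp only: csqrt_half)
    finally show ?thesis .
  qed
  moreover have "of_real (sqrt (pi / 2)) / csqrt z * ((z / 2) ^ n * (csqrt z / of_real (sqrt 2)))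
      = of_real (sqrt pi / 2) * (z / 2) ^ n"
  proof -
    have "of_real (sqrt (pi / 2)) / of_real (sqrt 2) = complex_of_real (sqrt pi / 2)"
      by (simp add: real_sqrt_divide flip: of_real_divide)
    then show ?thesis using assms by (simp add: field_simps)
  qed
  ultimately show ?thesis using assms
    by (simp only: spherical_bessel_j_def bessel_J_def if_False mult.assoc[symmetric])
qed

text \<open>Only the powers \<open>w\<^sup>n\<^sup>+\<^sup>2\<^sup>k\<close> occur in the series of the kernel; reindexed over \<open>k\<close> it is the Bessel
  series term by term.\<close>

lemma chromatic_kernel_eq_spherical_bessel:
  "chromatic_kernel n w = of_real (sqrt (2 * real n + 1)) * spherical_bessel_j n (of_real pi * w)"
proof (cases "w = 0")
  case True
  have "chromatic_kernel n 0 = (- \<i>) ^ n * of_real (legendre_moment n 0)"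
    using sums_unique2[OF chromatic_kernel_power_series[of n 0] powser_sums_zero] by simp
  moreover have "legendre_moment n 0 = (if n = 0 then 1 else 0)"
  proof (cases "n = 0")
    case True
    have Gamma: "Gamma (3 / 2 :: real) = sqrt pi / 2"
      using Gamma_half_integer[of 1] by (simp add: fact_numeral)
    show ?thesis using True legendre_moment_eq[of 0 0] by (simp add: Gamma)
  next
    case False
    then have "legendre_moment n 0 = 0" by (intro legendre_moment_eq_0) auto
    then show ?thesis using False by simp
  qed
  ultimately show ?thesis using True by (simp add: spherical_bessel_j_def)
next
  case False
  define z where "z = of_real pi * w"
  define c where "c = complex_of_real (sqrt (2 * real n + 1)) * (of_real (sqrt pi / 2) * (z / 2) ^ n)"
  have c: "c \<noteq> 0" using False by (simp add: c_def z_def)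
  let ?b = "\<lambda>k. (- 1) ^ k / fact k * complex_of_real (inverse (Gamma (real n + real k + 3 / 2))) * (z / 2) ^ (2 * k)"
  let ?a = "\<lambda>m. (- \<i>) ^ n * \<i> ^ m * of_real (legendre_moment n m) / fact m * w ^ m"
  have "?a (n + 2 * k) = c * ?b k" for k
  proof -
    have "(- \<i>) ^ n * \<i> ^ (n + 2 * k) = (- 1) ^ k"
      by (simp add: power_add power_mult mult.assoc[symmetric] flip: power_mult_distrib)
    then have "?a (n + 2 * k) = (- 1) ^ k * of_real (legendre_moment n (n + 2 * k)) / fact (n + 2 * k) * w ^ (n + 2 * k)"
      by simp
    also have "\<dots> = c * ?b k"
      unfolding legendre_moment_eq c_def z_def
      by (simp add: power_add power_divide power_mult_distrib field_simps)
    finally show ?thesis .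
  qed
  moreover have "(\<lambda>k. ?a (n + 2 * k)) sums chromatic_kernel n w"
    using chromatic_kernel_power_series[of n w]
    by (subst sums_mono_reindex[of "\<lambda>k. n + 2 * k" ?a])
       (auto simp: strict_mono_def legendre_moment_eq_0)
  ultimately have "(\<lambda>k. c * ?b k) sums chromatic_kernel n w" by simp
  from sums_divide[OF this, of c] have "?b sums (chromatic_kernel n w / c)" using c by simp
  then have "chromatic_kernel n w = c * suminf ?b" using c by (simp add: sums_iff)
  also have "\<dots> = of_real (sqrt (2 * real n + 1)) * spherical_bessel_j n z"
  proof -
    have "z \<noteq> 0" using False by (simp add: z_def)
    then show ?thesis unfolding c_def spherical_bessel_j_series[OF \<open>z \<noteq> 0\<close>] by (intro mult.assoc)
  qed
  finally show ?thesis by (simp add: z_def)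
qed

section \<open>The chromatic expansion of an entire function\<close>

text \<open>The Legendre polynomials of degree at most \<open>m\<close> span the polynomials of degree at most \<open>m\<close>, and
  orthogonality identifies the coefficients.\<close>

lemma legendre_expansion:
  "degree q \<le> m \<Longrightarrow>
     q = (\<Sum>n\<le>m. smult ((2 * real n + 1) * mean (legendre_poly n * q)) (legendre_poly n))"
proof -
  have span: "\<exists>c. q = (\<Sum>n\<le>m. smult (c n) (legendre_poly n))" if "degree q \<le> m" for q m
    using that
  proof (induction m arbitrary: q)
    case 0
    then obtain a where "q = [:a:]" using degree_0_id[of q] by (metis le_zero_eq)
    moreover have "legendre_poly 0 = 1" by (simp add: legendre_poly_def)
    ultimately show ?case by (intro exI[of _ "\<lambda>_. a"]) simp
  next
    case (Suc m)
    let ?l = "legendre_poly (Suc m)"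
    define a where "a = coeff q (Suc m) / coeff ?l (Suc m)"
    have l: "coeff ?l (Suc m) \<noteq> 0" by (simp add: lead_coeff_legendre)
    have "degree (q - smult a ?l) \<le> m"
    proof (rule degree_le, intro allI impI)
      fix i assume i: "m < i"
      show "coeff (q - smult a ?l) i = 0"
      proof (cases "i = Suc m")
        case True
        then show ?thesis using l by (simp add: a_def)
      next
        case False
        with i have "Suc m < i" by simp
        then show ?thesis using Suc.prems by (simp add: coeff_eq_0 degree_legendre)
      qed
    qed
    from Suc.IH[OF this] obtain c where c: "q - smult a ?l = (\<Sum>n\<le>m. smult (c n) (legendre_poly n))" ..
    have "q = (\<Sum>n\<le>Suc m. smult ((c(Suc m := a)) n) (legendre_poly n))"
      using c by (simp add: algebra_simps)
    then show ?case by (rule exI[of _ "c(Suc m := a)"])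
  qed
  assume "degree q \<le> m"
  from span[OF this] obtain c where c: "q = (\<Sum>n\<le>m. smult (c n) (legendre_poly n))" ..
  have "(2 * real k + 1) * mean (legendre_poly k * q) = c k" if "k \<le> m" for k
  proof -
    have "mean (legendre_poly k * q) = (\<Sum>n\<le>m. c n * mean (legendre_poly k * legendre_poly n))"
      by (subst c) (simp add: sum_distrib_left mean_sum mean_smult)
    also have "\<dots> = (\<Sum>n\<le>m. if n = k then c k / (2 * real k + 1) else 0)"
      by (intro sum.cong) (auto simp: mean_legendre_orthogonal)
    also have "\<dots> = c k / (2 * real k + 1)" using that by simp
    finally show ?thesis by (simp add: field_simps)
  qed
  then have "(\<Sum>n\<le>m. smult ((2 * real n + 1) * mean (legendre_poly n * q)) (legendre_poly n))
      = (\<Sum>n\<le>m. smult (c n) (legendre_poly n))" by (intro sum.cong) auto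
  with c show ?thesis by simp
qed

text \<open>Comparison of coefficients in the Legendre expansion of a monomial.\<close>

lemma legendre_moment_biorthogonal:
  "(\<Sum>n\<le>m. legendre_moment n m * coeff (legendre_poly_normalized n) k) = (if k = m then 1 else 0)"
proof -
  let ?c = "\<lambda>n. (2 * real n + 1) * mean (legendre_poly n * monom 1 m)"
  have "legendre_moment n m * coeff (legendre_poly_normalized n) k
      = pi ^ m / pi ^ k * coeff (smult (?c n) (legendre_poly n)) k" for n
    by (simp add: legendre_moment_def coeff_legendre_normalized)
  then have "(\<Sum>n\<le>m. legendre_moment n m * coeff (legendre_poly_normalized n) k)
      = pi ^ m / pi ^ k * coeff (\<Sum>n\<le>m. smult (?c n) (legendre_poly n)) k"
    by (simp only: coeff_sum sum_distrib_left)
  also have "(\<Sum>n\<le>m. smult (?c n) (legendre_poly n)) = monom 1 m"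
    by (rule legendre_expansion[symmetric]) (simp add: degree_monom_eq)
  finally show ?thesis by simp
qed

lemma chromatic_deriv_eq:
  assumes "n \<le> m"
  shows "chromatic_deriv n f u
     = \<i> ^ n * (\<Sum>k\<le>m. of_real (coeff (legendre_poly_normalized n) k) * ((- \<i>) ^ k * (deriv ^^ k) f u))"
  unfolding chromatic_deriv_def degree_legendre_normalized using assms
  by (intro arg_cong2[where f = "(*)"] refl sum.mono_neutral_left)
     (auto simp: coeff_eq_0 degree_legendre_normalized)

text \<open>The purely algebraic core of the expansion: the left-hand side collects the coefficients of
  \<open>w\<^sup>m\<close> in all terms of the chromatic series.  Exchanging the two finite sums, the biorthogonality of
  moments and coefficients leaves the derivative of order \<open>m\<close> alone.\<close>

lemma chromatic_taylor_coefficient: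
  "(\<Sum>n\<le>m. chromatic_deriv n f u * ((- \<i>) ^ n * \<i> ^ m * of_real (legendre_moment n m) / fact m))
     = (deriv ^^ m) f u / fact m"
proof -
  let ?c = "\<lambda>n k. complex_of_real (coeff (legendre_poly_normalized n) k)"
  let ?F = "\<lambda>k. (- \<i>) ^ k * (deriv ^^ k) f u"
  have unit: "\<i> ^ n * (- \<i>) ^ n = 1" for n by (simp flip: power_mult_distrib)
  have "chromatic_deriv n f u * ((- \<i>) ^ n * \<i> ^ m * of_real (legendre_moment n m) / fact m)
      = \<i> ^ m / fact m * (\<Sum>k\<le>m. of_real (legendre_moment n m * coeff (legendre_poly_normalized n) k) * ?F k)"
    if "n \<le> m" for n
  proof -
    have "chromatic_deriv n f u * ((- \<i>) ^ n * \<i> ^ m * of_real (legendre_moment n m) / fact m)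
        = (\<i> ^ n * (- \<i>) ^ n) * (\<i> ^ m / fact m * (of_real (legendre_moment n m) * (\<Sum>k\<le>m. ?c n k * ?F k)))"
      unfolding chromatic_deriv_eq[OF that] by simp
    also have "\<dots> = \<i> ^ m / fact m * (\<Sum>k\<le>m. of_real (legendre_moment n m * coeff (legendre_poly_normalized n) k) * ?F k)"
      unfolding unit by (simp add: sum_distrib_left mult.assoc)
    finally show ?thesis .
  qed
  then have "(\<Sum>n\<le>m. chromatic_deriv n f u * ((- \<i>) ^ n * \<i> ^ m * of_real (legendre_moment n m) / fact m))
      = \<i> ^ m / fact m * (\<Sum>n\<le>m. \<Sum>k\<le>m. of_real (legendre_moment n m * coeff (legendre_poly_normalized n) k) * ?F k)"
    by (simp add: sum_distrib_left)
  also have "(\<Sum>n\<le>m. \<Sum>k\<le>m. of_real (legendre_moment n m * coeff (legendre_poly_normalized n) k) * ?F k)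
      = (\<Sum>k\<le>m. of_real (\<Sum>n\<le>m. legendre_moment n m * coeff (legendre_poly_normalized n) k) * ?F k)"
    by (subst sum.swap) (simp add: sum_distrib_right)
  also have "\<dots> = (\<Sum>k\<le>m. if k = m then ?F m else 0)"
    unfolding legendre_moment_biorthogonal by (intro sum.cong) auto
  also have "\<dots> = ?F m" by simp
  also have "\<i> ^ m / fact m * ?F m = (\<i> ^ m * (- \<i>) ^ m) * (deriv ^^ m) f u / fact m" by simp
  finally show ?thesis by (simp only: unit mult_1_left)
qed

lemma mean_nonneg: "(\<And>x. x \<in> {-1..1} \<Longrightarrow> 0 \<le> poly p x) \<Longrightarrow> 0 \<le> mean p"
  unfolding mean_def set_lebesgue_integral_def
  by (intro divide_nonneg_nonneg Bochner_Integration.integral_nonneg) (auto simp: indicator_def)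

text \<open>The Cauchy--Schwarz inequality for \<open>mean\<close>, applied to a normalized Legendre polynomial and a monomial
  whose square has mean at most 1.\<close>

lemma legendre_moment_bound: "\<bar>legendre_moment n m\<bar> \<le> pi ^ m"
proof -
  let ?q = "monom 1 m :: real poly" and ?l = "legendre_poly n"
  define b where "b = mean (?l * ?q)"
  define d where "d = 2 * real n + 1"
  have d: "d > 0" by (simp add: d_def)
  have ll: "mean (?l * ?l) = 1 / d" by (simp add: mean_legendre_orthogonal d_def)
  \<comment> \<open>The polynomial \<open>d b ?l\<close> is the orthogonal projection of the monomial to the line spanned by \<open>?l\<close>.\<close>
  have "0 \<le> mean ((?q - smult (d * b) ?l) * (?q - smult (d * b) ?l))"
    by (rule mean_nonneg) (simp flip: power2_eq_square)
  also have "(?q - smult (d * b) ?l) * (?q - smult (d * b) ?l)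
      = ?q * ?q - smult (2 * d * b) (?l * ?q) + smult ((d * b)\<^sup>2) (?l * ?l)"
    by (simp add: algebra_simps power2_eq_square smult_add_left[symmetric])
  also have "mean \<dots> = mean (?q * ?q) - d * b\<^sup>2"
    using d by (simp add: mean_add mean_diff mean_smult ll b_def[symmetric] power2_eq_square)
  finally have "d * b\<^sup>2 \<le> mean (?q * ?q)" by simp
  also have "\<dots> \<le> 1"
  proof -
    have "0 \<le> mean (1 - ?q * ?q)"
    proof (rule mean_nonneg)
      fix x :: real assume "x \<in> {-1..1}"
      then have "x\<^sup>2 \<le> 1" by (auto simp: abs_square_le_1)
      then have "(x\<^sup>2) ^ m \<le> 1" by (rule power_le_one[OF zero_le_power2])
      then show "0 \<le> poly (1 - ?q * ?q) x"
        by (simp add: poly_monom power2_eq_square power_mult_distrib)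
    qed
    moreover have "mean 1 = 1" using mean_legendre_orthogonal[of 0 0] by (simp add: legendre_poly_def one_pCons)
    ultimately show ?thesis by (simp add: mean_diff)
  qed
  finally have "(sqrt d * \<bar>b\<bar>)\<^sup>2 \<le> 1" using d by (simp add: power_mult_distrib)
  then have "sqrt d * \<bar>b\<bar> \<le> 1" using d by (subst (asm) abs_square_le_1) (simp add: abs_mult)
  then have "pi ^ m * (sqrt d * \<bar>b\<bar>) \<le> pi ^ m * 1" by (intro mult_left_mono) auto
  then show ?thesis by (simp add: legendre_moment_def b_def d_def abs_mult mult_ac)
qed

lemma legendre_moment_less: "m < n \<Longrightarrow> legendre_moment n m = 0"
  by (simp add: legendre_moment_def mean_legendre_monom)

lemma coeff_legendre_normalized_bound: "\<bar>coeff (legendre_poly_normalized n) k\<bar> \<le> (2 * real n + 1) * 4 ^ n"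
proof -
  have "\<bar>coeff (legendre_poly_normalized n) k\<bar> = sqrt (2 * real n + 1) * \<bar>coeff (legendre_poly n) k\<bar> / pi ^ k"
    by (simp add: coeff_legendre_normalized abs_mult)
  also have "\<dots> \<le> sqrt (2 * real n + 1) * \<bar>coeff (legendre_poly n) k\<bar>"
    using divide_left_mono[of 1 "pi ^ k" "sqrt (2 * real n + 1) * \<bar>coeff (legendre_poly n) k\<bar>"]
      one_le_power[of pi k] pi_gt3 by simp
  also have "\<dots> \<le> (2 * real n + 1) * 4 ^ n"
  proof (intro mult_mono coeff_legendre_bound)
    have "sqrt (2 * real n + 1) \<le> sqrt ((2 * real n + 1)\<^sup>2)"
      by (intro real_sqrt_le_mono self_le_power) auto
    then show "sqrt (2 * real n + 1) \<le> 2 * real n + 1" by simp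
  qed auto
  finally show ?thesis .
qed

lemma fact_mult_fact_le: "fact n * fact k \<le> (fact (n + k) :: real)"
  using dvd_imp_le[OF fact_fact_dvd_fact[of n k]] by (metis fact_gt_zero of_nat_fact of_nat_le_iff of_nat_mult)

text \<open>Cauchy's inequality bounds the \<open>k\<close>-th derivative by \<open>B k!/R\<^sup>k\<close>.  Since \<open>k! \<le> n!/(n - k)!\<close>, the sum over
  \<open>k \<le> n\<close> is at most \<open>B n!/R\<^sup>n\<close> times a partial sum of the series of \<open>exp R\<close>.  It matters that the power
  of \<open>R\<close> in the final bound is the full \<open>n\<close>-th one: it beats any geometric growth when \<open>R\<close> is large.\<close>

lemma chromatic_deriv_bound:
  assumes f: "f holomorphic_on UNIV" and R: "R > 0"
  obtains C where "C \<ge> 0" "\<And>n. cmod (chromatic_deriv n f u) \<le> C * (2 * real n + 1) * (4 / R) ^ n * fact n"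
proof -
  have "compact (f ` sphere u R)"
    by (intro compact_continuous_image continuous_on_subset[OF holomorphic_on_imp_continuous_on[OF f]]) auto
  then have "bounded (f ` sphere u R)" by (rule compact_imp_bounded)
  then obtain B where B: "\<And>x. cmod (u - x) = R \<Longrightarrow> cmod (f x) \<le> B"
    by (force simp: bounded_iff dist_norm)
  have deriv: "cmod ((deriv ^^ k) f u) \<le> fact k * B / R ^ k" for k
    by (rule Cauchy_inequality[OF _ _ R B])
       (use f in \<open>auto intro: holomorphic_on_subset continuous_on_subset[OF holomorphic_on_imp_continuous_on]\<close>)
  have B0: "B \<ge> 0"
    by (rule order_trans[OF norm_ge_zero[of "f u"]]) (use deriv[of 0] in simp)
  show ?thesis
  proof (rule that[of "B * exp R"])
    show "B * exp R \<ge> 0" using B0 by simp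
    fix n
    have "cmod (chromatic_deriv n f u)
        \<le> (\<Sum>k\<le>n. \<bar>coeff (legendre_poly_normalized n) k\<bar> * cmod ((deriv ^^ k) f u))"
      unfolding chromatic_deriv_eq[OF order_refl]
      by (simp add: norm_mult norm_power) (rule sum_norm_le, simp add: norm_mult norm_power)
    also have "\<dots> \<le> (\<Sum>k\<le>n. (2 * real n + 1) * 4 ^ n * (B * (fact n / R ^ n) * (R ^ (n - k) / fact (n - k))))"
    proof (intro sum_mono mult_mono coeff_legendre_normalized_bound)
      fix k assume "k \<in> {..n}"
      then have k: "k \<le> n" by simp
      have "fact k * fact (n - k) \<le> (fact n :: real)" using fact_mult_fact_le[of k "n - k"] k by simp
      then have "fact k \<le> fact n / (fact (n - k) :: real)" by (simp add: field_simps)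
      then have "fact k * (B / R ^ k) \<le> fact n / fact (n - k) * (B / R ^ k)"
        using B0 R by (intro mult_right_mono) auto
      also have "R ^ n = R ^ k * R ^ (n - k)" using k by (simp flip: power_add)
      then have "fact n / fact (n - k) * (B / R ^ k) = B * (fact n / R ^ n) * (R ^ (n - k) / fact (n - k))"
        using R by (simp add: field_simps)
      finally show "cmod ((deriv ^^ k) f u) \<le> B * (fact n / R ^ n) * (R ^ (n - k) / fact (n - k))"
        using deriv[of k] by simp
    qed auto
    also have "\<dots> = (2 * real n + 1) * 4 ^ n * (B * (fact n / R ^ n)) * (\<Sum>k\<le>n. R ^ (n - k) / fact (n - k))"
      by (simp add: sum_distrib_left mult.assoc)
    also have "(\<Sum>k\<le>n. R ^ (n - k) / fact (n - k)) = (\<Sum>k\<le>n. R ^ k / fact k)"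
      by (rule sum.nat_diff_reindex[of "\<lambda>k. R ^ k / fact k" "Suc n", unfolded lessThan_Suc_atMost diff_Suc_Suc])
    also have "(2 * real n + 1) * 4 ^ n * (B * (fact n / R ^ n)) * \<dots>
        \<le> (2 * real n + 1) * 4 ^ n * (B * (fact n / R ^ n)) * exp R"
    proof (intro mult_left_mono)
      have "(\<Sum>k\<le>n. R ^ k / fact k) \<le> (\<Sum>k. R ^ k / fact k)"
        using summable_exp_generic[of R] R
        by (intro sum_le_suminf) (auto simp: divide_inverse mult.commute)
      then show "(\<Sum>k\<le>n. R ^ k / fact k) \<le> exp R" by (simp add: exp_def divide_inverse mult.commute)
    qed (use B0 R in auto)
    finally show "cmod (chromatic_deriv n f u) \<le> B * exp R * (2 * real n + 1) * (4 / R) ^ n * fact n"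
      by (simp add: power_divide mult_ac)
  qed
qed

text \<open>A rearrangement theorem for double series supported on \<open>n \<le> m\<close>, dominated along the diagonals
  \<open>m - n = j\<close> by a product.\<close>

lemma triangular_series_sums:
  fixes x :: "nat \<Rightarrow> nat \<Rightarrow> 'a :: banach"
  assumes bound: "\<And>n j. norm (x n (n + j)) \<le> a n * b j"
    and zero: "\<And>n m. m < n \<Longrightarrow> x n m = 0"
    and a: "summable a" "\<And>n. 0 \<le> a n" and b: "summable b" "\<And>j. 0 \<le> b j"
    and rows: "\<And>n. x n sums r n"
    and columns: "(\<lambda>m. \<Sum>n\<le>m. x n m) sums s"
  shows "r sums s"
proof -
  have remainder: "norm (s - (\<Sum>n<N. r n)) \<le> (suminf a - (\<Sum>n<N. a n)) * suminf b" for N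
  proof -
    \<comment> \<open>The remainder after \<open>N\<close> rows is a series of columns, dominated by the Cauchy product of \<open>b\<close> with the tail of \<open>a\<close>.\<close>
    define a' where "a' n = (if n < N then 0 else a n)" for n
    have a'_sums: "a' sums (suminf a - (\<Sum>n<N. a n))"
    proof -
      have "(\<lambda>n. a n - (if n \<in> {..<N} then a n else 0)) sums (suminf a - (\<Sum>n\<in>{..<N}. a n))"
        by (intro sums_diff summable_sums a sums_If_finite_set) auto
      moreover have "(\<lambda>n. a n - (if n \<in> {..<N} then a n else 0)) = a'" by (auto simp: a'_def)
      ultimately show ?thesis by simp
    qed
    have "(\<lambda>m. \<Sum>n<N. x n m) sums (\<Sum>n<N. r n)" by (intro sums_sum rows)
    with columns have diff: "(\<lambda>m. (\<Sum>n\<le>m. x n m) - (\<Sum>n<N. x n m)) sums (s - (\<Sum>n<N. r n))"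
      by (rule sums_diff)
    have product: "(\<lambda>m. \<Sum>n\<le>m. a' n * b (m - n)) sums (suminf a' * suminf b)"
    proof -
      have "0 \<le> a' n" for n using a(2) by (simp add: a'_def)
      then show ?thesis
        using a'_sums b by (intro Cauchy_product_sums) (auto simp: sums_iff)
    qed
    have "norm ((\<Sum>n\<le>m. x n m) - (\<Sum>n<N. x n m)) \<le> (\<Sum>n\<le>m. a' n * b (m - n))" for m
    proof -
      have "(\<Sum>n<N. x n m) = (\<Sum>n\<le>m. if n < N then x n m else 0)"
        by (subst sum.inter_filter[symmetric]) (auto intro!: sum.mono_neutral_right zero simp: not_le)
      then have "(\<Sum>n\<le>m. x n m) - (\<Sum>n<N. x n m) = (\<Sum>n\<le>m. if n < N then 0 else x n m)"
        by (simp add: sum_subtractf[symmetric] if_distrib cong: if_cong)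
      also have "norm \<dots> \<le> (\<Sum>n\<le>m. a' n * b (m - n))"
      proof (rule sum_norm_le)
        fix n assume "n \<in> {..m}"
        then show "norm (if n < N then 0 else x n m) \<le> a' n * b (m - n)"
          using bound[of n "m - n"] by (simp add: a'_def)
      qed
      finally show ?thesis .
    qed
    then have "norm (suminf (\<lambda>m. (\<Sum>n\<le>m. x n m) - (\<Sum>n<N. x n m))) \<le> suminf (\<lambda>m. \<Sum>n\<le>m. a' n * b (m - n))"
      by (intro norm_suminf_le) (use product in \<open>auto simp: sums_iff\<close>)
    then show ?thesis using diff product a'_sums by (simp add: sums_iff)
  qed
  have "(\<lambda>N. (suminf a - (\<Sum>n<N. a n)) * suminf b) \<longlonglongrightarrow> (suminf a - suminf a) * suminf b"
    by (intro tendsto_intros summable_LIMSEQ a)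
  then have "(\<lambda>N. (suminf a - (\<Sum>n<N. a n)) * suminf b) \<longlonglongrightarrow> 0" by simp
  then have "(\<lambda>N. s - (\<Sum>n<N. r n)) \<longlonglongrightarrow> 0"
    by (rule Lim_null_comparison[rotated]) (use remainder in auto)
  then have "(\<lambda>N. s - (s - (\<Sum>n<N. r n))) \<longlonglongrightarrow> s - 0" by (intro tendsto_diff tendsto_const)
  then show ?thesis by (simp add: sums_def)
qed

text \<open>With \<open>y = \<pi>|z - u|\<close>, the bounds on derivatives and moments combine to
  \<open>C (2n+1) (4y/R)\<^sup>n y\<^sup>j/j!\<close> for the entry with \<open>m = n + j\<close>, because \<open>n!/(n + j)! \<le> 1/j!\<close>.\<close>

theorem chromatic_expansion_sums:
  assumes f: "f holomorphic_on UNIV"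
  shows "(\<lambda>n. chromatic_deriv n f u * chromatic_kernel n (z - u)) sums f z"
proof -
  define w where "w = z - u"
  define y where "y = pi * cmod w"
  \<comment> \<open>This makes \<open>4 y / R \<le> 1/2\<close>; the summand 1 keeps the radius positive at \<open>z = u\<close>.\<close>
  define R where "R = 8 * y + 1"
  have y: "y \<ge> 0" and R: "R > 0" by (auto simp: y_def R_def add_nonneg_pos)
  obtain C where C: "C \<ge> 0" "\<And>n. cmod (chromatic_deriv n f u) \<le> C * (2 * real n + 1) * (4 / R) ^ n * fact n"
    using chromatic_deriv_bound[OF f R] by metis
  define x where "x n m = chromatic_deriv n f u
      * ((- \<i>) ^ n * \<i> ^ m * of_real (legendre_moment n m) / fact m * w ^ m)" for n m
  define a where "a n = C * ((2 * real n + 1) * (1 / 2) ^ n)" for n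
  define b where "b j = y ^ j / fact j" for j
  have "(\<lambda>n. chromatic_deriv n f u * chromatic_kernel n w) sums f z"
  proof (rule triangular_series_sums[where x = x and a = a and b = b])
    show "norm (x n (n + j)) \<le> a n * b j" for n j
    proof -
      have "norm (x n (n + j)) = cmod (chromatic_deriv n f u) * (\<bar>legendre_moment n (n + j)\<bar> * cmod w ^ (n + j) / fact (n + j))"
        by (simp add: x_def norm_mult norm_divide norm_power)
      also have "\<dots> \<le> C * (2 * real n + 1) * (4 / R) ^ n * fact n * (pi ^ (n + j) * cmod w ^ (n + j) / fact (n + j))"
        using C R by (intro mult_mono divide_right_mono mult_right_mono legendre_moment_bound) auto
      also have "pi ^ (n + j) * cmod w ^ (n + j) = y ^ n * y ^ j"
        by (simp add: y_def power_mult_distrib power_add)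
      also have "C * (2 * real n + 1) * (4 / R) ^ n * fact n * (y ^ n * y ^ j / fact (n + j))
          = C * (2 * real n + 1) * (4 * y / R) ^ n * y ^ j * (fact n / fact (n + j))"
        by (simp add: power_mult_distrib power_divide)
      also have "\<dots> \<le> C * (2 * real n + 1) * (1 / 2) ^ n * y ^ j * (1 / fact j)"
      proof (intro mult_mono)
        have "4 * y / R \<le> 1 / 2" using y R by (simp add: R_def field_simps)
        then show "(4 * y / R) ^ n \<le> (1 / 2) ^ n" using y R by (intro power_mono) auto
        show "fact n / fact (n + j) \<le> (1 / fact j :: real)"
          using fact_mult_fact_le[of n j] by (simp add: field_simps)
      qed (use C y R in auto)
      finally show ?thesis by (simp add: a_def b_def)
    qed
    show "x n m = 0" if "m < n" for n m using that by (simp add: x_def legendre_moment_less)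
    have "(\<lambda>n. (2 * real n + 1) * (1 / 2) ^ n) \<in> O(\<lambda>n. (3 / 4) ^ n)" by real_asymp
    then have "summable (\<lambda>n. (2 * real n + 1) * (1 / 2) ^ n)"
      by (rule summable_comparison_test_bigo[rotated]) (simp add: summable_geometric)
    then show "summable a" unfolding a_def by (rule summable_mult)
    show "summable b"
      unfolding b_def using summable_exp_generic[of y] by (simp add: divide_inverse mult.commute)
    show "0 \<le> a n" "0 \<le> b n" for n using C y by (auto simp: a_def b_def)
    show "x n sums (chromatic_deriv n f u * chromatic_kernel n w)" for n
      unfolding x_def by (intro sums_mult chromatic_kernel_power_series)
    have "(\<lambda>m. (deriv ^^ m) f u / fact m * (z - u) ^ m) sums f z"
      by (rule holomorphic_power_series[of f u "dist u z + 1"]) (use f in \<open>auto intro: holomorphic_on_subset\<close>)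
    then show "(\<lambda>m. \<Sum>n\<le>m. x n m) sums f z"
      unfolding x_def w_def[symmetric] mult.assoc[symmetric] chromatic_taylor_coefficient[symmetric] sum_distrib_right
      by (simp only: mult.assoc times_divide_eq_right times_divide_eq_left)
  qed
  then show ?thesis by (simp add: w_def)
qed

section \<open>Square-summability of chromatic coefficients\<close>

lemma legendre_window_support: "\<omega> \<notin> {-pi..pi} \<Longrightarrow> legendre_window n \<omega> = 0"
  by (simp add: legendre_window_def)

lemma legendre_window_combination_energy:
  assumes "finite I"
  shows "integrable lborel (\<lambda>\<omega>. (cmod (\<Sum>n\<in>I. c n * legendre_window n \<omega>))\<^sup>2)"
    and "(LINT \<omega>|lborel. (cmod (\<Sum>n\<in>I. c n * legendre_window n \<omega>))\<^sup>2) = (\<Sum>n\<in>I. (cmod (c n))\<^sup>2) / (2 * pi)"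
proof -
  let ?W = legendre_window
  let ?S = "\<lambda>\<omega>. \<Sum>n\<in>I. c n * ?W n \<omega>"
  have W_int: "integrable lborel (\<lambda>\<omega>. ?W n \<omega> * ?W m \<omega>)" for n m
  proof -
    obtain A where A: "\<And>\<omega>. cmod (?W n \<omega>) \<le> A" using legendre_window_bounded[of n] by blast
    obtain B where B: "\<And>\<omega>. cmod (?W m \<omega>) \<le> B" using legendre_window_bounded[of m] by blast
    have "A \<ge> 0" using A[of 0] norm_ge_zero order_trans by blast
    then show ?thesis
      by (intro integrable_bounded_support[where B = "A * B" and a = "-pi" and b = pi])
         (auto simp: norm_mult legendre_window_support intro!: mult_mono A B)
  qed
  have eq: "complex_of_real ((cmod (?S \<omega>))\<^sup>2) = (\<Sum>n\<in>I. \<Sum>m\<in>I. c n * cnj (c m) * (?W n \<omega> * ?W m \<omega>))" for \<omega>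
    unfolding complex_norm_square by (simp add: sum_product mult_ac)
  have int: "integrable lborel (\<lambda>\<omega>. complex_of_real ((cmod (?S \<omega>))\<^sup>2))"
    unfolding eq by (intro Bochner_Integration.integrable_sum integrable_mult_right W_int)
  then show "integrable lborel (\<lambda>\<omega>. (cmod (?S \<omega>))\<^sup>2)" by (simp only: complex_of_real_integrable_eq)
  have "complex_of_real (LINT \<omega>|lborel. (cmod (?S \<omega>))\<^sup>2)
      = (\<Sum>n\<in>I. \<Sum>m\<in>I. c n * cnj (c m) * (LINT \<omega>|lborel. ?W n \<omega> * ?W m \<omega>))"
    unfolding integral_complex_of_real[symmetric] eq
    by (simp only: Bochner_Integration.integral_sum Bochner_Integration.integrable_sum
        integrable_mult_right W_int integral_mult_right_zero)
  also have "\<dots> = (\<Sum>n\<in>I. \<Sum>m\<in>I. if n = m then c n * cnj (c n) / (2 * of_real pi) else 0)"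
    by (intro sum.cong refl) (simp add: legendre_window_orthogonal)
  also have "\<dots> = (\<Sum>n\<in>I. c n * cnj (c n) / (2 * of_real pi))"
    using assms by (intro sum.cong refl) (simp add: sum.delta')
  also have "\<dots> = of_real ((\<Sum>n\<in>I. (cmod (c n))\<^sup>2) / (2 * pi))"
    by (simp add: complex_norm_square[symmetric] sum_divide_distrib)
  finally show "(LINT \<omega>|lborel. (cmod (?S \<omega>))\<^sup>2) = (\<Sum>n\<in>I. (cmod (c n))\<^sup>2) / (2 * pi)"
    by (simp only: of_real_eq_iff)
qed

lemma band_limited_window_integrable:
  assumes "band_limited H"
  shows "integrable lborel (\<lambda>\<omega>. H \<omega> * legendre_window n \<omega>)"
proof -
  have "band_limited (\<lambda>\<omega>. of_real (poly (legendre_poly_normalized n) \<omega> / (2 * pi)) * H \<omega>)"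
    using assms by (rule band_limited_mult) (intro continuous_intros, simp)
  moreover have "of_real (poly (legendre_poly_normalized n) \<omega> / (2 * pi)) * H \<omega> = H \<omega> * legendre_window n \<omega>" for \<omega>
    using assms by (simp add: legendre_window_def band_limited_def indicator_def)
  ultimately show ?thesis by (simp add: band_limited_def)
qed

text \<open>The mean-square distance of \<open>H\<close> from its projection to the span of \<open>p\<^sub>0, ..., p\<^sub>N\<^sub>-\<^sub>1\<close> is nonnegative.\<close>

lemma legendre_bessel_inequality:
  assumes H: "band_limited H" and H2: "integrable lborel (\<lambda>\<omega>. (cmod (H \<omega>))\<^sup>2)"
  shows "(\<Sum>n<N. (cmod (LINT \<omega>|lborel. H \<omega> * legendre_window n \<omega>))\<^sup>2)
       \<le> (LINT \<omega>|lborel. (cmod (H \<omega>))\<^sup>2) / (2 * pi)"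
proof -
  define c where "c n = (LINT \<omega>|lborel. H \<omega> * legendre_window n \<omega>)" for n
  \<comment> \<open>The windows contain the factor \<open>1/(2\<pi>)\<close>, so these are the coefficients of the projection of \<open>H\<close>.\<close>
  define d where "d n = 2 * of_real pi * c n" for n
  define e where "e = (\<Sum>n<N. (cmod (c n))\<^sup>2)"
  let ?S = "\<lambda>\<omega>. \<Sum>n<N. d n * legendre_window n \<omega>"
  have [measurable]: "H \<in> borel_measurable borel" using H by (auto simp: band_limited_def)
  have "(cmod (d n))\<^sup>2 / (2 * pi) = 2 * pi * (cmod (c n))\<^sup>2" for n
    by (simp add: d_def norm_mult power_mult_distrib power2_eq_square[of pi])
  then have energy: "(LINT \<omega>|lborel. (cmod (?S \<omega>))\<^sup>2) = 2 * pi * e"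
    by (simp add: legendre_window_combination_energy(2) sum_divide_distrib sum_distrib_left e_def)
  have "cnj (?S \<omega>) * H \<omega> = (\<Sum>n<N. cnj (d n) * (H \<omega> * legendre_window n \<omega>))" for \<omega>
    by (simp add: sum_distrib_right sum_distrib_left mult_ac)
  then have "(LINT \<omega>|lborel. cnj (?S \<omega>) * H \<omega>) = (\<Sum>n<N. cnj (d n) * c n)"
    by (simp only: Bochner_Integration.integral_sum integrable_mult_right band_limited_window_integrable[OF H]
        integral_mult_right_zero c_def)
  also have "\<dots> = of_real (2 * pi * e)"
    unfolding d_def e_def of_real_mult of_real_sum complex_norm_square sum_distrib_left
    by (simp add: mult_ac)
  finally have cross: "(LINT \<omega>|lborel. cnj (?S \<omega>) * H \<omega>) = of_real (2 * pi * e)" .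
  have "0 \<le> (LINT \<omega>|lborel. (cmod (H \<omega> - ?S \<omega>))\<^sup>2)" by (intro Bochner_Integration.integral_nonneg) simp
  also have "\<dots> = (LINT \<omega>|lborel. (cmod (H \<omega>))\<^sup>2) - 2 * Re (LINT \<omega>|lborel. cnj (?S \<omega>) * H \<omega>)
      + (LINT \<omega>|lborel. (cmod (?S \<omega>))\<^sup>2)"
    by (rule integral_norm_diff_square(2)) (use H2 legendre_window_combination_energy(1) in auto)
  finally have "2 * pi * e \<le> (LINT \<omega>|lborel. (cmod (H \<omega>))\<^sup>2)"
    unfolding cross energy by simp
  then show ?thesis by (simp add: e_def c_def field_simps)
qed

text \<open>Up to a unimodular factor the kernels at \<open>w\<close> are the Legendre coefficients of
  \<open>exp(\<i>\<omega>w)\<close> on \<open>[-\<pi>, \<pi>]\<close>, whose modulus is at most \<open>exp(\<pi>|Im w|)\<close>.\<close>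

lemma chromatic_kernel_square_sum:
  "(\<Sum>n<N. (cmod (chromatic_kernel n w))\<^sup>2) \<le> exp (2 * pi * \<bar>Im w\<bar>)"
proof -
  let ?H = "\<lambda>\<omega>. indicator {-pi..pi} \<omega> *\<^sub>R exp (\<i> * of_real \<omega> * w)"
  have norm: "cmod (exp (\<i> * of_real \<omega> * w)) \<le> exp (pi * \<bar>Im w\<bar>)" if "\<omega> \<in> {-pi..pi}" for \<omega>
  proof -
    have "\<bar>\<omega>\<bar> * \<bar>Im w\<bar> \<le> pi * \<bar>Im w\<bar>" using that by (intro mult_right_mono) auto
    then have "- (\<omega> * Im w) \<le> pi * \<bar>Im w\<bar>"
      using abs_ge_minus_self[of "\<omega> * Im w"] by (simp add: abs_mult)
    then show ?thesis by (simp add: norm_exp_eq_Re)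
  qed
  have H_int: "integrable lborel ?H"
    by (rule integrable_bounded_support[where B = "exp (pi * \<bar>Im w\<bar>)" and a = "-pi" and b = pi])
       (use norm in \<open>auto simp: indicator_def\<close>)
  have norm2: "(cmod (?H \<omega>))\<^sup>2 \<le> exp (2 * pi * \<bar>Im w\<bar>) * indicator {-pi..pi} \<omega>" for \<omega>
    using power_mono[OF norm[of \<omega>], of 2] by (auto simp: indicator_def exp_double[symmetric] mult.assoc)
  have ind_int: "integrable lborel (\<lambda>\<omega>. exp (2 * pi * \<bar>Im w\<bar>) * indicat_real {-pi..pi} \<omega>)"
    by (intro integrable_mult_right integrable_real_indicator) (auto simp: emeasure_lborel_Icc_eq)
  have H2: "integrable lborel (\<lambda>\<omega>. (cmod (?H \<omega>))\<^sup>2)"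
    by (rule Bochner_Integration.integrable_bound[OF ind_int]) (use norm2 in auto)
  have "legendre_window n \<omega> * exp (\<i> * of_real \<omega> * w) = ?H \<omega> * legendre_window n \<omega>" for n \<omega>
    by (cases "\<omega> \<in> {-pi..pi}") (simp_all add: legendre_window_support)
  then have "chromatic_kernel n w = (- \<i>) ^ n * (LINT \<omega>|lborel. ?H \<omega> * legendre_window n \<omega>)" for n
    unfolding chromatic_kernel_def fourier_laplace_def by (simp only:)
  then have "(\<Sum>n<N. (cmod (chromatic_kernel n w))\<^sup>2)
      = (\<Sum>n<N. (cmod (LINT \<omega>|lborel. ?H \<omega> * legendre_window n \<omega>))\<^sup>2)"
    by (simp add: norm_mult norm_power)
  also have "\<dots> \<le> (LINT \<omega>|lborel. (cmod (?H \<omega>))\<^sup>2) / (2 * pi)"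
    using H_int H2 by (intro legendre_bessel_inequality) (auto simp: band_limited_def)
  also have "\<dots> \<le> (LINT \<omega>|lborel. exp (2 * pi * \<bar>Im w\<bar>) * indicat_real {-pi..pi} \<omega>) / (2 * pi)"
    by (intro divide_right_mono integral_mono H2 ind_int norm2) auto
  also have "\<dots> = exp (2 * pi * \<bar>Im w\<bar>)" by simp
  finally show ?thesis .
qed

lemma chromatic_kernel_combination:
  assumes "finite I"
  shows "(\<Sum>n\<in>I. c n * chromatic_kernel n (z - u))
       = fourier_laplace (\<lambda>\<omega>. exp (\<i> * of_real \<omega> * (- u)) * (\<Sum>n\<in>I. (c n * (- \<i>) ^ n) * legendre_window n \<omega>)) z"
proof -
  have "(\<Sum>n\<in>I. c n * chromatic_kernel n (z - u))
      = fourier_laplace (\<lambda>\<omega>. \<Sum>n\<in>I. (c n * (- \<i>) ^ n) * legendre_window n \<omega>) (- u + z)"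
    unfolding chromatic_kernel_def
    by (subst fourier_laplace_sum)
       (auto simp: fourier_laplace_cmult mult.assoc intro!: band_limited_mult legendre_window_band_limited continuous_intros)
  then show ?thesis by (simp only: fourier_laplace_add_arg)
qed

text \<open>The translation by \<open>u\<close> multiplies the spectrum by \<open>exp(-\<i>\<omega>u)\<close>, whose modulus is bounded on
  \<open>[-\<pi>, \<pi>]\<close> also when \<open>u\<close> is not real.\<close>

lemma chromatic_kernel_combination_L2:
  assumes "finite I"
  shows "(\<integral>\<^sup>+x. ennreal ((cmod (\<Sum>n\<in>I. c n * chromatic_kernel n (of_real x - u)))\<^sup>2) \<partial>lborel)
      \<le> ennreal (exp (2 * pi * \<bar>Im u\<bar>) * (\<Sum>n\<in>I. (cmod (c n))\<^sup>2))"
proof -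
  let ?S = "\<lambda>\<omega>. \<Sum>n\<in>I. (c n * (- \<i>) ^ n) * legendre_window n \<omega>"
  let ?D = "\<lambda>\<omega>. exp (\<i> * of_real \<omega> * (- u)) * ?S \<omega>"
  have S: "band_limited ?S"
    using legendre_window_band_limited unfolding band_limited_def by auto
  have D: "band_limited ?D" by (intro band_limited_mult S continuous_intros)
  have bound: "(cmod (?D \<omega>))\<^sup>2 \<le> exp (2 * pi * \<bar>Im u\<bar>) * (cmod (?S \<omega>))\<^sup>2" for \<omega>
  proof (cases "\<omega> \<in> {-pi..pi}")
    case True
    have "\<bar>\<omega>\<bar> * \<bar>Im u\<bar> \<le> pi * \<bar>Im u\<bar>" using True by (intro mult_right_mono) auto
    then have "\<omega> * Im u \<le> pi * \<bar>Im u\<bar>"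
      using abs_ge_self[of "\<omega> * Im u"] by (simp add: abs_mult)
    then have "(cmod (exp (\<i> * of_real \<omega> * (- u))))\<^sup>2 \<le> (exp (pi * \<bar>Im u\<bar>))\<^sup>2"
      by (intro power_mono) (simp_all add: norm_exp_eq_Re)
    then have "(cmod (exp (\<i> * of_real \<omega> * (- u))))\<^sup>2 \<le> exp (2 * pi * \<bar>Im u\<bar>)"
      by (simp add: exp_double[symmetric] mult.assoc)
    then show ?thesis unfolding norm_mult power_mult_distrib by (intro mult_right_mono) auto
  next
    case False
    then have "?S \<omega> = 0" using S by (auto simp: band_limited_def)
    then show ?thesis by simp
  qed
  have "(\<integral>\<^sup>+x. ennreal ((cmod (\<Sum>n\<in>I. c n * chromatic_kernel n (of_real x - u)))\<^sup>2) \<partial>lborel)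
      \<le> ennreal (2 * pi) * (\<integral>\<^sup>+\<omega>. ennreal ((cmod (?D \<omega>))\<^sup>2) \<partial>lborel)"
    unfolding chromatic_kernel_combination[OF assms]
    using D by (intro plancherel_le) (simp only: band_limited_def)
  also have "\<dots> \<le> ennreal (2 * pi) * (\<integral>\<^sup>+\<omega>. ennreal (exp (2 * pi * \<bar>Im u\<bar>) * (cmod (?S \<omega>))\<^sup>2) \<partial>lborel)"
    by (intro mult_left_mono nn_integral_mono ennreal_leI bound) auto
  also have "(\<integral>\<^sup>+\<omega>. ennreal (exp (2 * pi * \<bar>Im u\<bar>) * (cmod (?S \<omega>))\<^sup>2) \<partial>lborel)
      = ennreal (exp (2 * pi * \<bar>Im u\<bar>) * ((\<Sum>n\<in>I. (cmod (c n * (- \<i>) ^ n))\<^sup>2) / (2 * pi)))"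
    using assms legendre_window_combination_energy[OF assms, of "\<lambda>n. c n * (- \<i>) ^ n"]
    by (subst nn_integral_eq_integral) auto
  also have "ennreal (2 * pi) * \<dots> = ennreal (exp (2 * pi * \<bar>Im u\<bar>) * (\<Sum>n\<in>I. (cmod (c n))\<^sup>2))"
    by (subst ennreal_mult[symmetric]) (auto simp: norm_mult norm_power intro!: sum_nonneg divide_nonneg_nonneg mult_nonneg_nonneg)
  finally show ?thesis .
qed

text \<open>Fourier inversion gives the representation on the real line, and both sides are entire.\<close>

lemma BL_pi_fourier_laplace:
  assumes "f \<in> BL_pi"
  obtains D where "band_limited D" "integrable lborel (\<lambda>\<omega>. (cmod (D \<omega>))\<^sup>2)" "f = fourier_laplace D"
proof -
  from assms obtain g G where f: "f holomorphic_on UNIV" and fg: "\<And>x. f (of_real x) = of_real (g x)"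
    and cont: "continuous_on UNIV g" and sq: "square_integrable g"
    and G: "has_L2_fourier_transform g G"
    and supp: "AE \<omega> in lborel. \<omega> \<notin> {-pi..pi} \<longrightarrow> G \<omega> = 0"
    unfolding BL_pi_def BL_pi_real_def by blast
  define E where "E \<omega> = indicator {-pi..pi} \<omega> *\<^sub>R G \<omega>" for \<omega>
  note inv = fourier_inversion_band_limited[OF cont sq G supp, folded E_def]
  define D where "D \<omega> = 1 / (2 * of_real pi) * E \<omega>" for \<omega>
  have E: "integrable lborel E" using inv(1) by (simp add: E_def[abs_def])
  have "integrable lborel D" unfolding D_def[abs_def] by (rule integrable_mult_right[OF E])
  then have D: "band_limited D" by (simp add: band_limited_def D_def E_def)
  have "integrable lborel (\<lambda>\<omega>. (1 / (2 * pi))\<^sup>2 * (cmod (E \<omega>))\<^sup>2)"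
    using inv(2) by (intro integrable_mult_right)
  then have D2: "integrable lborel (\<lambda>\<omega>. (cmod (D \<omega>))\<^sup>2)"
    by (simp add: D_def norm_mult norm_divide power_mult_distrib power_divide)
  have real: "f (of_real x) = fourier_laplace D (of_real x)" for x
    using inv(3)[of x] by (simp only: fg D_def[abs_def] fourier_laplace_cmult) simp
  have "f z - fourier_laplace D z = 0" for z
  proof (rule analytic_continuation[of "\<lambda>z. f z - fourier_laplace D z" UNIV \<real> 0])
    show "(\<lambda>z. f z - fourier_laplace D z) holomorphic_on UNIV"
      by (intro holomorphic_intros f fourier_laplace_holomorphic D)
    show "0 islimpt (\<real> :: complex set)"
    proof -
      have "\<exists>x\<in>\<real>. x \<noteq> 0 \<and> dist x (0 :: complex) < e" if "e > 0" for e
        using that by (intro bexI[of _ "of_real (e / 2)"]) auto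
      then show ?thesis by (simp add: islimpt_approachable)
    qed
  qed (auto simp: real elim!: Reals_cases)
  then have "f = fourier_laplace D" by auto
  with D D2 show ?thesis by (rule that)
qed

text \<open>The coefficients are, up to the factor \<open>2\<pi>\<close> and a power of \<open>\<i>\<close>, the Legendre coefficients of the square-integrable function
  \<open>D(\<omega>) exp(\<i>\<omega>u)\<close>, so that Bessel's inequality applies.\<close>

lemma chromatic_coefficients_square_summable:
  assumes "f \<in> BL_pi"
  shows "summable (\<lambda>n. (cmod (chromatic_deriv n f u))\<^sup>2)"
proof -
  obtain D where D: "band_limited D" "integrable lborel (\<lambda>\<omega>. (cmod (D \<omega>))\<^sup>2)" and f: "f = fourier_laplace D"
    using BL_pi_fourier_laplace[OF assms] by metis
  have supp: "\<And>\<omega>. \<omega> \<notin> {-pi..pi} \<Longrightarrow> D \<omega> = 0" using D by (auto simp: band_limited_def)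
  define H where "H \<omega> = exp (\<i> * of_real \<omega> * u) * D \<omega>" for \<omega>
  have H: "band_limited H" unfolding H_def by (intro band_limited_mult D continuous_intros)
  have [measurable]: "H \<in> borel_measurable borel" using H by (auto simp: band_limited_def)
  have H2: "integrable lborel (\<lambda>\<omega>. (cmod (H \<omega>))\<^sup>2)"
  proof (rule Bochner_Integration.integrable_bound[OF integrable_mult_right[OF D(2), of "exp (2 * pi * cmod u)"]])
    show "AE \<omega> in lborel. norm ((cmod (H \<omega>))\<^sup>2) \<le> norm (exp (2 * pi * cmod u) * (cmod (D \<omega>))\<^sup>2)"
    proof (intro AE_I2)
      fix \<omega>
      show "norm ((cmod (H \<omega>))\<^sup>2) \<le> norm (exp (2 * pi * cmod u) * (cmod (D \<omega>))\<^sup>2)"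
      proof (cases "\<omega> \<in> {-pi..pi}")
        case True
        have "cmod (exp (\<i> * of_real \<omega> * u)) \<le> exp (cmod (\<i> * of_real \<omega> * u))" by (rule norm_exp)
        also have "\<dots> \<le> exp (pi * cmod u)" using True by (auto simp: norm_mult intro!: mult_right_mono)
        finally have "(cmod (exp (\<i> * of_real \<omega> * u)))\<^sup>2 \<le> (exp (pi * cmod u))\<^sup>2" by (rule power_mono) simp
        then have "(cmod (exp (\<i> * of_real \<omega> * u)))\<^sup>2 \<le> exp (2 * pi * cmod u)"
          by (simp add: exp_double[symmetric] mult.assoc)
        then show ?thesis by (simp add: H_def norm_mult power_mult_distrib mult_right_mono)
      qed (simp add: H_def supp)
    qed
  qed measurable
  have coeff: "chromatic_deriv n f u = \<i> ^ n * (2 * of_real pi * (LINT \<omega>|lborel. H \<omega> * legendre_window n \<omega>))" for n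
  proof -
    have "of_real (poly (legendre_poly_normalized n) \<omega>) * D \<omega> * exp (\<i> * of_real \<omega> * u)
        = 2 * of_real pi * (H \<omega> * legendre_window n \<omega>)" for \<omega>
      using supp[of \<omega>] by (auto simp: H_def legendre_window_def indicator_def)
    then show ?thesis
      unfolding f chromatic_deriv_fourier_laplace[OF D(1)] fourier_laplace_def
      by (simp only: integral_mult_right_zero)
  qed
  show ?thesis
  proof (rule summableI_nonneg_bounded)
    show "(\<Sum>n<N. (cmod (chromatic_deriv n f u))\<^sup>2) \<le> (2 * pi)\<^sup>2 * ((LINT \<omega>|lborel. (cmod (H \<omega>))\<^sup>2) / (2 * pi))" for N
    proof -
      have "(\<Sum>n<N. (cmod (chromatic_deriv n f u))\<^sup>2)
          = (2 * pi)\<^sup>2 * (\<Sum>n<N. (cmod (LINT \<omega>|lborel. H \<omega> * legendre_window n \<omega>))\<^sup>2)"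
        unfolding coeff by (simp add: norm_mult norm_power power_mult_distrib sum_distrib_left)
      also have "\<dots> \<le> (2 * pi)\<^sup>2 * ((LINT \<omega>|lborel. (cmod (H \<omega>))\<^sup>2) / (2 * pi))"
        by (intro mult_left_mono legendre_bessel_inequality H H2) simp
      finally show ?thesis .
    qed
  qed simp
qed

section \<open>Uniform and mean-square convergence\<close>

text \<open>Along the real axis the imaginary part of \<open>f\<close> is constantly 0, hence so is its derivative.\<close>

lemma deriv_in_Reals:
  assumes f: "f holomorphic_on UNIV" and real: "\<And>x. f (of_real x) \<in> \<real>"
  shows "deriv f (of_real x) \<in> \<real>"
proof -
  have "(f has_field_derivative deriv f (of_real x)) (at (of_real x))"
    using f by (intro holomorphic_derivI[of f UNIV]) auto
  then have "((\<lambda>t. f (of_real t)) has_vector_derivative deriv f (of_real x)) (at x)"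
    by (rule has_vector_derivative_real_field)
  then have "((\<lambda>t. Im (f (of_real t))) has_vector_derivative Im (deriv f (of_real x))) (at x)"
    by (rule bounded_linear.has_vector_derivative[OF bounded_linear_Im])
  moreover have "(\<lambda>t. Im (f (of_real t))) = (\<lambda>t. 0)"
    using real by (simp add: complex_is_Real_iff)
  ultimately have "((\<lambda>t. 0) has_vector_derivative Im (deriv f (of_real x))) (at x)" by simp
  then have "Im (deriv f (of_real x)) = 0"
    using vector_derivative_unique_at[OF _ has_vector_derivative_const] by metis
  then show ?thesis by (simp add: complex_is_Real_iff)
qed

lemma higher_deriv_in_Reals:
  assumes "f holomorphic_on UNIV" and "\<And>x. f (of_real x) \<in> \<real>"
  shows "(deriv ^^ k) f (of_real x) \<in> \<real>"
proof (induction k arbitrary: x)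
  case 0
  then show ?case using assms by simp
next
  case (Suc k)
  have "deriv ((deriv ^^ k) f) (of_real x) \<in> \<real>"
    by (intro deriv_in_Reals Suc holomorphic_higher_deriv assms(1)) auto
  then show ?case by simp
qed

text \<open>By the parity of the Legendre polynomials only derivatives of order \<open>k\<close> with \<open>n + k\<close> even occur, and
  for these \<open>\<i>\<^sup>n (-\<i>)\<^sup>k\<close> is real.\<close>

lemma chromatic_deriv_in_Reals:
  assumes "f holomorphic_on UNIV" and "\<And>x. f (of_real x) \<in> \<real>"
  shows "chromatic_deriv n f (of_real x) \<in> \<real>"
proof -
  let ?c = "coeff (legendre_poly_normalized n)"
  have unit: "\<i> ^ n * (- \<i>) ^ k \<in> \<real>" if nk: "even (n + k)" "k \<le> n" for k
  proof -
    have "even (n - k)" using nk by simp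
    then obtain j where "n - k = 2 * j" by (rule evenE)
    then have n: "n = k + 2 * j" using nk(2) by simp
    have "\<i> ^ n * (- \<i>) ^ k = (\<i> * - \<i>) ^ k * (\<i>\<^sup>2) ^ j"
      unfolding n power_add power_mult power_mult_distrib by (simp only: mult_ac)
    then show ?thesis by (simp add: Reals_power)
  qed
  have "\<i> ^ n * (of_real (?c k) * ((- \<i>) ^ k * (deriv ^^ k) f (of_real x))) \<in> \<real>" if "k \<le> n" for k
  proof (cases "even (n + k)")
    case True
    have "\<i> ^ n * (of_real (?c k) * ((- \<i>) ^ k * (deriv ^^ k) f (of_real x)))
        = (\<i> ^ n * (- \<i>) ^ k) * (of_real (?c k) * (deriv ^^ k) f (of_real x))" by simp
    then show ?thesis
      by (simp only: Reals_mult unit[OF True that] Reals_of_real higher_deriv_in_Reals[OF assms])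
  qed (simp add: coeff_legendre_normalized coeff_legendre_parity)
  then show ?thesis
    unfolding chromatic_deriv_eq[OF order_refl] sum_distrib_left by (intro sum_in_Reals) auto
qed

lemma chromatic_kernel_holomorphic: "chromatic_kernel n holomorphic_on UNIV"
  unfolding chromatic_kernel_def[abs_def]
  by (intro holomorphic_intros fourier_laplace_holomorphic legendre_window_band_limited)

lemma chromatic_kernel_in_Reals: "chromatic_kernel n (of_real x) \<in> \<real>"
proof -
  have "csinc holomorphic_on UNIV"
    unfolding csinc_eq_fourier_laplace by (intro fourier_laplace_holomorphic legendre_window_band_limited)
  moreover have "csinc (of_real y) \<in> \<real>" for y
    by (auto simp: csinc_def simp flip: of_real_mult sin_of_real)
  ultimately have "chromatic_deriv n csinc (of_real x) \<in> \<real>" by (rule chromatic_deriv_in_Reals)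
  then show ?thesis by (simp add: Reals_power flip: chromatic_deriv_csinc)
qed

text \<open>The spectrum of the shifted kernel is a smooth function cut off at \<open>\<plusminus>\<pi>\<close>; being bounded and
  continuous except at two points, it is the mean-square Fourier transform of the kernel.\<close>

lemma BL_pi_scaled_kernel:
  assumes c: "c \<in> \<real>" and u: "u \<in> \<real>"
  shows "(\<lambda>z. c * chromatic_kernel n (z - u)) \<in> BL_pi"
proof -
  let ?T = "\<lambda>z. c * chromatic_kernel n (z - u)"
  from u obtain v where v: "u = of_real v" by (auto elim: Reals_cases)
  define g where "g x = Re (?T (of_real x))" for x
  have hol: "?T holomorphic_on UNIV"
    by (intro holomorphic_intros holomorphic_on_compose[OF _ holomorphic_on_subset[OF chromatic_kernel_holomorphic], unfolded o_def]) auto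
  have g: "?T (of_real x) = of_real (g x)" for x
  proof -
    have "?T (of_real x) \<in> \<real>"
      using chromatic_kernel_in_Reals[of n "x - v"] c by (simp add: v)
    then show ?thesis by (simp only: g_def of_real_Re)
  qed
  define D where "D \<omega> = 2 * of_real pi * (exp (\<i> * of_real \<omega> * (- u)) * ((c * (- \<i>) ^ n) * legendre_window n \<omega>))" for \<omega>
  have [measurable]: "D \<in> borel_measurable borel" unfolding D_def by measurable
  have T: "?T z = fourier_laplace D z / (2 * of_real pi)" for z
    using chromatic_kernel_combination[of "{n}" "\<lambda>_. c" z u]
    unfolding D_def[abs_def] fourier_laplace_cmult by simp
  obtain B where B: "\<And>\<omega>. cmod (legendre_window n \<omega>) \<le> B" using legendre_window_bounded[of n] by blast
  have bound: "cmod (D \<omega>) \<le> 2 * pi * (cmod c * B)" for \<omega>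
    using B[of \<omega>] by (auto simp: D_def norm_mult norm_power v norm_exp_minus_ii_real intro!: mult_left_mono)
  have supp: "D \<omega> = 0" if "\<omega> \<notin> {-pi..pi}" for \<omega> using that by (simp add: D_def legendre_window_support)
  have cont: "AE \<omega> in lborel. isCont D \<omega>"
  proof -
    have "isCont D \<omega>" if "\<omega> \<noteq> - pi" "\<omega> \<noteq> pi" for \<omega>
    proof (cases "\<omega> \<in> {-pi<..<pi}")
      case True
      let ?E = "\<lambda>\<omega>. 2 * of_real pi * (exp (\<i> * of_real \<omega> * (- u)) * ((c * (- \<i>) ^ n)
          * complex_of_real (poly (legendre_poly_normalized n) \<omega> / (2 * pi))))"
      have "\<forall>\<^sub>F t in nhds \<omega>. D t = ?E t"
        unfolding eventually_nhds using True
        by (intro exI[of _ "{-pi<..<pi}"]) (auto simp: D_def legendre_window_def)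
      moreover have "isCont ?E \<omega>" by (intro continuous_intros) auto
      ultimately show ?thesis by (rule isCont_cong[THEN iffD2])
    next
      case False
      have "\<forall>\<^sub>F t in nhds \<omega>. D t = 0"
        unfolding eventually_nhds using False that
        by (intro exI[of _ "- {-pi..pi}"]) (auto simp: supp closed_atLeastAtMost intro!: open_Compl)
      then show ?thesis using isCont_cong[of D "\<lambda>_. 0"] by simp
    qed
    moreover have "AE \<omega> in lborel. \<omega> \<noteq> - pi" "AE \<omega> in lborel. \<omega> \<noteq> pi"
      by (rule AE_lborel_singleton)+
    ultimately show ?thesis by (auto elim!: eventually_elim2)
  qed
  have "of_real (g x) = fourier_laplace D (of_real x) / (2 * of_real pi)" for x
    by (simp only: g[symmetric] T)
  note transform = has_L2_fourier_transform_fourier_laplace[OF _ bound supp cont this]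
  have "continuous_on UNIV g"
    unfolding g_def[abs_def]
    by (intro continuous_intros continuous_on_compose2[OF holomorphic_on_imp_continuous_on[OF hol]]) auto
  then have "g \<in> BL_pi_real"
    unfolding BL_pi_real_def using transform supp by (auto intro!: exI[of _ D])
  then show ?thesis unfolding BL_pi_def using hol g by auto
qed

lemma BL_pi_real_on_reals: "f \<in> BL_pi \<Longrightarrow> f (of_real x) \<in> \<real>"
  by (auto simp: BL_pi_def)

text \<open>The Cauchy--Schwarz inequality bounds a block of the series by the square root of a tail of the
  square-summable coefficients times a constant that is the same for all real \<open>z\<close>.  Letting the block
  grow, the pointwise limit is \<open>f\<close>.\<close>

lemma chromatic_expansion_uniform:
  assumes f: "f holomorphic_on UNIV" and BL: "f \<in> BL_pi"
  shows "uniform_limit \<real> (\<lambda>N z. \<Sum>n<N. chromatic_deriv n f u * chromatic_kernel n (z - u)) f sequentially"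
proof -
  let ?A = "\<lambda>n. chromatic_deriv n f u"
  let ?S = "\<lambda>N z. \<Sum>n<N. ?A n * chromatic_kernel n (z - u)"
  let ?a = "\<lambda>n. (cmod (?A n))\<^sup>2"
  have summable: "summable ?a" by (rule chromatic_coefficients_square_summable[OF BL])
  define tail where "tail N = suminf ?a - (\<Sum>n<N. ?a n)" for N
  define C where "C = sqrt (exp (2 * pi * \<bar>Im u\<bar>))"
  have bound: "cmod (f z - ?S N z) \<le> sqrt (tail N) * C" if "z \<in> \<real>" for z N
  proof (rule tendsto_upperbound)
    have "(\<lambda>M. ?S M z) \<longlonglongrightarrow> f z"
      using chromatic_expansion_sums[OF f] by (simp add: sums_def)
    then show "(\<lambda>M. cmod (?S M z - ?S N z)) \<longlonglongrightarrow> cmod (f z - ?S N z)"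
      by (intro tendsto_intros)
    show "\<forall>\<^sub>F M in sequentially. cmod (?S M z - ?S N z) \<le> sqrt (tail N) * C"
      using eventually_ge_at_top[of N]
    proof eventually_elim
      case (elim M)
      let ?k = "\<lambda>n. cmod (chromatic_kernel n (z - u))"
      have "{..<M} = {..<N} \<union> {N..<M}" using elim by auto
      then have split: "(\<Sum>n<M. h n) = (\<Sum>n<N. h n) + (\<Sum>n\<in>{N..<M}. h n)" for h :: "nat \<Rightarrow> 'b::comm_monoid_add"
        by (simp add: sum.union_disjoint ivl_disj_int)
      have "cmod (?S M z - ?S N z) \<le> (\<Sum>n\<in>{N..<M}. \<bar>cmod (?A n)\<bar> * \<bar>?k n\<bar>)"
        unfolding split[of "\<lambda>n. ?A n * chromatic_kernel n (z - u)"]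
        by (simp add: sum_norm_le norm_mult)
      also have "\<dots> \<le> L2_set (\<lambda>n. cmod (?A n)) {N..<M} * L2_set ?k {N..<M}"
        by (rule L2_set_mult_ineq)
      also have "\<dots> \<le> sqrt (tail N) * C"
        unfolding L2_set_def C_def
      proof (intro mult_mono real_sqrt_le_mono)
        have "(\<Sum>n<M. ?a n) \<le> suminf ?a" by (intro sum_le_suminf summable) auto
        then show "(\<Sum>n\<in>{N..<M}. ?a n) \<le> tail N"
          unfolding tail_def split[of ?a] by simp
        have "(\<Sum>n\<in>{N..<M}. (?k n)\<^sup>2) \<le> (\<Sum>n<M. (?k n)\<^sup>2)" by (intro sum_mono2) auto
        also have "\<dots> \<le> exp (2 * pi * \<bar>Im (z - u)\<bar>)" by (rule chromatic_kernel_square_sum)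
        also have "\<bar>Im (z - u)\<bar> = \<bar>Im u\<bar>" using that by (simp add: complex_is_Real_iff)
        finally show "(\<Sum>n\<in>{N..<M}. (?k n)\<^sup>2) \<le> exp (2 * pi * \<bar>Im u\<bar>)" .
        show "0 \<le> sqrt (tail N)"
          unfolding tail_def using summable by (auto intro!: sum_le_suminf)
      qed (auto intro!: sum_nonneg)
      finally show ?case .
    qed
  qed simp
  have "tail \<longlonglongrightarrow> suminf ?a - suminf ?a"
    unfolding tail_def by (intro tendsto_intros summable_LIMSEQ summable)
  then have "(\<lambda>N. sqrt (tail N) * C) \<longlonglongrightarrow> sqrt (suminf ?a - suminf ?a) * C"
    by (intro tendsto_intros)
  then have lim: "(\<lambda>N. sqrt (tail N) * C) \<longlonglongrightarrow> 0" by simp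
  show ?thesis
  proof (rule uniform_limitI)
    fix e :: real assume "e > 0"
    with lim have "\<forall>\<^sub>F N in sequentially. sqrt (tail N) * C < e" by (rule order_tendstoD)
    then show "\<forall>\<^sub>F N in sequentially. \<forall>z\<in>\<real>. dist (?S N z) (f z) < e"
    proof eventually_elim
      case (elim N)
      then show ?case
        using bound[of _ N] by (auto simp: dist_norm norm_minus_commute intro: le_less_trans)
    qed
  qed
qed

text \<open>The norms of all blocks starting at \<open>N\<close> are bounded by a tail of the square-summable
  coefficients.  Fatou's lemma passes this bound to the difference of \<open>f\<close> and the partial sum.\<close>

lemma chromatic_expansion_L2:
  assumes f: "f holomorphic_on UNIV" and BL: "f \<in> BL_pi"
  shows "L2_tendsto (\<lambda>N x. \<Sum>n<N. chromatic_deriv n f u * chromatic_kernel n (of_real x - u))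
           (\<lambda>x. f (of_real x)) sequentially"
proof -
  let ?A = "\<lambda>n. chromatic_deriv n f u"
  let ?S = "\<lambda>N x. \<Sum>n<N. ?A n * chromatic_kernel n (complex_of_real x - u)"
  let ?a = "\<lambda>n. (cmod (?A n))\<^sup>2"
  have summable: "summable ?a" by (rule chromatic_coefficients_square_summable[OF BL])
  define tail where "tail N = suminf ?a - (\<Sum>n<N. ?a n)" for N
  define C where "C = exp (2 * pi * \<bar>Im u\<bar>)"
  have cont: "continuous_on UNIV (\<lambda>x. chromatic_kernel n (complex_of_real x - u))" for n
    by (intro continuous_on_compose2[OF holomorphic_on_imp_continuous_on[OF chromatic_kernel_holomorphic]] continuous_intros) auto
  have [measurable]: "(\<lambda>x. chromatic_kernel n (complex_of_real x - u)) \<in> borel_measurable borel" for n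
    by (rule borel_measurable_continuous_onI[OF cont])
  have bound: "(\<integral>\<^sup>+x. ennreal ((cmod (?S N x - f (of_real x)))\<^sup>2) \<partial>lborel) \<le> ennreal (C * tail N)" for N
  proof -
    have lim: "(\<lambda>M. ennreal ((cmod (?S N x - ?S M x))\<^sup>2)) \<longlonglongrightarrow> ennreal ((cmod (?S N x - f (of_real x)))\<^sup>2)" for x
      using chromatic_expansion_sums[OF f, of u "of_real x"] unfolding sums_def by (intro tendsto_intros)
    have "(\<integral>\<^sup>+x. ennreal ((cmod (?S N x - f (of_real x)))\<^sup>2) \<partial>lborel)
        = (\<integral>\<^sup>+x. liminf (\<lambda>M. ennreal ((cmod (?S N x - ?S M x))\<^sup>2)) \<partial>lborel)"
      by (intro nn_integral_cong lim_imp_Liminf[OF sequentially_bot lim, symmetric])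
    also have "\<dots> \<le> liminf (\<lambda>M. \<integral>\<^sup>+x. ennreal ((cmod (?S N x - ?S M x))\<^sup>2) \<partial>lborel)"
      by (rule nn_integral_liminf) measurable
    also have "\<dots> \<le> liminf (\<lambda>M::nat. ennreal (C * tail N))"
    proof (rule Liminf_mono, use eventually_ge_at_top[of N] in eventually_elim)
      case (elim M)
      have "{..<M} = {..<N} \<union> {N..<M}" using elim by auto
      then have split: "(\<Sum>n<M. h n) = (\<Sum>n<N. h n) + (\<Sum>n\<in>{N..<M}. h n)" for h :: "nat \<Rightarrow> 'b::comm_monoid_add"
        by (simp add: sum.union_disjoint ivl_disj_int)
      have "cmod (?S N x - ?S M x) = cmod (\<Sum>n\<in>{N..<M}. ?A n * chromatic_kernel n (of_real x - u))" for x
        unfolding split[of "\<lambda>n. ?A n * chromatic_kernel n (complex_of_real x - u)"] by simp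
      then have "(\<integral>\<^sup>+x. ennreal ((cmod (?S N x - ?S M x))\<^sup>2) \<partial>lborel) \<le> ennreal (C * (\<Sum>n\<in>{N..<M}. ?a n))"
        unfolding C_def using chromatic_kernel_combination_L2[of "{N..<M}" ?A u] by simp
      also have "\<dots> \<le> ennreal (C * tail N)"
      proof (intro ennreal_leI mult_left_mono)
        have "(\<Sum>n<M. ?a n) \<le> suminf ?a" by (intro sum_le_suminf summable) auto
        then show "(\<Sum>n\<in>{N..<M}. ?a n) \<le> tail N"
          unfolding tail_def split[of ?a] by simp
      qed (simp add: C_def)
      finally show ?case .
    qed
    also have "\<dots> = ennreal (C * tail N)" by (simp add: Liminf_const)
    finally show ?thesis .
  qed
  have "tail \<longlonglongrightarrow> suminf ?a - suminf ?a"
    unfolding tail_def by (intro tendsto_intros summable_LIMSEQ summable)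
  then have "(\<lambda>N. ennreal (C * tail N)) \<longlonglongrightarrow> ennreal (C * (suminf ?a - suminf ?a))"
    by (intro tendsto_intros)
  then have "(\<lambda>N. ennreal (C * tail N)) \<longlonglongrightarrow> 0" by simp
  then show ?thesis
    unfolding L2_tendsto_def
    by (rule tendsto_sandwich[OF _ _ tendsto_const, rotated 2]) (use bound in auto)
qed

theorem proposition1p1:
  fixes f :: "complex \<Rightarrow> complex"
  assumes "f holomorphic_on UNIV"
  shows "\<forall>u. \<forall>T \<in> {\<lambda>n z. chromatic_deriv n f u * chromatic_deriv n (\<lambda>v. csinc (z - v)) u,
                    \<lambda>n z. (- 1) ^ n * chromatic_deriv n f u * chromatic_deriv n csinc (z - u),
                    \<lambda>n z. chromatic_deriv n f u * of_real (sqrt (2 * real n + 1))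
                            * spherical_bessel_j n (of_real pi * (z - u))}.
           (\<forall>z. (\<lambda>n. T n z) sums f z) \<and>
           (f \<in> BL_pi \<longrightarrow>
              uniform_limit \<real> (\<lambda>N z. \<Sum>n<N. T n z) f sequentially \<and>
              (u \<in> \<real> \<longrightarrow> (\<forall>n. T n \<in> BL_pi)) \<and>
              L2_tendsto (\<lambda>N x. \<Sum>n<N. T n (of_real x)) (\<lambda>x. f (of_real x)) sequentially)"
proof (intro allI ballI)
  fix u T
  assume "T \<in> {\<lambda>n z. chromatic_deriv n f u * chromatic_deriv n (\<lambda>v. csinc (z - v)) u,
                    \<lambda>n z. (- 1) ^ n * chromatic_deriv n f u * chromatic_deriv n csinc (z - u),
                    \<lambda>n z. chromatic_deriv n f u * of_real (sqrt (2 * real n + 1))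
                            * spherical_bessel_j n (of_real pi * (z - u))}"
  then have T: "T = (\<lambda>n z. chromatic_deriv n f u * chromatic_kernel n (z - u))"
  proof (elim insertE emptyE)
    assume "T = (\<lambda>n z. chromatic_deriv n f u * chromatic_deriv n (\<lambda>v. csinc (z - v)) u)"
    then show ?thesis by (simp only: chromatic_deriv_csinc_shifted)
  next
    assume "T = (\<lambda>n z. (- 1) ^ n * chromatic_deriv n f u * chromatic_deriv n csinc (z - u))"
    then show ?thesis by (simp add: mult_ac flip: chromatic_deriv_csinc)
  next
    assume "T = (\<lambda>n z. chromatic_deriv n f u * of_real (sqrt (2 * real n + 1))
                            * spherical_bessel_j n (of_real pi * (z - u)))"
    then show ?thesis by (simp only: chromatic_kernel_eq_spherical_bessel mult.assoc)
  qed
  have "T n \<in> BL_pi" if "f \<in> BL_pi" "u \<in> \<real>" for n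
  proof -
    from that(2) obtain v where "u = of_real v" by (rule Reals_cases)
    then have "chromatic_deriv n f u \<in> \<real>"
      using chromatic_deriv_in_Reals[OF assms BL_pi_real_on_reals[OF that(1)]] by simp
    then show ?thesis unfolding T using that(2) by (rule BL_pi_scaled_kernel)
  qed
  then show "(\<forall>z. (\<lambda>n. T n z) sums f z) \<and>
           (f \<in> BL_pi \<longrightarrow>
              uniform_limit \<real> (\<lambda>N z. \<Sum>n<N. T n z) f sequentially \<and>
              (u \<in> \<real> \<longrightarrow> (\<forall>n. T n \<in> BL_pi)) \<and>
              L2_tendsto (\<lambda>N x. \<Sum>n<N. T n (of_real x)) (\<lambda>x. f (of_real x)) sequentially)"
    using chromatic_expansion_sums[OF assms] chromatic_expansion_uniform[OF assms]
      chromatic_expansion_L2[OF assms] by (simp add: T)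
qed

end
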